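(* Let $\mu$ be a measure on $\mathbb{R}^n$ of the form $\mu=\sum_{\lambda\in\Lambda}\mu(\lambda)\delta_\lambda$, $\mu(\lambda)\neq0$ for all $\lambda\in\Lambda$, with uniformly discrete support $\Lambda$, and assume that $\hat\mu$ is a slowly increasing measure. Then the discrete part of $\hat\mu$ is the Fourier transform of a measure $\mu'$ on $\mathbb{R}^n$ of the form $\mu'=\sum_{\lambda\in\Lambda'}\mu'(\lambda)\delta_\lambda$, $\mu'(\lambda)\neq 0$ for all $\lambda\in\Lambda'$, whose support $\Lambda'$ is also a uniformly discrete set.
   Context: A "measure" on $\mathbb{R}^n$ means a complex, locally finite measure $\mu$ that is slowly increasing: there is $N$ with $|\mu|(\{|x|<R\})=O(R^N)$ as $R\to\infty$. Such a measure is a temperate distribution, and $\hat\mu$ denotes its distributional Fourier transform, $\langle\hat\mu,\varphi\rangle=\langle\mu,\hat\varphi\rangle$ for Schwartz $\varphi$, with $\hat\varphi(t)=\int\varphi(x)e^{-2\pi i\langle t,x\rangle}dx$. $\delta_x$ is the unit point mass at $x$. The discrete part of a measure $\nu$ is the pure point measure $\nu_d$ in the unique decomposition $\nu=\nu_d+\nu_c$ with $\nu_d$ pure point and $\nu_c$ continuous (without atoms). A set $A\subset\mathbb{R}^n$ is uniformly discrete if $\inf\{|x-y|:x,y\in A,\ x\neq y\}>0$ (the empty set is allowed). *)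

theory Defs
  imports "HOL-Analysis.Analysis" "HOL-Library.Landau_Symbols"
begin

text \<open>
  A complex, locally finite measure need not have a value on unbounded sets, so it is a set
  function on the bounded Borel sets. Values elsewhere are normalised to 0, so that equality of
  set functions is equality of measures.
\<close>

definition bounded_borel :: "(real ^ 'n) set set" where
  "bounded_borel = {A. A \<in> sets borel \<and> bounded A}"

definition variation :: "((real ^ 'n) set \<Rightarrow> complex) \<Rightarrow> (real ^ 'n) set \<Rightarrow> ennreal" where
  "variation \<mu> A =
     (SUP P \<in> {P. finite P \<and> P \<subseteq> sets borel \<and> partition_on A P}. \<Sum>B\<in>P. ennreal (cmod (\<mu> B)))"

definition complex_measure :: "((real ^ 'n) set \<Rightarrow> complex) \<Rightarrow> bool" where
  "complex_measure \<mu> \<longleftrightarrow>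
     (\<forall>A. A \<notin> bounded_borel \<longrightarrow> \<mu> A = 0) \<and>
     (\<forall>A :: nat \<Rightarrow> (real ^ 'n) set.
        range A \<subseteq> bounded_borel \<longrightarrow> disjoint_family A \<longrightarrow> bounded (\<Union>i. A i) \<longrightarrow>
        (\<lambda>i. \<mu> (A i)) sums \<mu> (\<Union>i. A i)) \<and>
     (\<forall>A \<in> bounded_borel. variation \<mu> A < \<infinity>)"

definition slowly_increasing :: "((real ^ 'n) set \<Rightarrow> complex) \<Rightarrow> bool" where
  "slowly_increasing \<mu> \<longleftrightarrow>
     complex_measure \<mu> \<and>
     (\<exists>N::nat. (\<lambda>R::real. enn2real (variation \<mu> {x. norm x < R})) \<in> O[at_top](\<lambda>R. R ^ N))"

text \<open>
  The positive variation of a real set function, as a positive Borel measure; applied to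
  \<open>\<nu>\<close> and to \<open>- \<nu>\<close> it gives the Jordan decomposition of \<open>\<nu>\<close>. The supremum ranges over the
  bounded sets only because \<open>\<nu>\<close> is not defined on others.
\<close>

definition positive_variation :: "((real ^ 'n) set \<Rightarrow> real) \<Rightarrow> (real ^ 'n) measure" where
  "positive_variation \<nu> =
     measure_of UNIV (sets borel) (\<lambda>A. SUP B \<in> {B \<in> bounded_borel. B \<subseteq> A}. ennreal (\<nu> B))"

definition pairing :: "((real ^ 'n) set \<Rightarrow> complex) \<Rightarrow> (real ^ 'n \<Rightarrow> complex) \<Rightarrow> complex" where
  "pairing \<mu> f =
     (\<integral>x. f x \<partial>positive_variation (\<lambda>A. Re (\<mu> A))) -
     (\<integral>x. f x \<partial>positive_variation (\<lambda>A. - Re (\<mu> A))) +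
     \<i> * ((\<integral>x. f x \<partial>positive_variation (\<lambda>A. Im (\<mu> A))) -
          (\<integral>x. f x \<partial>positive_variation (\<lambda>A. - Im (\<mu> A))))"

text \<open>This is \<open>\<mu> = (\<Sum>x\<in>\<Lambda>. \<mu> {x} \<delta>\<^sub>x)\<close>, evaluated on each bounded Borel set.\<close>

definition sum_of_point_masses ::
    "(real ^ 'n) set \<Rightarrow> ((real ^ 'n) set \<Rightarrow> complex) \<Rightarrow> bool" where
  "sum_of_point_masses \<Lambda> \<mu> \<longleftrightarrow>
     (\<forall>A \<in> bounded_borel. ((\<lambda>x. \<mu> {x}) has_sum \<mu> A) (A \<inter> \<Lambda>))"

definition pure_point :: "((real ^ 'n) set \<Rightarrow> complex) \<Rightarrow> bool" where
  "pure_point \<mu> \<longleftrightarrow> complex_measure \<mu> \<and> (\<exists>S. countable S \<and> sum_of_point_masses S \<mu>)"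

definition continuous_measure :: "((real ^ 'n) set \<Rightarrow> complex) \<Rightarrow> bool" where
  "continuous_measure \<mu> \<longleftrightarrow> complex_measure \<mu> \<and> (\<forall>x. \<mu> {x} = 0)"

definition discrete_part ::
    "((real ^ 'n) set \<Rightarrow> complex) \<Rightarrow> (real ^ 'n) set \<Rightarrow> complex" where
  "discrete_part \<nu> =
     (THE \<nu>d. pure_point \<nu>d \<and> (\<exists>\<nu>c. continuous_measure \<nu>c \<and> (\<forall>A. \<nu> A = \<nu>d A + \<nu>c A)))"

primrec iterated_partial ::
    "'n list \<Rightarrow> (real ^ 'n \<Rightarrow> complex) \<Rightarrow> real ^ 'n \<Rightarrow> complex" where
  "iterated_partial [] f = f"
| "iterated_partial (i # is) f =
     (\<lambda>x. frechet_derivative (iterated_partial is f) (at x) (axis i 1))"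

definition schwartz :: "(real ^ 'n \<Rightarrow> complex) \<Rightarrow> bool" where
  "schwartz f \<longleftrightarrow>
     (\<forall>is x. iterated_partial is f differentiable (at x)) \<and>
     (\<forall>k::nat. \<forall>is. bounded (range (\<lambda>x. norm x ^ k * cmod (iterated_partial is f x))))"

definition fourier :: "(real ^ 'n \<Rightarrow> complex) \<Rightarrow> real ^ 'n \<Rightarrow> complex" where
  "fourier f t = (\<integral>x. f x * exp (- 2 * of_real pi * \<i> * of_real (t \<bullet> x)) \<partial>lborel)"

text \<open>Here \<open>\<nu>\<close> represents the tempered distribution that is the Fourier transform of \<open>\<mu>\<close>.\<close>

definition has_fourier_transform ::
    "((real ^ 'n) set \<Rightarrow> complex) \<Rightarrow> ((real ^ 'n) set \<Rightarrow> complex) \<Rightarrow> bool" where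
  "has_fourier_transform \<mu> \<nu> \<longleftrightarrow>
     slowly_increasing \<mu> \<and> slowly_increasing \<nu> \<and>
     (\<forall>\<phi>. schwartz \<phi> \<longrightarrow> pairing \<nu> \<phi> = pairing \<mu> (fourier \<phi>))"

end

theory Submission
  imports Defs "HOL-Library.Diagonal_Subsequence"
begin

text \<open>
  Let \<open>\<nu>\<close> be the Fourier transform of \<open>\<mu>\<close>. Multiplying \<open>\<nu>\<close> by the character \<open>x \<mapsto> exp (2 \<pi> \<i> \<tau> \<bullet> x)\<close>
  translates \<open>\<mu>\<close> by \<open>- \<tau>\<close>. Frequencies \<open>\<tau>\<^sub>j\<close> are chosen so that these characters tend to 1 at every
  atom of \<open>\<nu>\<close>, while the integrals of test functions against the modulated continuous part tend to 0:
  by Wiener's lemma almost all \<open>\<tau>\<close> are good for the continuous part, so there is a sequence all of whose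
  differences are good, and by compactness some differences are also almost periods of finitely many atoms.
  Hence the modulated \<open>\<nu>\<close> tends to its discrete part. On the other side, testing with narrow Gaussians
  shows that the masses of \<open>\<mu>\<close> are bounded, so the translates of \<open>\<mu>\<close>, whose supports are separated by
  the same distance, have a subsequence converging to a measure of the same kind.
\<close>

text \<open>The continuous part of \<open>\<nu>\<close> may be singular, so its modulations need not
  tend to 0 along all large frequencies. Wiener's lemma controls only a mean over many frequencies
  and leaves no say in which good frequency is found, whereas the atoms ask for an almost period.
  Differences reconcile the two demands: smallness can be imposed on all differences of one
  sequence, and compactness alone makes some of these differences almost periods. One sequence of
  frequencies can meet only countably many demands. The continuous part is therefore tested on
  dyadic cells, and approximation in the mean extends the convergence to every test function.
  Translates of \<open>\<mu>\<close> could lose compactness through their masses, which slow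
  increase alone allows to grow polynomially. Here the assumption on \<open>\<nu>\<close> acts a
  second time: as a measure it bounds the pairings with all modulations of one function at once. A
  mass may tend to 0 along the subsequence, so the new support keeps only the limit positions with
  nonzero limit mass; it may be empty.\<close>

no_notation Infinite_Sum.abs_summable_on (infixr \<open>abs'_summable'_on\<close> 46)

section \<open>Polynomial growth and separated sets\<close>

text \<open>Arises from cutting along shells \<open>j \<le> g x < j + 1\<close>: growth gives a
  shell mass at most \<open>C * (2 + j) ^ N \<le> C * 2 ^ N * (1 + j) ^ N\<close>, and the weight
  \<open>1 / (1 + j) ^ (N + 2)\<close> leaves inverse squares.\<close>

definition shell_const :: "nat \<Rightarrow> real" where
  "shell_const N = 2 ^ N * (\<Sum>j. 1 / (1 + real j)^2)"

lemma summable_inverse_squares_Suc: "summable (\<lambda>j. 1 / (1 + real j)^2)"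
proof -
  have "summable (\<lambda>n. inverse (real n ^ 2))" by (rule inverse_power_summable) simp
  hence "summable (\<lambda>n. inverse (real (Suc n) ^ 2))" by (subst summable_Suc_iff)
  thus ?thesis by (simp add: inverse_eq_divide)
qed

lemma shell_const_nonneg: "0 \<le> shell_const N"
  unfolding shell_const_def by (intro mult_nonneg_nonneg suminf_nonneg summable_inverse_squares_Suc) auto

text \<open>Kept general in \<open>M\<close> and \<open>g\<close> because it serves both counting
  measure on a separated set and Borel measures of polynomial growth. The weight exceeds the growth
  by the exponent 2 so that the shells sum like inverse squares.\<close>

lemma nn_integral_polynomial_growth:
  fixes g :: "'a \<Rightarrow> real"
  assumes [measurable]: "g \<in> borel_measurable M"
    and nn: "\<And>x. x \<in> space M \<Longrightarrow> 0 \<le> g x" and C: "0 \<le> C"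
    and growth: "\<And>R. 0 \<le> R \<Longrightarrow> emeasure M {x \<in> space M. g x < R} \<le> ennreal (C * (1 + R) ^ N)"
  shows "(\<integral>\<^sup>+x. ennreal (1 / (1 + g x) ^ (N + 2)) \<partial>M) \<le> ennreal (C * shell_const N)"
proof -
  define s where "s j = {x \<in> space M. real j \<le> g x \<and> g x < real j + 1}" for j
  have [measurable]: "s j \<in> sets M" for j unfolding s_def by measurable
  define w where "w j = 1 / (1 + real j) ^ (N + 2)" for j
  have w0: "0 \<le> w j" for j by (simp add: w_def)
  have pt: "ennreal (1 / (1 + g x) ^ (N + 2)) \<le> (\<Sum>j. ennreal (w j) * indicator (s j) x)"
    if x: "x \<in> space M" for x
  proof -
    define j where "j = nat \<lfloor>g x\<rfloor>"
    have j: "real j \<le> g x" "g x < real j + 1" using nn[OF x] unfolding j_def by linarith+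
    hence "x \<in> s j" using x by (auto simp: s_def)
    have "1 / (1 + g x) ^ (N + 2) \<le> w j"
      unfolding w_def using j nn[OF x] by (intro divide_left_mono power_mono mult_pos_pos zero_less_power) auto
    hence "ennreal (1 / (1 + g x) ^ (N + 2)) \<le> ennreal (w j)" by (rule ennreal_leI)
    also have "\<dots> = (\<Sum>i\<in>{j}. ennreal (w i) * indicator (s i) x)" using \<open>x \<in> s j\<close> by simp
    also have "\<dots> \<le> (\<Sum>i. ennreal (w i) * indicator (s i) x)"
      by (rule sum_le_suminf) auto
    finally show ?thesis .
  qed
  have smm: "summable (\<lambda>j. 1 / (1 + real j)^2)" by (rule summable_inverse_squares_Suc)
  have summand: "w j * (C * (1 + (real j + 1)) ^ N) \<le> C * 2 ^ N * (1 / (1 + real j)^2)" for j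
  proof -
    have "(1 + (real j + 1)) ^ N \<le> (2 * (1 + real j)) ^ N" by (intro power_mono) auto
    hence "w j * (C * (1 + (real j + 1)) ^ N) \<le> w j * (C * (2 * (1 + real j)) ^ N)"
      using C w0 by (intro mult_left_mono) auto
    also have "\<dots> = C * 2 ^ N * (1 / (1 + real j)^2)"
    proof -
      define y where "y = 1 + real j"
      have "0 < y" by (simp add: y_def)
      thus ?thesis unfolding w_def y_def[symmetric]
        by (simp add: power_mult_distrib power_add power2_eq_square)
    qed
    finally show ?thesis .
  qed
  have "(\<integral>\<^sup>+x. ennreal (1 / (1 + g x) ^ (N + 2)) \<partial>M) \<le>
      (\<integral>\<^sup>+x. (\<Sum>j. ennreal (w j) * indicator (s j) x) \<partial>M)"
    by (intro nn_integral_mono pt)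
  also have "\<dots> = (\<Sum>j. \<integral>\<^sup>+x. ennreal (w j) * indicator (s j) x \<partial>M)"
    by (intro nn_integral_suminf) auto
  also have "\<dots> = (\<Sum>j. ennreal (w j) * emeasure M (s j))"
    by (simp add: nn_integral_cmult_indicator)
  also have "\<dots> \<le> (\<Sum>j. ennreal (C * 2 ^ N * (1 / (1 + real j)^2)))"
  proof (intro suminf_le summableI)
    fix j
    have "emeasure M (s j) \<le> emeasure M {x \<in> space M. g x < real j + 1}"
      by (intro emeasure_mono) (auto simp: s_def)
    also have "\<dots> \<le> ennreal (C * (1 + (real j + 1)) ^ N)" by (rule growth) auto
    finally have "ennreal (w j) * emeasure M (s j) \<le> ennreal (w j) * ennreal (C * (1 + (real j + 1)) ^ N)"
      by (intro mult_left_mono) auto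
    also have "\<dots> = ennreal (w j * (C * (1 + (real j + 1)) ^ N))"
      using w0 C by (simp add: ennreal_mult)
    also have "\<dots> \<le> ennreal (C * 2 ^ N * (1 / (1 + real j)^2))"
      by (intro ennreal_leI summand)
    finally show "ennreal (w j) * emeasure M (s j) \<le> \<dots>" .
  qed
  also have "\<dots> = ennreal (\<Sum>j. C * 2 ^ N * (1 / (1 + real j)^2))"
    using C by (intro suminf_ennreal2 summable_mult smm) auto
  also have "(\<Sum>j. C * 2 ^ N * (1 / (1 + real j)^2)) = C * shell_const N"
    by (subst suminf_mult[OF smm]) (simp add: shell_const_def)
  finally show ?thesis .
qed

abbreviation separated :: "real \<Rightarrow> 'a::metric_space set \<Rightarrow> bool" where
  "separated \<delta> S \<equiv> \<forall>x\<in>S. \<forall>y\<in>S. dist x y < \<delta> \<longrightarrow> x = y"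

text \<open>The ratio of radii in the packing argument is
  \<open>(R + \<delta>/2) / (\<delta>/2) = 2 * R / \<delta> + 1\<close>, which is at most
  \<open>(2 / \<delta> + 1) * (1 + R)\<close>.\<close>

definition separation_const :: "nat \<Rightarrow> real \<Rightarrow> real" where
  "separation_const n \<delta> = (2 / \<delta> + 1) ^ n"

lemma separation_const_nonneg: "0 < \<delta> \<Longrightarrow> 0 \<le> separation_const n \<delta>"
  by (simp add: separation_const_def)

text \<open>Packing: the balls of radius \<open>\<delta>/2\<close> about the points are disjoint and
  lie in the ball of radius \<open>R + \<delta>/2\<close>, so volumes can be compared.\<close>

lemma separated_card_le:
  fixes S :: "'a::euclidean_space set"
  assumes \<delta>: "0 < \<delta>" and sep: "separated \<delta> S" and R: "0 \<le> R"
  shows "finite {x \<in> S. norm x < R}"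
    and "real (card {x \<in> S. norm x < R}) \<le> separation_const DIM('a) \<delta> * (1 + R) ^ DIM('a)"
proof -
  let ?n = "DIM('a)" and ?c = "unit_ball_vol (real DIM('a))"
  \<comment> \<open>Finite subsets come first: their uniform packing bound also excludes that the
    whole set is infinite.\<close>
  have bnd: "real (card F) \<le> separation_const ?n \<delta> * (1 + R) ^ ?n"
    if F: "F \<subseteq> {x \<in> S. norm x < R}" "finite F" for F
  proof -
    have disj: "disjoint_family_on (\<lambda>x. ball x (\<delta>/2)) F"
    proof (unfold disjoint_family_on_def, intro ballI impI)
      fix x y assume xy: "x \<in> F" "y \<in> F" "x \<noteq> y"
      hence "\<not> dist x y < \<delta>" using sep F by blast
      thus "ball x (\<delta>/2) \<inter> ball y (\<delta>/2) = {}"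
        by (intro disjoint_ballI) auto
    qed
    have "real (card F) * (?c * (\<delta>/2) ^ ?n) = (\<Sum>x\<in>F. measure lborel (ball x (\<delta>/2)))"
      using \<delta> by (simp add: content_ball)
    also have "\<dots> = measure lborel (\<Union>x\<in>F. ball x (\<delta>/2))"
      using F disj by (intro measure_finite_Union[symmetric]) (auto simp: emeasure_lborel_ball_finite[unfolded infinity_ennreal_def, THEN less_imp_neq])
    also have "\<dots> \<le> measure lborel (ball (0::'a) (R + \<delta>/2))"
    proof (rule measure_mono_fmeasurable)
      show "(\<Union>x\<in>F. ball x (\<delta>/2)) \<subseteq> ball 0 (R + \<delta>/2)"
      proof safe
        fix x y assume "x \<in> F" "y \<in> ball x (\<delta>/2)"
        hence "norm x < R" "dist x y < \<delta>/2" using F by auto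
        thus "y \<in> ball 0 (R + \<delta>/2)" using norm_triangle_ineq2[of y x] by (auto simp: dist_norm norm_minus_commute)
      qed
    qed (use F in \<open>auto intro!: sets.finite_UN simp: fmeasurable_def emeasure_lborel_ball_finite[unfolded infinity_ennreal_def]\<close>)
    also have "\<dots> = ?c * (R + \<delta>/2) ^ ?n" using R \<delta> by (simp add: content_ball)
    finally have "real (card F) * (\<delta>/2) ^ ?n \<le> (R + \<delta>/2) ^ ?n"
      by (simp add: mult.left_commute)
    hence "real (card F) \<le> ((R + \<delta>/2) / (\<delta>/2)) ^ ?n"
      using \<delta> by (subst power_divide, subst pos_le_divide_eq) auto
    also have "\<dots> \<le> ((2/\<delta> + 1) * (1 + R)) ^ ?n"
      using \<delta> R by (intro power_mono) (auto simp: field_simps)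
    finally show ?thesis by (simp add: separation_const_def power_mult_distrib)
  qed
  show fin: "finite {x \<in> S. norm x < R}"
  proof (rule ccontr)
    assume inf: "infinite {x \<in> S. norm x < R}"
    obtain B where "finite B" "card B = nat \<lceil>separation_const ?n \<delta> * (1 + R) ^ ?n\<rceil> + 1" "B \<subseteq> {x \<in> S. norm x < R}"
      using infinite_arbitrarily_large[OF inf] by blast
    with bnd[of B] show False by (smt (verit) of_nat_add of_nat_1 real_nat_ceiling_ge)
  qed
  show "real (card {x \<in> S. norm x < R}) \<le> separation_const ?n \<delta> * (1 + R) ^ ?n"
    using bnd[OF order_refl fin] .
qed

text \<open>The bound depends on the set only through its separation, hence is uniform over translates.\<close>

lemma separated_abs_summable:
  fixes S :: "'a::euclidean_space set"
  assumes \<delta>: "0 < \<delta>" and sep: "separated \<delta> S"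
  shows "(\<lambda>x. 1 / (1 + norm x) ^ (DIM('a) + 2)) abs_summable_on S"
    and "(\<Sum>\<^sub>ax\<in>S. 1 / (1 + norm x) ^ (DIM('a) + 2)) \<le> separation_const DIM('a) \<delta> * shell_const DIM('a)"
proof -
  have le: "(\<integral>\<^sup>+x. ennreal (1 / (1 + norm x) ^ (DIM('a) + 2)) \<partial>count_space S)
      \<le> ennreal (separation_const DIM('a) \<delta> * shell_const DIM('a))"
  proof (rule nn_integral_polynomial_growth)
    fix R :: real assume R: "0 \<le> R"
    have "emeasure (count_space S) {x \<in> space (count_space S). norm x < R} = ennreal (real (card {x \<in> S. norm x < R}))"
      using separated_card_le(1)[OF \<delta> sep R] by (subst emeasure_count_space_finite) (auto simp: ennreal_of_nat_eq_real_of_nat)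
    also have "\<dots> \<le> ennreal (separation_const DIM('a) \<delta> * (1 + R) ^ DIM('a))"
      by (intro ennreal_leI separated_card_le(2)[OF \<delta> sep R])
    finally show "emeasure (count_space S) {x \<in> space (count_space S). norm x < R} \<le> \<dots>" .
  qed (auto intro: separation_const_nonneg \<delta>)
  show 1: "(\<lambda>x. 1 / (1 + norm x) ^ (DIM('a) + 2)) abs_summable_on S"
    unfolding abs_summable_on_def
    by (rule integrableI_bounded) (use le in \<open>auto simp: order_le_less_trans\<close>)
  have "ennreal (\<Sum>\<^sub>ax\<in>S. 1 / (1 + norm x) ^ (DIM('a) + 2)) \<le> ennreal (separation_const DIM('a) \<delta> * shell_const DIM('a))"
    using le by (subst (asm) nn_integral_conv_infsetsum[OF 1]) auto
  thus "(\<Sum>\<^sub>ax\<in>S. 1 / (1 + norm x) ^ (DIM('a) + 2)) \<le> separation_const DIM('a) \<delta> * shell_const DIM('a)"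
    by (subst (asm) ennreal_le_iff) (auto intro!: mult_nonneg_nonneg separation_const_nonneg shell_const_nonneg \<delta>)
qed

section \<open>Jordan decomposition\<close>

lemma bounded_borel_iff: "A \<in> bounded_borel \<longleftrightarrow> A \<in> sets borel \<and> bounded A"
  by (simp add: bounded_borel_def)

lemma bounded_borelD [measurable_dest]: "A \<in> bounded_borel \<Longrightarrow> A \<in> sets borel"
  by (simp add: bounded_borel_def)

lemma bounded_borel_subset: "A \<in> bounded_borel \<Longrightarrow> B \<in> sets borel \<Longrightarrow> B \<subseteq> A \<Longrightarrow> B \<in> bounded_borel"
  by (auto simp: bounded_borel_def intro: bounded_subset)

lemma open_ball_bounded_borel: "{x :: real ^ 'n. norm x < R} \<in> bounded_borel"
proof -
  have "{x :: real ^ 'n. norm x < R} = ball 0 R" by auto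
  thus ?thesis by (auto simp: bounded_borel_def)
qed

section \<open>Total variation of a set function\<close>

lemma variation_ge_sum:
  assumes "finite P" "P \<subseteq> sets borel" "partition_on A P"
  shows "(\<Sum>B\<in>P. ennreal (cmod (\<mu> B))) \<le> variation \<mu> A"
  unfolding variation_def by (rule SUP_upper) (use assms in auto)

lemma variation_leI:
  assumes "\<And>P. finite P \<Longrightarrow> P \<subseteq> sets borel \<Longrightarrow> partition_on A P \<Longrightarrow> (\<Sum>B\<in>P. ennreal (cmod (\<mu> B))) \<le> c"
  shows "variation \<mu> A \<le> c"
  unfolding variation_def by (rule SUP_least) (use assms in auto)

text \<open>The set \<open>A - F\<close> may be empty while a partition has no empty block; hence
  the removal of \<open>{}\<close>.\<close>

lemma partition_on_singletons:
  assumes "F \<subseteq> A"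
  shows  "partition_on A (insert (A - F) ((\<lambda>x. {x}) ` F) - {{}})"
proof (rule partition_onI)
  have "\<Union>(S - {{}}) = \<Union>S" for S :: "'a set set" by blast
  thus "\<Union>(insert (A - F) ((\<lambda>x. {x}) ` F) - {{}}) = A" using assms by auto
  have *: "disjnt B C" if "B = A - F \<or> (\<exists>x\<in>F. B = {x})" "C = A - F \<or> (\<exists>x\<in>F. C = {x})" "B \<noteq> C" for B C
    using that by (auto simp: disjnt_iff)
  show "disjnt B C" if "B \<in> insert (A - F) ((\<lambda>x. {x}) ` F) - {{}}" "C \<in> insert (A - F) ((\<lambda>x. {x}) ` F) - {{}}" "B \<noteq> C" for B C
    by (rule *) (use that in \<open>simp_all add: image_iff\<close>)
qed simp

locale locally_finite_complex_measure =
  fixes \<mu> :: "(real ^ 'n) set \<Rightarrow> complex"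
  assumes cm: "complex_measure \<mu>"
begin

lemma sums_disjoint:
  assumes "\<And>i. A i \<in> bounded_borel" "disjoint_family A" "bounded (\<Union>i::nat. A i)"
  shows "(\<lambda>i. \<mu> (A i)) sums \<mu> (\<Union>i. A i)"
  using cm assms unfolding complex_measure_def by blast

lemma outside: "A \<notin> bounded_borel \<Longrightarrow> \<mu> A = 0"
  using cm unfolding complex_measure_def by blast

text \<open>The constant sequence of empty sets is a disjoint family, and a constant series
  converges only if its term is 0.\<close>

lemma empty [simp]: "\<mu> {} = 0"
proof -
  have "(\<lambda>i::nat. \<mu> {}) sums \<mu> (\<Union>i::nat. {})"
    by (rule sums_disjoint) (auto simp: bounded_borel_def disjoint_family_on_def)
  hence "summable (\<lambda>i::nat. \<mu> {})" by (simp add: sums_iff)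
  hence "(\<lambda>i::nat. \<mu> {}) \<longlonglongrightarrow> 0" by (rule summable_LIMSEQ_zero)
  thus ?thesis by (simp add: LIMSEQ_const_iff)
qed

lemma additive:
  assumes A: "A \<in> bounded_borel" and B: "B \<in> bounded_borel" and "A \<inter> B = {}"
  shows "\<mu> (A \<union> B) = \<mu> A + \<mu> B"
proof -
  have "(\<lambda>i. \<mu> (binaryset A B i)) sums \<mu> (\<Union>i. binaryset A B i)"
  proof (rule sums_disjoint)
    show "binaryset A B i \<in> bounded_borel" for i
      using A B by (auto simp: binaryset_def bounded_borel_def)
    show "disjoint_family (binaryset A B)"
      using assms by (auto simp: disjoint_family_on_def binaryset_def)
    show "bounded (\<Union>i. binaryset A B i)" using A B by (simp add: UN_binaryset_eq bounded_borel_def)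
  qed
  hence "(\<lambda>i. \<mu> (binaryset A B i)) sums \<mu> (A \<union> B)" by (simp add: UN_binaryset_eq)
  thus ?thesis using binaryset_sums[of \<mu> A B] by (simp add: sums_unique2)
qed

lemma diff:
  assumes A: "A \<in> bounded_borel" and B: "B \<in> sets borel" "B \<subseteq> A"
  shows "\<mu> (A - B) = \<mu> A - \<mu> B"
proof -
  have "\<mu> (B \<union> (A - B)) = \<mu> B + \<mu> (A - B)"
    using A B by (intro additive bounded_borel_subset[OF A]) auto
  moreover have "B \<union> (A - B) = A" using B by auto
  ultimately show ?thesis by simp
qed

lemma variation_finite: "A \<in> bounded_borel \<Longrightarrow> variation \<mu> A < \<infinity>"
  using cm unfolding complex_measure_def by blast

lemma norm_le_variation:
  assumes A: "A \<in> sets borel" and B: "B \<in> sets borel" "B \<subseteq> A"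
  shows "ennreal (cmod (\<mu> B)) \<le> variation \<mu> A"
proof (cases "B = {}")
  case False
  have "(\<Sum>C\<in>{B, A - B} - {{}}. ennreal (cmod (\<mu> C))) \<le> variation \<mu> A"
    using A B by (intro variation_ge_sum) (auto simp: partition_on_def disjoint_def)
  moreover have "(\<Sum>C\<in>{B}. ennreal (cmod (\<mu> C))) \<le> (\<Sum>C\<in>{B, A - B} - {{}}. ennreal (cmod (\<mu> C)))"
    using False by (intro sum_mono2) auto
  ultimately show ?thesis by simp
qed simp

lemma sum_atoms_le_variation:
  assumes A: "A \<in> sets borel" and F: "finite F" "F \<subseteq> A"
  shows "ennreal (\<Sum>x\<in>F. cmod (\<mu> {x})) \<le> variation \<mu> A"
proof -
  let ?P = "insert (A - F) ((\<lambda>x. {x}) ` F) - {{}}"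
  have "F \<in> sets borel" using F by (meson finite_imp_closed borel_closed)
  hence "insert (A - F) ((\<lambda>x. {x}) ` F) \<subseteq> sets borel"
    using A by (intro insert_subset[THEN iffD2] conjI sets.Diff image_subsetI) simp_all
  hence P: "?P \<subseteq> sets borel" by (rule order_trans[OF Diff_subset])
  from partition_on_singletons[OF F(2)] have "partition_on A ?P" .
  with P have "(\<Sum>C\<in>?P. ennreal (cmod (\<mu> C))) \<le> variation \<mu> A"
    using F by (intro variation_ge_sum) simp_all
  moreover have "(\<Sum>C\<in>(\<lambda>x. {x}) ` F. ennreal (cmod (\<mu> C))) \<le> (\<Sum>C\<in>?P. ennreal (cmod (\<mu> C)))"
    using F by (intro sum_mono2) auto
  moreover have "(\<Sum>C\<in>(\<lambda>x. {x}) ` F. ennreal (cmod (\<mu> C))) = (\<Sum>x\<in>F. ennreal (cmod (\<mu> {x})))"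
    by (subst sum.reindex) auto
  ultimately show ?thesis by (simp add: sum_ennreal)
qed

end

text \<open>The order is chosen so that the positive variations \<open>\<mu>\<^sub>k\<close> of these parts satisfy
  \<open>\<mu> = \<mu>\<^sub>0 - \<mu>\<^sub>1 + \<i> (\<mu>\<^sub>2 - \<mu>\<^sub>3)\<close>.\<close>

definition signed_part :: "nat \<Rightarrow> ('a set \<Rightarrow> complex) \<Rightarrow> 'a set \<Rightarrow> real" where
  "signed_part k \<mu> A = (if k = 0 then Re (\<mu> A) else if k = 1 then - Re (\<mu> A)
     else if k = 2 then Im (\<mu> A) else - Im (\<mu> A))"

definition jordan_coeff :: "nat \<Rightarrow> complex" where
  "jordan_coeff k = (if k = 0 then 1 else if k = 1 then -1 else if k = 2 then \<i> else -\<i>)"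

definition jordan_part :: "nat \<Rightarrow> ((real ^ 'n) set \<Rightarrow> complex) \<Rightarrow> (real ^ 'n) measure" where
  "jordan_part k \<mu> = positive_variation (signed_part k \<mu>)"

lemma sum_lessThan_4: "(\<Sum>k<4. f k) = f 0 + f 1 + f 2 + f (3::nat)" for f :: "nat \<Rightarrow> 'a::comm_monoid_add"
  by (simp add: numeral_eq_Suc)

lemma sum_jordan_coeff: "(\<Sum>k<4. jordan_coeff k * z k) = z 0 - z 1 + \<i> * (z 2 - z 3)"
  by (simp add: sum_lessThan_4 jordan_coeff_def right_diff_distrib)

lemma pairing_eq_jordan: "pairing \<mu> f = (\<Sum>k<4. jordan_coeff k * (\<integral>x. f x \<partial>jordan_part k \<mu>))"
proof -
  have "signed_part 0 \<mu> = (\<lambda>A. Re (\<mu> A))" "signed_part 1 \<mu> = (\<lambda>A. - Re (\<mu> A))"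
    "signed_part 2 \<mu> = (\<lambda>A. Im (\<mu> A))" "signed_part 3 \<mu> = (\<lambda>A. - Im (\<mu> A))"
    by (auto simp: signed_part_def)
  thus ?thesis
    by (simp add: pairing_def jordan_part_def sum_lessThan_4 jordan_coeff_def right_diff_distrib)
qed

lemma norm_jordan_coeff [simp]: "cmod (jordan_coeff k) = 1"
  by (simp add: jordan_coeff_def)

lemma signed_part_le: "\<bar>signed_part k \<mu> A\<bar> \<le> cmod (\<mu> A)"
  by (simp add: signed_part_def abs_Re_le_cmod abs_Im_le_cmod)

context locally_finite_complex_measure begin

lemma signed_part_empty [simp]: "signed_part k \<mu> {} = 0"
  by (simp add: signed_part_def)

lemma signed_part_additive:
  assumes "A \<in> bounded_borel" "B \<in> bounded_borel" "A \<inter> B = {}"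
  shows "signed_part k \<mu> (A \<union> B) = signed_part k \<mu> A + signed_part k \<mu> B"
  using additive[OF assms] by (simp add: signed_part_def)

lemma signed_part_diff:
  assumes "A \<in> bounded_borel" "B \<in> sets borel" "B \<subseteq> A"
  shows "signed_part k \<mu> (A - B) = signed_part k \<mu> A - signed_part k \<mu> B"
  using diff[OF assms] by (simp add: signed_part_def)

lemma signed_part_sums:
  assumes "\<And>i. A i \<in> bounded_borel" "disjoint_family A" "bounded (\<Union>i::nat. A i)"
  shows "(\<lambda>i. signed_part k \<mu> (A i)) sums signed_part k \<mu> (\<Union>i. A i)"
  using sums_disjoint[OF assms] 
  by (auto simp: signed_part_def intro!: sums_minus bounded_linear.sums[OF bounded_linear_Re] bounded_linear.sums[OF bounded_linear_Im])

text \<open>For the upper bound a bounded test set is cut along the \<open>A i\<close>, and its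
  value is the sum of the values of the pieces. For the lower bound test sets of two disjoint sets
  are united, which gives superadditivity for finite unions and, in the limit, for the countable
  one.\<close>

lemma positive_variation_countably_additive:
  "countably_additive (sets borel) (\<lambda>A. SUP B \<in> {B \<in> bounded_borel. B \<subseteq> A}. ennreal (signed_part k \<mu> B))"
    (is "countably_additive _ ?V")
proof (rule countably_additiveI)
  fix A :: "nat \<Rightarrow> (real ^ 'n) set"
  assume A: "range A \<subseteq> sets borel" and disj: "disjoint_family A" and "(\<Union>i. A i) \<in> sets borel"
  have Am [measurable]: "A i \<in> sets borel" for i using A by auto
  have up: "ennreal (signed_part k \<mu> B) \<le> ?V C" if "B \<in> bounded_borel" "B \<subseteq> C" for B C
    by (rule SUP_upper) (use that in auto)
  show "(\<Sum>i. ?V (A i)) = ?V (\<Union>i. A i)"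
  proof (rule antisym)
    show "?V (\<Union>i. A i) \<le> (\<Sum>i. ?V (A i))"
    proof (rule SUP_least, safe)
      fix B assume B: "B \<in> bounded_borel" "B \<subseteq> (\<Union>i. A i)"
      hence [measurable]: "B \<in> sets borel" by (simp add: bounded_borel_iff)
      have BA: "B \<inter> A i \<in> bounded_borel" for i by (rule bounded_borel_subset[OF B(1)]) auto
      have eq: "(\<Union>i. B \<inter> A i) = B" using B by auto
      have s: "(\<lambda>i. signed_part k \<mu> (B \<inter> A i)) sums signed_part k \<mu> (\<Union>i. B \<inter> A i)"
      proof (rule signed_part_sums[OF BA])
        show "disjoint_family (\<lambda>i. B \<inter> A i)" using disj by (auto simp: disjoint_family_on_def)
        show "bounded (\<Union>i. B \<inter> A i)" unfolding eq using B by (simp add: bounded_borel_iff)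
      qed
      have s': "(\<lambda>n. ennreal (\<Sum>i<n. signed_part k \<mu> (B \<inter> A i))) \<longlonglongrightarrow> ennreal (signed_part k \<mu> B)"
        using s unfolding sums_def eq by (intro tendsto_ennrealI)
      have b: "ennreal (\<Sum>i<n. signed_part k \<mu> (B \<inter> A i)) \<le> (\<Sum>i. ?V (A i))" for n
      proof -
        \<comment> \<open>Replacing negative summands by 0 only enlarges the sum, and
          \<open>ennreal\<close> does so anyway; after the truncation the conversion commutes with
          the sum.\<close>
        have "ennreal (\<Sum>i<n. signed_part k \<mu> (B \<inter> A i)) \<le> ennreal (\<Sum>i<n. max 0 (signed_part k \<mu> (B \<inter> A i)))"
          by (intro ennreal_leI sum_mono) auto
        also have "\<dots> = (\<Sum>i<n. ennreal (max 0 (signed_part k \<mu> (B \<inter> A i))))"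
          by (subst sum_ennreal) auto
        also have "\<dots> = (\<Sum>i<n. ennreal (signed_part k \<mu> (B \<inter> A i)))"
          by (intro sum.cong) (auto simp: max_def ennreal_neg)
        also have "\<dots> \<le> (\<Sum>i<n. ?V (A i))" by (intro sum_mono up BA) auto
        also have "\<dots> \<le> (\<Sum>i. ?V (A i))" by (rule sum_le_suminf) auto
        finally show ?thesis .
      qed
      show "ennreal (signed_part k \<mu> B) \<le> (\<Sum>i. ?V (A i))"
        by (rule LIMSEQ_le_const2[OF s']) (use b in auto)
    qed
    have fin: "(\<Sum>i<n. ?V (A i)) \<le> ?V (\<Union>i<n. A i)" for n
    proof (induction n)
      case (Suc n)
      have ne: "\<exists>B. B \<in> bounded_borel \<and> B \<subseteq> C" for C :: "(real^'n) set"
        by (intro exI[of _ "{}"]) (simp add: bounded_borel_def)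
      have "?V (\<Union>i<n. A i) + ?V (A n) \<le> ?V (\<Union>i<Suc n. A i)"
      proof -
        have 1: "ennreal (signed_part k \<mu> B) + ennreal (signed_part k \<mu> C) \<le> ?V (\<Union>i<Suc n. A i)"
          if B: "B \<in> bounded_borel" "B \<subseteq> (\<Union>i<n. A i)" and C: "C \<in> bounded_borel" "C \<subseteq> A n" for B C
        proof -
          have "A i \<inter> A n = {}" if "i < n" for i using disj that by (auto simp: disjoint_family_on_def)
          hence BC: "B \<inter> C = {}" using B C by blast
          have BC2: "B \<union> C \<in> bounded_borel" using B C by (auto simp: bounded_borel_def)
          have BC3: "B \<subseteq> (\<Union>i<Suc n. A i)" "C \<subseteq> (\<Union>i<Suc n. A i)"
            using B C by (simp_all add: lessThan_Suc le_supI1 le_supI2)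
          \<comment> \<open>Since \<open>ennreal\<close> sends negative values to 0, additivity
            carries over only when both values are positive. Otherwise the test set without positive
            value is dropped.\<close>
          consider "signed_part k \<mu> B \<le> 0" | "signed_part k \<mu> C \<le> 0" | "signed_part k \<mu> B > 0" "signed_part k \<mu> C > 0" by linarith
          thus ?thesis
          proof cases
            case 1 thus ?thesis using up[OF C(1) BC3(2)] by (simp add: ennreal_neg)
          next
            case 2 thus ?thesis using up[OF B(1) BC3(1)] by (simp add: ennreal_neg)
          next
            case 3
            hence "ennreal (signed_part k \<mu> B) + ennreal (signed_part k \<mu> C) = ennreal (signed_part k \<mu> (B \<union> C))"
              by (simp add: signed_part_additive[OF B(1) C(1) BC] ennreal_plus)
            also have "\<dots> \<le> ?V (\<Union>i<Suc n. A i)" by (rule up[OF BC2]) (use BC3 in auto)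
            finally show ?thesis .
          qed
        qed
        have "?V (\<Union>i<n. A i) + ?V (A n) = (SUP B \<in> {B \<in> bounded_borel. B \<subseteq> (\<Union>i<n. A i)}. ennreal (signed_part k \<mu> B) + ?V (A n))"
          by (subst ennreal_SUP_add_left[symmetric]) (use ne in auto)
        also have "\<dots> = (SUP B \<in> {B \<in> bounded_borel. B \<subseteq> (\<Union>i<n. A i)}. SUP C \<in> {B \<in> bounded_borel. B \<subseteq> A n}. ennreal (signed_part k \<mu> B) + ennreal (signed_part k \<mu> C))"
          by (subst ennreal_SUP_add_right) (use ne in auto)
        also have "\<dots> \<le> ?V (\<Union>i<Suc n. A i)" by (intro SUP_least 1) auto
        finally show ?thesis .
      qed
      with Suc show ?case by (metis (no_types, lifting) add_right_mono order_trans sum.lessThan_Suc)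
    qed simp
    have "(\<Sum>i<n. ?V (A i)) \<le> ?V (\<Union>i. A i)" for n
      by (rule order_trans[OF fin]) (auto intro!: SUP_subset_mono)
    thus "(\<Sum>i. ?V (A i)) \<le> ?V (\<Union>i. A i)" by (intro suminf_le_const summableI) auto
  qed
qed

text \<open>\<open>measure_of\<close> returns the intended values only for a countably additive set
  function, so the supremum formula becomes available here.\<close>

lemma emeasure_jordan_part:
  assumes "A \<in> sets borel"
  shows "emeasure (jordan_part k \<mu>) A = (SUP B \<in> {B \<in> bounded_borel. B \<subseteq> A}. ennreal (signed_part k \<mu> B))"
  unfolding jordan_part_def positive_variation_def
proof (rule emeasure_measure_of_sigma)
  show "sigma_algebra UNIV (sets (borel :: (real^'n) measure))"
    using sets.sigma_algebra_axioms[of "borel :: (real^'n) measure"] by simp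
  have "{B. B \<in> bounded_borel \<and> B = {}} = {{} :: (real^'n) set}" by (auto simp: bounded_borel_def)
  thus "positive (sets borel) (\<lambda>A. SUP B \<in> {B \<in> bounded_borel. B \<subseteq> A}. ennreal (signed_part k \<mu> B))"
    by (simp add: positive_def)
qed (use assms positive_variation_countably_additive in auto)

lemma sets_jordan_part [simp, measurable_cong]: "sets (jordan_part k \<mu>) = sets borel"
  unfolding jordan_part_def positive_variation_def
  using sets.sigma_sets_eq[of "borel :: (real^'n) measure"] by (simp add: sets_measure_of)

lemma space_jordan_part [simp]: "space (jordan_part k \<mu>) = UNIV"
  unfolding jordan_part_def positive_variation_def by (simp add: space_measure_of_conv)

lemma jordan_part_le_variation:
  assumes "A \<in> sets borel" shows "emeasure (jordan_part k \<mu>) A \<le> variation \<mu> A"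
  unfolding emeasure_jordan_part[OF assms]
proof (rule SUP_least, safe)
  fix B assume B: "B \<in> bounded_borel" "B \<subseteq> A"
  have "ennreal (signed_part k \<mu> B) \<le> ennreal (cmod (\<mu> B))"
    using signed_part_le[of k \<mu> B] by (intro ennreal_leI) auto
  also have "\<dots> \<le> variation \<mu> A" using B assms by (intro norm_le_variation) (auto simp: bounded_borel_iff)
  finally show "ennreal (signed_part k \<mu> B) \<le> variation \<mu> A" .
qed

lemma jordan_part_finite: "A \<in> bounded_borel \<Longrightarrow> emeasure (jordan_part k \<mu>) A < \<infinity>"
  using jordan_part_le_variation[of A k] variation_finite[of A] by (auto simp: bounded_borel_iff intro: order_le_less_trans)

text \<open>The only test sets are \<open>{}\<close> and \<open>{x}\<close>. Consequently the parts
  of a continuous measure have no atoms, as Wiener's lemma requires.\<close>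

lemma jordan_part_singleton: "emeasure (jordan_part k \<mu>) {x} = ennreal (signed_part k \<mu> {x})"
proof -
  have "{B \<in> bounded_borel. B \<subseteq> {x}} = {{}, {x}}" by (auto simp: bounded_borel_def)
  thus ?thesis by (simp add: emeasure_jordan_part sup_absorb2)
qed

text \<open>The bounded set \<open>A\<close> is split into \<open>B\<close> and \<open>A - B\<close>: a supremum over the former is an infimum over the latter.\<close>

lemma jordan_part_diff:
  assumes A: "A \<in> bounded_borel" and opp: "\<And>B. signed_part l \<mu> B = - signed_part k \<mu> B"
  shows "measure (jordan_part k \<mu>) A - measure (jordan_part l \<mu>) A = signed_part k \<mu> A"
proof -
  have le: "measure (jordan_part k \<mu>) A \<le> measure (jordan_part l \<mu>) A + signed_part k \<mu> A"
    if opp: "\<And>B. signed_part l \<mu> B = - signed_part k \<mu> B" for k l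
  proof -
    have fin: "emeasure (jordan_part k \<mu>) A < \<infinity>" for k by (rule jordan_part_finite[OF A])
    have e: "emeasure (jordan_part k \<mu>) A = ennreal (measure (jordan_part k \<mu>) A)" for k
      using fin[of k] by (intro emeasure_eq_ennreal_measure) auto
    have up: "signed_part j \<mu> B \<le> measure (jordan_part j \<mu>) A" if "B \<in> bounded_borel" "B \<subseteq> A" for B j
    proof -
      have "ennreal (signed_part j \<mu> B) \<le> emeasure (jordan_part j \<mu>) A"
        using A that by (subst emeasure_jordan_part) (auto intro!: SUP_upper simp: bounded_borel_iff)
      thus ?thesis unfolding e by (simp add: ennreal_le_iff)
    qed
    have nn: "0 \<le> measure (jordan_part l \<mu>) A + signed_part k \<mu> A"
      using up[of A l] A opp[of A] by simp
    have "emeasure (jordan_part k \<mu>) A \<le> ennreal (measure (jordan_part l \<mu>) A + signed_part k \<mu> A)"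
      using A apply (subst emeasure_jordan_part, simp add: bounded_borel_iff)
    proof (rule SUP_least, safe)
      fix B assume B: "B \<in> bounded_borel" "B \<subseteq> A"
      have "signed_part l \<mu> (A - B) \<le> measure (jordan_part l \<mu>) A"
        using A B by (intro up bounded_borel_subset[OF A]) (auto simp: bounded_borel_iff)
      hence "signed_part k \<mu> B \<le> measure (jordan_part l \<mu>) A + signed_part k \<mu> A"
        using opp[of "A - B"] signed_part_diff[OF A, of B k] B by (auto simp: bounded_borel_iff)
      thus "ennreal (signed_part k \<mu> B) \<le> ennreal (measure (jordan_part l \<mu>) A + signed_part k \<mu> A)"
        by (rule ennreal_leI)
    qed
    thus ?thesis unfolding e using nn by (subst (asm) ennreal_le_iff) auto
  qed
  have "signed_part k \<mu> B = - signed_part l \<mu> B" for B using opp[of B] by simp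
  from le[OF this] le[OF opp] show ?thesis using opp[of A] by linarith
qed

lemma jordan_decomposition:
  assumes A: "A \<in> bounded_borel"
  shows "\<mu> A = (\<Sum>k<4. jordan_coeff k * of_real (measure (jordan_part k \<mu>) A))"
proof -
  have 1: "measure (jordan_part 0 \<mu>) A - measure (jordan_part 1 \<mu>) A = Re (\<mu> A)"
    by (rule trans[OF jordan_part_diff[OF A]]) (simp_all only: signed_part_def, simp_all)
  have 2: "measure (jordan_part 2 \<mu>) A - measure (jordan_part 3 \<mu>) A = Im (\<mu> A)"
    by (rule trans[OF jordan_part_diff[OF A]]) (simp_all only: signed_part_def, simp_all)
  have "\<mu> A = of_real (Re (\<mu> A)) + \<i> * of_real (Im (\<mu> A))" by (rule complex_eq)
  also have "\<dots> = of_real (measure (jordan_part 0 \<mu>) A) - of_real (measure (jordan_part 1 \<mu>) A) +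
      \<i> * (of_real (measure (jordan_part 2 \<mu>) A) - of_real (measure (jordan_part 3 \<mu>) A))"
    unfolding 1[symmetric] 2[symmetric] of_real_diff ..
  finally show ?thesis
    by (simp only: sum_jordan_coeff)
qed

end

section \<open>Integration against slowly increasing measures\<close>

text \<open>Decay of all orders is what integration against slowly increasing measures uses. The
  class holds Schwartz functions and their Fourier transforms alike; smoothness is no part of it,
  and continuity is carried separately.\<close>

definition rapidly_decreasing :: "(real ^ 'n \<Rightarrow> complex) \<Rightarrow> bool" where
  "rapidly_decreasing f \<longleftrightarrow> f \<in> borel_measurable borel \<and> (\<forall>K::nat. \<exists>D\<ge>0. \<forall>x. cmod (f x) \<le> D / (1 + norm x) ^ K)"

lemma rapidly_decreasing_measurable [measurable_dest]:
  "rapidly_decreasing f \<Longrightarrow> f \<in> borel_measurable borel"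
  by (simp add: rapidly_decreasing_def)

lemma rapidly_decreasingE:
  assumes "rapidly_decreasing f"
  obtains D where "0 \<le> D" "\<And>x. cmod (f x) \<le> D / (1 + norm x) ^ K"
  using assms unfolding rapidly_decreasing_def by metis

section \<open>Polynomial growth of the variation and integrability\<close>

lemma variation_mono:
  assumes A: "A \<in> sets borel" and B: "B \<in> sets borel" and "A \<subseteq> B"
  shows "variation \<mu> A \<le> variation \<mu> B"
proof (rule variation_leI)
  fix P assume P: "finite P" "P \<subseteq> sets borel" "partition_on A P"
  let ?Q = "P \<union> ({B - A} - {{}})"
  have "(\<Sum>C\<in>P. ennreal (cmod (\<mu> C))) \<le> (\<Sum>C\<in>?Q. ennreal (cmod (\<mu> C)))"
    using P by (intro sum_mono2) auto
  also have "\<dots> \<le> variation \<mu> B"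
  proof (rule variation_ge_sum)
    have UP: "\<Union>P = A" using P by (simp add: partition_on_def)
    show "partition_on B ?Q"
    proof (rule partition_onI)
      show "\<Union>?Q = B" using UP \<open>A \<subseteq> B\<close> by (cases "B - A = {}") auto
      show "{} \<notin> ?Q" using P by (auto simp: partition_on_def)
      fix p q assume pq: "p \<in> ?Q" "q \<in> ?Q" "p \<noteq> q"
      have *: "disjnt p q" if "p \<in> P" "q \<in> P" using P pq that by (auto simp: partition_on_def pairwise_def)
      have **: "disjnt C (B - A)" "disjnt (B - A) C" if "C \<in> P" for C
        using UP that by (auto simp: disjnt_iff)
      from pq * ** show "disjnt p q" by blast
    qed
    show "?Q \<subseteq> sets borel" using P A B by blast
  qed (use P in auto)
  finally show "(\<Sum>C\<in>P. ennreal (cmod (\<mu> C))) \<le> variation \<mu> B" .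
qed

text \<open>The asymptotic bound speaks only beyond a threshold \<open>R0\<close>. By monotonicity
  the variation at \<open>R\<close> is at most that at \<open>R + R0\<close>, and
  \<open>R + R0 \<le> (1 + R0) * (1 + R)\<close> absorbs the shift into the constant.\<close>

lemma slowly_increasing_growth:
  fixes \<mu> :: "(real ^ 'n) set \<Rightarrow> complex"
  assumes "slowly_increasing \<mu>"
  obtains C N where "0 \<le> C" "\<And>R. 0 \<le> R \<Longrightarrow> variation \<mu> {x. norm x < R} \<le> ennreal (C * (1 + R) ^ N)"
proof -
  let ?v = "\<lambda>R::real. variation \<mu> {x. norm x < R}"
  from assms obtain N where cm: "complex_measure \<mu>" and O: "(\<lambda>R. enn2real (?v R)) \<in> O[at_top](\<lambda>R. R ^ N)"
    unfolding slowly_increasing_def by blast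
  interpret locally_finite_complex_measure \<mu> by standard (rule cm)
  from O obtain c where c: "c > 0" "\<forall>\<^sub>F R in at_top. norm (enn2real (?v R)) \<le> c * norm (R ^ N)"
    by (rule landau_o.bigE)
  then obtain R0' where R0': "\<And>R. R \<ge> R0' \<Longrightarrow> norm (enn2real (?v R)) \<le> c * norm (R ^ N)"
    unfolding eventually_at_top_linorder by blast
  define R0 where "R0 = max R0' 0"
  show ?thesis
  proof
    show "0 \<le> c * (1 + R0) ^ N" using c by (simp add: R0_def)
    fix R :: real assume R: "0 \<le> R"
    have fin: "?v (R + R0) < \<infinity>" by (rule variation_finite[OF open_ball_bounded_borel])
    have "?v R \<le> ?v (R + R0)"
      by (rule variation_mono) (auto simp: bounded_borelD[OF open_ball_bounded_borel] R0_def)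
    also have "\<dots> = ennreal (enn2real (?v (R + R0)))" using fin by simp
    also have "\<dots> \<le> ennreal (c * (1 + R0) ^ N * (1 + R) ^ N)"
    proof (rule ennreal_leI)
      have "enn2real (?v (R + R0)) \<le> c * (R + R0) ^ N"
        using R0'[of "R + R0"] R by (auto simp: R0_def)
      also have "\<dots> \<le> c * ((1 + R0) * (1 + R)) ^ N"
      proof (intro mult_left_mono power_mono)
        have "0 \<le> R0 * R" using R by (simp add: R0_def)
        thus "R + R0 \<le> (1 + R0) * (1 + R)" by (simp add: algebra_simps)
      qed (use c R in \<open>auto simp: R0_def\<close>)
      finally show "enn2real (?v (R + R0)) \<le> c * (1 + R0) ^ N * (1 + R) ^ N" by (simp add: power_mult_distrib)
    qed
    finally show "?v R \<le> ennreal (c * (1 + R0) ^ N * (1 + R) ^ N)" .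
  qed
qed

lemma slowly_increasingI:
  fixes \<mu> :: "(real ^ 'n) set \<Rightarrow> complex"
  assumes "complex_measure \<mu>" "0 \<le> C" "\<And>R. 0 \<le> R \<Longrightarrow> variation \<mu> {x. norm x < R} \<le> ennreal (C * (1 + R) ^ N)"
  shows "slowly_increasing \<mu>"
proof -
  have "\<forall>\<^sub>F R in at_top. norm (enn2real (variation \<mu> {x. norm x < R})) \<le> (C * 2 ^ N) * norm (R ^ N)"
    unfolding eventually_at_top_linorder
  proof (intro exI[of _ 1] allI impI)
    fix R :: real assume R: "1 \<le> R"
    have "enn2real (variation \<mu> {x. norm x < R}) \<le> C * (1 + R) ^ N"
      by (rule enn2real_leI) (use assms R in auto)
    also have "\<dots> \<le> C * (2 * R) ^ N" using R assms by (intro mult_left_mono power_mono) auto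
    finally show "norm (enn2real (variation \<mu> {x. norm x < R})) \<le> (C * 2 ^ N) * norm (R ^ N)"
      using R by (simp add: power_mult_distrib)
  qed
  hence "(\<lambda>R. enn2real (variation \<mu> {x. norm x < R})) \<in> O[at_top](\<lambda>R. R ^ N)" by (rule bigoI)
  thus ?thesis using assms unfolding slowly_increasing_def by blast
qed

lemma integrable_inverse_power_norm:
  fixes M :: "(real ^ 'n) measure"
  assumes sets: "sets M = sets borel" and C: "0 \<le> C"
    and growth: "\<And>R. 0 \<le> R \<Longrightarrow> emeasure M {x. norm x < R} \<le> ennreal (C * (1 + R) ^ N)"
  shows "integrable M (\<lambda>x. 1 / (1 + norm x) ^ (N + 2))"
proof (rule integrableI_bounded)
  note [measurable_cong] = sets
  show "(\<lambda>x. 1 / (1 + norm x) ^ (N + 2)) \<in> borel_measurable M" by measurable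
  have sp: "space M = UNIV" using sets_eq_imp_space_eq[OF sets] by simp
  have "(\<integral>\<^sup>+x. ennreal (1 / (1 + norm x) ^ (N + 2)) \<partial>M) \<le> ennreal (C * shell_const N)"
    by (rule nn_integral_polynomial_growth) (use C growth sp in auto)
  thus "(\<integral>\<^sup>+x. ennreal (norm (1 / (1 + norm x) ^ (N + 2))) \<partial>M) < \<infinity>"
    by (auto intro: order_le_less_trans)
qed

lemma integrable_rapidly_decreasing:
  fixes M :: "(real ^ 'n) measure"
  assumes sets: "sets M = sets borel" and int: "integrable M (\<lambda>x. 1 / (1 + norm x) ^ K)"
    and f: "rapidly_decreasing f"
  shows "integrable M f"
proof -
  obtain D where D: "0 \<le> D" "\<And>x. cmod (f x) \<le> D / (1 + norm x) ^ K"
    using rapidly_decreasingE[OF f] by blast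
  have "integrable M (\<lambda>x. D * (1 / (1 + norm x) ^ K))" using int by (rule integrable_mult_right)
  moreover have "f \<in> borel_measurable M" using f sets by (simp add: rapidly_decreasing_def cong: measurable_cong_sets)
  ultimately show ?thesis
    by (rule Bochner_Integration.integrable_bound) (use D in \<open>auto intro!: AE_I2 order_trans[OF D(2)]\<close>)
qed

lemma jordan_part_integrable_inverse_power_norm:
  fixes \<mu> :: "(real ^ 'n) set \<Rightarrow> complex"
  assumes si: "slowly_increasing \<mu>"
  obtains K where "\<And>k. integrable (jordan_part k \<mu>) (\<lambda>x. 1 / (1 + norm x) ^ K)"
proof -
  obtain C N where C: "0 \<le> C" and growth: "\<And>R. 0 \<le> R \<Longrightarrow> variation \<mu> {x. norm x < R} \<le> ennreal (C * (1 + R) ^ N)"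
    using slowly_increasing_growth[OF si] by blast
  interpret locally_finite_complex_measure \<mu> by standard (use si in \<open>simp add: slowly_increasing_def\<close>)
  have "emeasure (jordan_part k \<mu>) {x. norm x < R} \<le> ennreal (C * (1 + R) ^ N)" if "0 \<le> R" for R k
    using growth[OF that] jordan_part_le_variation[OF bounded_borelD[OF open_ball_bounded_borel]]
    by (rule order_trans[rotated])
  with C have "integrable (jordan_part k \<mu>) (\<lambda>x. 1 / (1 + norm x) ^ (N + 2))" for k
    by (intro integrable_inverse_power_norm[OF sets_jordan_part])
  thus ?thesis by (rule that)
qed

lemma integrable_jordan_part:
  fixes \<mu> :: "(real ^ 'n) set \<Rightarrow> complex"
  assumes si: "slowly_increasing \<mu>" and f: "rapidly_decreasing f"
  shows "integrable (jordan_part k \<mu>) f"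
proof -
  interpret locally_finite_complex_measure \<mu> by standard (use si in \<open>simp add: slowly_increasing_def\<close>)
  obtain K where "\<And>k. integrable (jordan_part k \<mu>) (\<lambda>x. 1 / (1 + norm x) ^ K)"
    using jordan_part_integrable_inverse_power_norm[OF si] by blast
  thus ?thesis by (intro integrable_rapidly_decreasing[OF sets_jordan_part _ f])
qed

text \<open>Used to compare different decompositions of a complex measure into positive ones.\<close>

lemma sum_integrals_eq_0:
  fixes M :: "'i \<Rightarrow> (real ^ 'n) measure" and f :: "real ^ 'n \<Rightarrow> complex"
  assumes sets: "\<And>i. i \<in> I \<Longrightarrow> sets (M i) = sets borel"
    and fin: "\<And>i A. i \<in> I \<Longrightarrow> A \<in> bounded_borel \<Longrightarrow> emeasure (M i) A < \<infinity>"
    and zero: "\<And>A. A \<in> bounded_borel \<Longrightarrow> (\<Sum>i\<in>I. c i * of_real (measure (M i) A)) = 0"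
    and f: "\<And>i. i \<in> I \<Longrightarrow> integrable (M i) f" and fm: "f \<in> borel_measurable borel"
  shows "(\<Sum>i\<in>I. c i * (\<integral>x. f x \<partial>M i)) = 0"
proof -
  obtain F where F: "\<And>n. simple_function borel (F n)"
      "\<And>x. (\<lambda>n. F n x) \<longlonglongrightarrow> f x" "\<And>n x. dist (F n x) 0 \<le> 2 * dist (f x) 0"
    using borel_measurable_implies_sequence_metric[OF fm, of 0] by auto
  have Fm [measurable]: "F n \<in> borel_measurable borel" for n
    by (rule borel_measurable_simple_function[OF F(1)])
  \<comment> \<open>The level sets of \<open>F n\<close> may be unbounded. Cutting with balls turns
    them into bounded Borel sets, to which \<open>fin\<close> and \<open>zero\<close> apply.\<close>
  define B where "B n = {x :: real ^ 'n. norm x < real n}" for n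
  have B: "B n \<in> bounded_borel" for n unfolding B_def by (rule open_ball_bounded_borel)
  have [measurable]: "B n \<in> sets borel" for n using B by (rule bounded_borelD)
  define s where "s n x = indicator (B n) x *\<^sub>R F n x" for n x
  have Y: "finite (range (F n))" for n using F(1)[of n] by (simp add: simple_function_def)
  define L where "L n y = F n -` {y} \<inter> B n" for n y
  have L: "L n y \<in> bounded_borel" for n y
  proof (rule bounded_borel_subset[OF B[of n]])
    show "L n y \<in> sets borel" unfolding L_def
      by (intro sets.Int) (use measurable_sets_borel[OF Fm, of "{y}" n] in auto)
  qed (auto simp: L_def)
  have s_eq: "s n x = (\<Sum>y\<in>range (F n). indicator (L n y) x *\<^sub>R y)" for n x
  proof -
    have "(\<Sum>y\<in>range (F n). indicator (L n y) x *\<^sub>R y) = (\<Sum>y\<in>range (F n). if y = F n x then s n x else 0)"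
      by (intro sum.cong) (auto simp: s_def L_def indicator_def)
    also have "\<dots> = s n x" using Y by (subst sum.delta) auto
    finally show ?thesis ..
  qed
  have s_int: "(\<integral>x. s n x \<partial>M i) = (\<Sum>y\<in>range (F n). measure (M i) (L n y) *\<^sub>R y)" if i: "i \<in> I" for n i
  proof -
    have [simp]: "space (M i) = UNIV" using sets_eq_imp_space_eq[OF sets[OF i]] by simp
    have Lm: "L n y \<in> sets (M i)" for y using L sets[OF i] by (simp add: bounded_borel_iff)
    have "integrable (M i) (indicator (L n y) :: _ \<Rightarrow> real)" for y
      using fin[OF i L] Lm by (simp add: integrable_indicator_iff)
    hence "integrable (M i) (\<lambda>x. indicator (L n y) x *\<^sub>R y)" for y
      by (intro integrable_scaleR_left) auto
    hence "(\<integral>x. s n x \<partial>M i) = (\<Sum>y\<in>range (F n). \<integral>x. indicator (L n y) x *\<^sub>R y \<partial>M i)"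
      unfolding s_eq by (intro Bochner_Integration.integral_sum) auto
    also have "\<dots> = (\<Sum>y\<in>range (F n). measure (M i) (L n y) *\<^sub>R y)"
      using fin[OF i L] Lm by (intro sum.cong refl) simp
    finally show ?thesis .
  qed
  have lim: "(\<lambda>n. \<integral>x. s n x \<partial>M i) \<longlonglongrightarrow> (\<integral>x. f x \<partial>M i)" if i: "i \<in> I" for i
  proof (rule integral_dominated_convergence[where w = "\<lambda>x. 2 * norm (f x)"])
    show "f \<in> borel_measurable (M i)" "s n \<in> borel_measurable (M i)" for n
      unfolding s_def measurable_cong_sets[OF sets[OF i] refl] using fm by measurable
    show "integrable (M i) (\<lambda>x. 2 * norm (f x))" using f[OF i] by auto
    show "AE x in M i. norm (s n x) \<le> 2 * norm (f x)" for n
      using F(3)[of n] by (auto simp: s_def indicator_def)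
    show "AE x in M i. (\<lambda>n. s n x) \<longlonglongrightarrow> f x"
    proof (rule AE_I2)
      fix x :: "real ^ 'n"
      obtain n0 where n0: "norm x < real n0" using reals_Archimedean2 by blast
      have "\<forall>\<^sub>F n in sequentially. F n x = s n x"
        using eventually_ge_at_top[of n0] by eventually_elim (use n0 in \<open>auto simp: s_def B_def\<close>)
      thus "(\<lambda>n. s n x) \<longlonglongrightarrow> f x" by (rule Lim_transform_eventually[OF F(2)])
    qed
  qed
  have "(\<Sum>i\<in>I. c i * (\<integral>x. s n x \<partial>M i)) = 0" for n
  proof -
    have "(\<Sum>i\<in>I. c i * (\<integral>x. s n x \<partial>M i)) = (\<Sum>i\<in>I. \<Sum>y\<in>range (F n). c i * (measure (M i) (L n y) *\<^sub>R y))"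
      by (intro sum.cong refl) (simp add: s_int sum_distrib_left)
    also have "\<dots> = (\<Sum>y\<in>range (F n). (\<Sum>i\<in>I. c i * of_real (measure (M i) (L n y))) * y)"
      by (subst sum.swap) (simp add: sum_distrib_right scaleR_conv_of_real mult.assoc)
    also have "\<dots> = 0" using zero[OF L] by simp
    finally show ?thesis .
  qed
  moreover have "(\<lambda>n. \<Sum>i\<in>I. c i * (\<integral>x. s n x \<partial>M i)) \<longlonglongrightarrow> (\<Sum>i\<in>I. c i * (\<integral>x. f x \<partial>M i))"
    by (intro tendsto_intros lim)
  ultimately show ?thesis by (simp add: LIMSEQ_const_iff)
qed

text \<open>Additivity in the measure is not visible in \<open>pairing\<close>, since the Jordan
  parts of a sum are not the sums of the Jordan parts. The twelve parts of the three measures, with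
  the coefficients of \<open>\<mu> - a - b\<close>, cancel on every bounded Borel set, hence under
  the integral.\<close>

lemma pairing_add:
  fixes \<mu> a b :: "(real ^ 'n) set \<Rightarrow> complex"
  assumes "complex_measure \<mu>" "complex_measure a" "complex_measure b"
    and add: "\<And>A. A \<in> bounded_borel \<Longrightarrow> \<mu> A = a A + b A"
    and int: "\<And>k. integrable (jordan_part k \<mu>) f" "\<And>k. integrable (jordan_part k a) f" "\<And>k. integrable (jordan_part k b) f"
    and fm: "f \<in> borel_measurable borel"
  shows "pairing \<mu> f = pairing a f + pairing b f"
proof -
  define m where "m j = (if j = 0 then \<mu> else if j = 1 then a else b)" for j :: nat
  define s where "s j = (if j = 0 then 1 else -1 :: complex)" for j :: nat
  let ?I = "{..<3::nat} \<times> {..<4::nat}"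
  have cm: "locally_finite_complex_measure (m j)" for j using assms by (auto simp: m_def locally_finite_complex_measure_def)
  have sum3: "(\<Sum>j<3. g j) = g 0 + g 1 + g 2" for g :: "nat \<Rightarrow> complex" by (simp add: numeral_eq_Suc)
  have "(\<Sum>p\<in>?I. (s (fst p) * jordan_coeff (snd p)) * (\<integral>x. f x \<partial>jordan_part (snd p) (m (fst p)))) = 0"
  proof (rule sum_integrals_eq_0)
    fix A :: "(real^'n) set" assume A: "A \<in> bounded_borel"
    have "(\<Sum>p\<in>?I. (s (fst p) * jordan_coeff (snd p)) * of_real (measure (jordan_part (snd p) (m (fst p))) A)) =
      (\<Sum>j<3. s j * (\<Sum>k<4. jordan_coeff k * of_real (measure (jordan_part k (m j)) A)))"
      by (simp add: sum.cartesian_product' sum_distrib_left mult.assoc)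
    also have "\<dots> = (\<Sum>j<3. s j * m j A)"
      by (simp add: locally_finite_complex_measure.jordan_decomposition[OF cm A, symmetric])
    also have "\<dots> = 0" unfolding sum3 using add[OF A] by (simp add: s_def m_def)
    finally show "(\<Sum>p\<in>?I. (s (fst p) * jordan_coeff (snd p)) * of_real (measure (jordan_part (snd p) (m (fst p))) A)) = 0" .
  next
    fix p show "integrable (jordan_part (snd p) (m (fst p))) f" using int by (simp add: m_def)
  qed (auto simp: locally_finite_complex_measure.sets_jordan_part[OF cm] fm locally_finite_complex_measure.jordan_part_finite[OF cm, simplified])
  also have "(\<Sum>p\<in>?I. (s (fst p) * jordan_coeff (snd p)) * (\<integral>x. f x \<partial>jordan_part (snd p) (m (fst p)))) =
      (\<Sum>j<3. s j * pairing (m j) f)"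
    by (simp add: sum.cartesian_product' sum_distrib_left mult.assoc pairing_eq_jordan)
  finally show ?thesis unfolding sum3 by (simp add: s_def m_def diff_eq_eq add.commute)
qed

text \<open>Such a measure is the image of counting measure on \<open>\<Lambda>\<close> weighted by
  the point masses, so that integration becomes summation.\<close>

lemma integral_countable_support:
  fixes M :: "(real ^ 'n) measure" and f :: "real ^ 'n \<Rightarrow> complex"
  assumes sets: "sets M = sets borel" and \<Lambda>: "countable \<Lambda>" and null: "emeasure M (- \<Lambda>) = 0"
    and fin: "\<And>x. emeasure M {x} < \<infinity>" and f: "integrable M f"
  shows "(\<lambda>x. measure M {x} *\<^sub>R f x) abs_summable_on \<Lambda>"
    and "(\<integral>x. f x \<partial>M) = (\<Sum>\<^sub>ax\<in>\<Lambda>. measure M {x} *\<^sub>R f x)"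
proof -
  have sp: "space M = UNIV" using sets_eq_imp_space_eq[OF sets] by simp
  have \<Lambda>b: "\<Lambda> \<in> sets borel" using \<Lambda> by (rule sets.countable[rotated]) auto
  let ?D = "density (count_space \<Lambda>) (\<lambda>x. ennreal (measure M {x}))"
  have em: "emeasure M {x} = ennreal (measure M {x})" for x
    using fin[of x] by (intro emeasure_eq_ennreal_measure) auto
  have Meq: "M = distr ?D borel (\<lambda>x. x)"
  proof (rule measure_eqI)
    fix A assume "A \<in> sets M"
    hence A: "A \<in> sets borel" using sets by simp
    have "emeasure M A = emeasure M (A \<inter> \<Lambda>) + emeasure M (A \<inter> - \<Lambda>)"
      using A \<Lambda>b by (subst plus_emeasure) (auto simp: sets intro!: arg_cong[where f="emeasure M"])
    also have "emeasure M (A \<inter> - \<Lambda>) = 0"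
      using emeasure_mono[of "A \<inter> -\<Lambda>" "-\<Lambda>" M] null \<Lambda>b sets by auto
    also have "emeasure M (A \<inter> \<Lambda>) = (\<integral>\<^sup>+x. emeasure M {x} \<partial>count_space (A \<inter> \<Lambda>))"
      using \<Lambda> by (intro emeasure_countable_singleton) (auto simp: sets)
    also have "\<dots> = (\<integral>\<^sup>+x. ennreal (measure M {x}) * indicator A x \<partial>count_space \<Lambda>)"
      by (subst nn_integral_count_space_indicator[of "A \<inter> \<Lambda>"])
         (auto simp: em nn_integral_count_space_indicator[of \<Lambda>] indicator_def intro!: nn_integral_cong)
    also have "\<dots> = emeasure (distr ?D borel (\<lambda>x. x)) A"
      using A by (subst emeasure_distr) (auto simp: emeasure_density indicator_def intro!: nn_integral_cong)
    finally show "emeasure M A = emeasure (distr ?D borel (\<lambda>x. x)) A" by simp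
  qed (simp add: sets)
  have fb: "f \<in> borel_measurable borel" using f unfolding measurable_cong_sets[OF sets refl, symmetric] by auto
  have "integrable ?D f"
    using f fb by (subst (asm) Meq) (simp add: integrable_distr_eq)
  thus "(\<lambda>x. measure M {x} *\<^sub>R f x) abs_summable_on \<Lambda>"
    unfolding abs_summable_on_def by (subst (asm) integrable_density) auto
  have "(\<integral>x. f x \<partial>M) = (\<integral>x. f x \<partial>?D)"
    using fb by (subst Meq) (simp add: integral_distr)
  also have "\<dots> = (\<Sum>\<^sub>ax\<in>\<Lambda>. measure M {x} *\<^sub>R f x)"
    unfolding infsetsum_def by (subst integral_density) auto
  finally show "(\<integral>x. f x \<partial>M) = (\<Sum>\<^sub>ax\<in>\<Lambda>. measure M {x} *\<^sub>R f x)" .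
qed

lemma pairing_point_masses:
  fixes \<mu> :: "(real ^ 'n) set \<Rightarrow> complex"
  assumes cm: "complex_measure \<mu>" and sp: "sum_of_point_masses \<Lambda> \<mu>" and \<Lambda>: "countable \<Lambda>"
    and int: "\<And>k. integrable (jordan_part k \<mu>) f"
  shows "(\<lambda>x. \<mu> {x} * f x) abs_summable_on \<Lambda>" and "pairing \<mu> f = (\<Sum>\<^sub>ax\<in>\<Lambda>. \<mu> {x} * f x)"
proof -
  interpret locally_finite_complex_measure \<mu> by standard (rule cm)
  have \<Lambda>b: "\<Lambda> \<in> sets borel" using \<Lambda> by (rule sets.countable[rotated]) auto
  have sg: "{x} \<in> bounded_borel" for x :: "real^'n" by (simp add: bounded_borel_def)
  \<comment> \<open>A bounded test set that misses \<open>\<Lambda>\<close> has the value of an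
    empty sum, so no part charges the complement of \<open>\<Lambda>\<close>.\<close>
  have null: "emeasure (jordan_part k \<mu>) (- \<Lambda>) = 0" for k
  proof -
    have "ennreal (signed_part k \<mu> B) \<le> 0" if B: "B \<in> bounded_borel" "B \<subseteq> - \<Lambda>" for B
    proof -
      have "B \<inter> \<Lambda> = {}" using B by auto
      hence "((\<lambda>x. \<mu> {x}) has_sum \<mu> B) {}" using sp B unfolding sum_of_point_masses_def by metis
      hence "\<mu> B = 0" using has_sum_empty by (rule has_sum_unique)
      thus ?thesis by (simp add: signed_part_def)
    qed
    hence "(SUP B \<in> {B \<in> bounded_borel. B \<subseteq> - \<Lambda>}. ennreal (signed_part k \<mu> B)) \<le> 0" by (intro SUP_least) auto
    thus ?thesis using \<Lambda>b by (simp add: emeasure_jordan_part)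
  qed
  note * = integral_countable_support[OF sets_jordan_part \<Lambda> null jordan_part_finite[OF sg] int]
  have eq: "\<mu> {x} * f x = (\<Sum>k<4. jordan_coeff k * (measure (jordan_part k \<mu>) {x} *\<^sub>R f x))" for x
    by (subst jordan_decomposition[OF sg]) (simp add: sum_distrib_right scaleR_conv_of_real mult.assoc)
  have sm: "(\<lambda>x. jordan_coeff k * (measure (jordan_part k \<mu>) {x} *\<^sub>R f x)) abs_summable_on \<Lambda>" for k
    by (intro abs_summable_on_cmult_right *)
  show "(\<lambda>x. \<mu> {x} * f x) abs_summable_on \<Lambda>" unfolding eq by (intro abs_summable_sum sm)
  have "pairing \<mu> f = (\<Sum>k<4. \<Sum>\<^sub>ax\<in>\<Lambda>. jordan_coeff k * (measure (jordan_part k \<mu>) {x} *\<^sub>R f x))"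
    unfolding pairing_eq_jordan *(2) by (intro sum.cong refl infsetsum_cmult_right[symmetric] *(1))
  also have "\<dots> = (\<Sum>\<^sub>ax\<in>\<Lambda>. \<mu> {x} * f x)" unfolding eq by (rule sum_infsetsum[OF sm])
  finally show "pairing \<mu> f = (\<Sum>\<^sub>ax\<in>\<Lambda>. \<mu> {x} * f x)" .
qed

section \<open>Point masses and the discrete part\<close>

text \<open>The value 0 elsewhere is the normalisation demanded by \<open>complex_measure\<close>.
  The sum is an \<open>infsetsum\<close>, an integral against counting measure, so that dominated
  convergence applies to it.\<close>

definition point_mass_measure :: "(real ^ 'n \<Rightarrow> complex) \<Rightarrow> (real ^ 'n) set \<Rightarrow> complex" where
  "point_mass_measure c A = (if A \<in> bounded_borel then infsetsum c A else 0)"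

locale point_masses =
  fixes c :: "real ^ 'n \<Rightarrow> complex"
  assumes locally_summable: "\<And>R. c abs_summable_on {x. norm x < R}"
begin

lemma summable_bounded:
  assumes "bounded A" shows "c abs_summable_on A"
proof -
  obtain B where B: "\<And>x. x \<in> A \<Longrightarrow> norm x \<le> B" using assms unfolding bounded_iff by blast
  have "A \<subseteq> {x. norm x < B + 1}" using B by force
  thus ?thesis by (rule abs_summable_on_subset[OF locally_summable])
qed

lemma countable_support: "countable {x. c x \<noteq> 0}"
proof -
  have "countable {x \<in> {x. norm x < real n}. c x \<noteq> 0}" for n
    using locally_summable[of "real n"] by (intro abs_summable_countable) (simp add: abs_summable_equivalent)
  hence "countable (\<Union>n. {x \<in> {x. norm x < real n}. c x \<noteq> 0})" by (intro countable_UN) auto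
  moreover have "(\<Union>n. {x \<in> {x. norm x < real n}. c x \<noteq> 0}) = {x. c x \<noteq> 0}"
    using reals_Archimedean2 by auto
  ultimately show ?thesis by simp
qed

lemma point_mass_measure_singleton [simp]: "point_mass_measure c {x} = c x"
  by (simp add: point_mass_measure_def bounded_borel_def)

lemma point_mass_measure_sums:
  fixes A :: "nat \<Rightarrow> (real ^ 'n) set"
  assumes A: "range A \<subseteq> bounded_borel" "disjoint_family A" "bounded (\<Union>i. A i)"
  shows "(\<lambda>i. point_mass_measure c (A i)) sums point_mass_measure c (\<Union>i. A i)"
proof -
  have U: "(\<Union>i. A i) \<in> bounded_borel" using A by (auto simp: bounded_borel_def)
  have sm: "c abs_summable_on B" if "B \<subseteq> (\<Union>i. A i)" for B
    using summable_bounded[OF A(3)] that by (rule abs_summable_on_subset)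
  have Un: "infsetsum c (\<Union>i<n. A i) = (\<Sum>i<n. infsetsum c (A i))" for n
  proof (induction n)
    case (Suc n)
    have "infsetsum c ((\<Union>i<n. A i) \<union> A n) = infsetsum c (\<Union>i<n. A i) + infsetsum c (A n)"
    proof (rule infsetsum_Un_disjoint)
      have "A i \<inter> A n = {}" if "i < n" for i using A(2) that by (auto simp: disjoint_family_on_def)
      thus "(\<Union>i<n. A i) \<inter> A n = {}" by blast
    qed (auto intro!: sm)
    moreover have "(\<Union>i<n. A i) \<union> A n = (\<Union>i<Suc n. A i)" by (simp add: lessThan_Suc Un_commute)
    ultimately show ?case using Suc by simp
  qed simp
  \<comment> \<open>Countable additivity is continuity from below of the set integral, taken for
    counting measure.\<close>
  have "(\<lambda>n. LINT x:(\<Union>i<n. A i)|count_space UNIV. c x) \<longlonglongrightarrow> (LINT x:(\<Union>n. \<Union>i<n. A i)|count_space UNIV. c x)"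
  proof (rule set_integral_cont_up)
    show "incseq (\<lambda>n. \<Union>i<n. A i)" by (rule incseq_SucI) (auto simp: lessThan_Suc)
    show "set_integrable (count_space UNIV) (\<Union>n. \<Union>i<n. A i) c"
      unfolding abs_summable_on_altdef[symmetric] by (rule sm) auto
  qed auto
  moreover have "(\<Union>n. \<Union>i<n. A i) = (\<Union>i. A i)" by auto
  ultimately have "(\<lambda>n. infsetsum c (\<Union>i<n. A i)) \<longlonglongrightarrow> infsetsum c (\<Union>i. A i)"
    by (simp add: infsetsum_altdef)
  thus ?thesis using A U by (simp add: sums_def Un point_mass_measure_def image_subset_iff)
qed

text \<open>Counting measure with density \<open>cmod (c x)\<close> is positive, dominates the value
  of every block and adds up exactly over a partition.\<close>

lemma variation_point_mass_measure_le:
  assumes A: "A \<in> bounded_borel"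
  shows "variation (point_mass_measure c) A \<le> ennreal (\<Sum>\<^sub>ax\<in>A. cmod (c x))"
proof (rule variation_leI)
  fix P assume P: "finite P" "P \<subseteq> sets borel" "partition_on A P"
  let ?D = "density (count_space UNIV) (\<lambda>x. ennreal (cmod (c x)))"
  have UP: "\<Union>P = A" and disj: "disjoint_family_on (\<lambda>B. B) P"
    using P by (auto simp: partition_on_def pairwise_def disjnt_def disjoint_family_on_def)
  have em: "emeasure ?D B = ennreal (\<Sum>\<^sub>ax\<in>B. cmod (c x))" if "B \<subseteq> A" for B
  proof -
    have "c abs_summable_on B" using A that by (intro summable_bounded) (auto simp: bounded_borel_def intro: bounded_subset)
    hence "(\<integral>\<^sup>+x. ennreal (cmod (c x)) \<partial>count_space B) = ennreal (\<Sum>\<^sub>ax\<in>B. cmod (c x))"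
      by (intro nn_integral_conv_infsetsum) (auto intro: abs_summable_on_normI)
    thus ?thesis by (simp add: emeasure_density nn_integral_count_space_indicator)
  qed
  have "(\<Sum>B\<in>P. ennreal (cmod (point_mass_measure c B))) \<le> (\<Sum>B\<in>P. emeasure ?D B)"
  proof (rule sum_mono)
    fix B assume B: "B \<in> P"
    have BA: "B \<subseteq> A" using B UP by auto
    hence "c abs_summable_on B" using A by (intro summable_bounded) (auto simp: bounded_borel_def intro: bounded_subset)
    have "cmod (point_mass_measure c B) \<le> (\<Sum>\<^sub>ax\<in>B. cmod (c x))"
      unfolding point_mass_measure_def using norm_infsetsum_bound[of c B] by (auto intro: infsetsum_nonneg)
    thus "ennreal (cmod (point_mass_measure c B)) \<le> emeasure ?D B"
      unfolding em[OF BA] by (rule ennreal_leI)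
  qed
  also have "\<dots> = emeasure ?D (\<Union>B\<in>P. B)" using P disj by (intro sum_emeasure) auto
  also have "\<dots> = ennreal (\<Sum>\<^sub>ax\<in>A. cmod (c x))" using UP by (simp add: em)
  finally show "(\<Sum>B\<in>P. ennreal (cmod (point_mass_measure c B))) \<le> ennreal (\<Sum>\<^sub>ax\<in>A. cmod (c x))" .
qed

lemma complex_measure_point_mass_measure: "complex_measure (point_mass_measure c)"
  unfolding complex_measure_def
proof (intro conjI allI impI ballI)
  show "variation (point_mass_measure c) A < \<infinity>" if "A \<in> bounded_borel" for A
    using variation_point_mass_measure_le[OF that] by (simp add: order_le_less_trans)
  show "point_mass_measure c A = 0" if "A \<notin> bounded_borel" for A
    using that by (simp add: point_mass_measure_def)
qed (rule point_mass_measure_sums)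

text \<open>Passes from \<open>infsetsum\<close>, in which the estimates are done, to
  \<open>has_sum\<close>, in which the representation by point masses is phrased.\<close>

lemma sum_of_point_masses_point_mass_measure: "sum_of_point_masses {x. c x \<noteq> 0} (point_mass_measure c)"
  unfolding sum_of_point_masses_def
proof
  fix A :: "(real^'n) set" assume A: "A \<in> bounded_borel"
  hence sm: "c abs_summable_on A" by (intro summable_bounded) (simp add: bounded_borel_def)
  hence "Infinite_Sum.abs_summable_on c A" by (simp add: abs_summable_equivalent)
  hence "(c has_sum infsum c A) A"
    by (rule has_sum_infsum[OF abs_summable_summable])
  hence "(c has_sum point_mass_measure c A) A"
    using A by (simp add: point_mass_measure_def infsetsum_infsum[OF sm])
  hence "(c has_sum point_mass_measure c A) (A \<inter> {x. c x \<noteq> 0})"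
    by (subst has_sum_cong_neutral[where T = A and g = c]) auto
  thus "((\<lambda>x. point_mass_measure c {x}) has_sum point_mass_measure c A) (A \<inter> {x. c x \<noteq> 0})" by simp
qed

end

section \<open>Atomic and continuous part of a complex measure\<close>

context locally_finite_complex_measure begin

lemma sum_atoms_le:
  assumes A: "A \<in> bounded_borel" and F: "finite F" "F \<subseteq> A"
  shows "(\<Sum>x\<in>F. cmod (\<mu> {x})) \<le> enn2real (variation \<mu> A)"
proof -
  have "ennreal (\<Sum>x\<in>F. cmod (\<mu> {x})) \<le> variation \<mu> A"
    by (rule sum_atoms_le_variation) (use A F in \<open>auto simp: bounded_borel_def\<close>)
  also have "\<dots> = ennreal (enn2real (variation \<mu> A))" using variation_finite[OF A] by simp
  finally show ?thesis by (subst (asm) ennreal_le_iff) auto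
qed

lemma atoms_summable: "A \<in> bounded_borel \<Longrightarrow> (\<lambda>x. \<mu> {x}) abs_summable_on A"
  by (rule abs_summable_finite_sumsI) (rule sum_atoms_le)

sublocale atoms: point_masses "\<lambda>x. \<mu> {x}"
  by standard (rule atoms_summable[OF open_ball_bounded_borel])

text \<open>Through this bound the discrete part of a slowly increasing measure is slowly
  increasing, as \<open>has_fourier_transform\<close> demands of it.\<close>

lemma variation_atoms_le:
  assumes A: "A \<in> bounded_borel"
  shows "variation (point_mass_measure (\<lambda>x. \<mu> {x})) A \<le> variation \<mu> A"
proof -
  have sm: "(\<lambda>x. cmod (\<mu> {x})) abs_summable_on A" using atoms_summable[OF A] by simp
  have "infsum (\<lambda>x. cmod (\<mu> {x})) A \<le> enn2real (variation \<mu> A)"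
    by (rule infsum_le_finite_sums[OF _ sum_atoms_le[OF A]])
      (use atoms_summable[OF A] in \<open>simp_all add: abs_summable_equivalent\<close>)
  hence "(\<Sum>\<^sub>ax\<in>A. cmod (\<mu> {x})) \<le> enn2real (variation \<mu> A)" by (simp add: infsetsum_infsum[OF sm])
  hence "ennreal (\<Sum>\<^sub>ax\<in>A. cmod (\<mu> {x})) \<le> ennreal (enn2real (variation \<mu> A))" by (rule ennreal_leI)
  also have "\<dots> = variation \<mu> A" using variation_finite[OF A] by simp
  finally show ?thesis using atoms.variation_point_mass_measure_le[OF A] by (rule order_trans[rotated])
qed

abbreviation "atomic_part \<equiv> point_mass_measure (\<lambda>x. \<mu> {x})"

definition "continuous_part A = \<mu> A - atomic_part A"

lemma variation_continuous_part_le: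
  "variation continuous_part A \<le> variation \<mu> A + variation atomic_part A"
proof (rule variation_leI)
  fix P assume P: "finite P" "P \<subseteq> sets borel" "partition_on A P"
  have "(\<Sum>B\<in>P. ennreal (cmod (continuous_part B))) \<le> (\<Sum>B\<in>P. ennreal (cmod (\<mu> B)) + ennreal (cmod (atomic_part B)))"
    by (intro sum_mono) (simp add: continuous_part_def ennreal_plus[symmetric] norm_triangle_ineq4 del: ennreal_plus)
  also have "\<dots> = (\<Sum>B\<in>P. ennreal (cmod (\<mu> B))) + (\<Sum>B\<in>P. ennreal (cmod (atomic_part B)))"
    by (rule sum.distrib)
  also have "\<dots> \<le> variation \<mu> A + variation atomic_part A"
    by (intro add_mono variation_ge_sum P)
  finally show "(\<Sum>B\<in>P. ennreal (cmod (continuous_part B))) \<le> variation \<mu> A + variation atomic_part A" .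
qed

lemma complex_measure_continuous_part: "complex_measure continuous_part"
  unfolding complex_measure_def
proof (intro conjI allI impI ballI)
  show "continuous_part A = 0" if "A \<notin> bounded_borel" for A
    using that outside[OF that] by (simp add: continuous_part_def point_mass_measure_def)
  show "(\<lambda>i. continuous_part (A i)) sums continuous_part (\<Union>i. A i)"
    if "range A \<subseteq> bounded_borel" "disjoint_family A" "bounded (\<Union>i. A i)" for A :: "nat \<Rightarrow> (real^'n) set"
    unfolding continuous_part_def using that
    by (intro sums_diff sums_disjoint atoms.point_mass_measure_sums) auto
  show "variation continuous_part A < \<infinity>" if A: "A \<in> bounded_borel" for A
    using variation_continuous_part_le[of A] variation_finite[OF A] variation_atoms_le[OF A]
    by (auto simp: ennreal_add_eq_top order_le_less_trans less_top[symmetric] top_unique)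
qed

lemma continuous_measure_continuous_part: "continuous_measure continuous_part"
  using complex_measure_continuous_part by (simp add: continuous_measure_def continuous_part_def)

lemma pure_point_unique:
  assumes "pure_point d" "continuous_measure c" and eq: "\<And>A. \<mu> A = d A + c A"
  shows "d = atomic_part"
proof
  fix A
  obtain S where d: "complex_measure d" and S: "sum_of_point_masses S d"
    using assms unfolding pure_point_def by blast
  have dx: "d {x} = \<mu> {x}" for x using eq[of "{x}"] assms(2) by (simp add: continuous_measure_def)
  \<comment> \<open>\<open>S\<close> may contain points of mass 0 but misses no atom: at a point
    outside \<open>S\<close> the representing sum is empty.\<close>
  have zero: "\<mu> {x} = 0" if "x \<notin> S" for x
  proof -
    have "{x} \<in> bounded_borel" by (simp add: bounded_borel_def)
    hence "((\<lambda>x. d {x}) has_sum d {x}) ({x} \<inter> S)" using S unfolding sum_of_point_masses_def by blast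
    hence "((\<lambda>x. d {x}) has_sum d {x}) {}" using that by simp
    hence "d {x} = 0" using has_sum_empty by (rule has_sum_unique)
    thus ?thesis by (simp add: dx)
  qed
  show "d A = atomic_part A"
  proof (cases "A \<in> bounded_borel")
    case True
    have "((\<lambda>x. \<mu> {x}) has_sum d A) (A \<inter> S)"
      using S True unfolding sum_of_point_masses_def dx by blast
    hence "((\<lambda>x. \<mu> {x}) has_sum d A) (A \<inter> {x. \<mu> {x} \<noteq> 0})"
      by (subst has_sum_cong_neutral[where T = "A \<inter> S" and g = "\<lambda>x. \<mu> {x}"]) (use zero in auto)
    moreover have "((\<lambda>x. \<mu> {x}) has_sum atomic_part A) (A \<inter> {x. \<mu> {x} \<noteq> 0})"
      using atoms.sum_of_point_masses_point_mass_measure True unfolding sum_of_point_masses_def by simp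
    ultimately show ?thesis by (rule has_sum_unique)
  next
    case False
    thus ?thesis using d by (simp add: complex_measure_def point_mass_measure_def)
  qed
qed

text \<open>Resolves the definite description. The atoms and the remainder give existence;
  uniqueness holds because the masses are read off at singletons, where the continuous summand
  vanishes.\<close>

lemma discrete_part_eq: "discrete_part \<mu> = atomic_part"
  unfolding discrete_part_def
proof (rule the_equality)
  have "pure_point atomic_part"
    unfolding pure_point_def using atoms.complex_measure_point_mass_measure
      atoms.countable_support atoms.sum_of_point_masses_point_mass_measure by blast
  moreover have "\<forall>A. \<mu> A = atomic_part A + continuous_part A" by (simp add: continuous_part_def)
  ultimately show "pure_point atomic_part \<and> (\<exists>\<nu>c. continuous_measure \<nu>c \<and> (\<forall>A. \<mu> A = atomic_part A + \<nu>c A))"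
    using continuous_measure_continuous_part by blast
qed (use pure_point_unique in blast)

lemma slowly_increasing_parts:
  assumes "slowly_increasing \<mu>"
  shows "slowly_increasing atomic_part" "slowly_increasing continuous_part"
proof -
  obtain C N where C: "0 \<le> C" and growth: "\<And>R. 0 \<le> R \<Longrightarrow> variation \<mu> {x. norm x < R} \<le> ennreal (C * (1 + R) ^ N)"
    using slowly_increasing_growth[OF assms] by blast
  have 1: "variation atomic_part {x. norm x < R} \<le> ennreal (C * (1 + R) ^ N)" if "0 \<le> R" for R
    using growth[OF that] variation_atoms_le[OF open_ball_bounded_borel] by (rule order_trans[rotated])
  show "slowly_increasing atomic_part"
    using atoms.complex_measure_point_mass_measure C 1 by (rule slowly_increasingI)
  have 2: "variation continuous_part {x. norm x < R} \<le> ennreal ((2 * C) * (1 + R) ^ N)" if R: "0 \<le> R" for R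
  proof -
    have "variation continuous_part {x. norm x < R} \<le> ennreal (C * (1 + R) ^ N) + ennreal (C * (1 + R) ^ N)"
      by (rule order_trans[OF variation_continuous_part_le]) (intro add_mono growth 1 R)
    also have "\<dots> = ennreal ((2 * C) * (1 + R) ^ N)"
      using R C by (subst ennreal_plus[symmetric]) auto
    finally show ?thesis .
  qed
  show "slowly_increasing continuous_part"
    using complex_measure_continuous_part _ 2 by (rule slowly_increasingI) (use C in auto)
qed

end

section \<open>Schwartz functions and their Fourier transforms\<close>

abbreviation partial :: "'n \<Rightarrow> (real ^ 'n \<Rightarrow> complex) \<Rightarrow> real ^ 'n \<Rightarrow> complex" where
  "partial i f \<equiv> (\<lambda>x. frechet_derivative f (at x) (axis i 1))"

lemma partial_eq: "(f has_derivative D) (at x) \<Longrightarrow> partial i f x = D (axis i 1)"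
  by (simp add: frechet_derivative_at[symmetric])

lemma partial_add:
  assumes "f differentiable (at x)" "g differentiable (at x)"
  shows "partial i (\<lambda>x. f x + g x) x = partial i f x + partial i g x"
  by (rule partial_eq) (intro has_derivative_add assms[unfolded frechet_derivative_works])

lemma partial_cmult:
  assumes "f differentiable (at x)"
  shows "partial i (\<lambda>x. c * f x) x = c * partial i f x"
  by (rule partial_eq) (intro has_derivative_mult_right assms[unfolded frechet_derivative_works])

lemma partial_mult:
  assumes "f differentiable (at x)" "g differentiable (at x)"
  shows "partial i (\<lambda>x. f x * g x) x = f x * partial i g x + partial i f x * g x"
  by (rule partial_eq) (intro has_derivative_mult assms[unfolded frechet_derivative_works])

text \<open>Replaces the computation of iterated derivatives: it is enough to exhibit a class around
  \<open>f\<close> that is stable under a single partial derivative.\<close>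

lemma schwartz_closure:
  assumes f: "f \<in> S"
    and diff: "\<And>g x. g \<in> S \<Longrightarrow> g differentiable (at x)"
    and partial: "\<And>g i. g \<in> S \<Longrightarrow> partial i g \<in> S"
    and bdd: "\<And>g k. g \<in> S \<Longrightarrow> bounded (range (\<lambda>x. norm x ^ k * cmod (g x)))"
  shows "schwartz f"
proof -
  have "iterated_partial is f \<in> S" for "is" by (induction "is") (simp_all add: f partial)
  thus ?thesis unfolding schwartz_def using diff bdd by blast
qed

lemma schwartz_differentiable: "schwartz f \<Longrightarrow> iterated_partial is f differentiable (at x)"
  by (simp add: schwartz_def)

lemma schwartz_differentiable_0: "schwartz f \<Longrightarrow> f differentiable (at x)"
  using schwartz_differentiable[of f "[]"] by simp

lemma iterated_partial_append: "iterated_partial is (iterated_partial js f) = iterated_partial (is @ js) f"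
  by (induction "is") simp_all

lemma schwartz_partial: "schwartz f \<Longrightarrow> schwartz (partial i f)"
  using iterated_partial_append[of _ "[i]" f] by (simp add: schwartz_def)

lemma schwartz_bounded: "schwartz f \<Longrightarrow> bounded (range (\<lambda>x. norm x ^ k * cmod (f x)))"
  unfolding schwartz_def by (metis iterated_partial.simps(1))

lemma schwartz_add:
  assumes f: "schwartz f" and g: "schwartz g"
  shows "schwartz (\<lambda>x. f x + g x)"
proof -
  let ?S = "{\<lambda>x. f x + g x | f g. schwartz f \<and> schwartz g}"
  show ?thesis
  proof (rule schwartz_closure[of _ ?S])
    fix h assume "h \<in> ?S"
    then obtain f g where h: "h = (\<lambda>x. f x + g x)" "schwartz f" "schwartz g" by blast
    note d = schwartz_differentiable_0[OF h(2)] schwartz_differentiable_0[OF h(3)]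
    show "h differentiable (at x)" for x unfolding h by (intro differentiable_add d)
    have eq: "partial i h = (\<lambda>x. partial i f x + partial i g x)" for i
      unfolding h(1) by (intro ext partial_add[OF d])
    show "partial i h \<in> ?S" for i
      by (intro CollectI exI[of _ "partial i f"] exI[of _ "partial i g"] conjI eq schwartz_partial h)
    show "bounded (range (\<lambda>x. norm x ^ k * cmod (h x)))" for k
    proof -
      obtain B C where B: "\<And>x. norm x ^ k * cmod (f x) \<le> B" and C: "\<And>x. norm x ^ k * cmod (g x) \<le> C"
        using schwartz_bounded[OF h(2), of k] schwartz_bounded[OF h(3), of k] unfolding bounded_iff by auto
      have "norm x ^ k * cmod (h x) \<le> B + C" for x
      proof -
        have "norm x ^ k * cmod (h x) \<le> norm x ^ k * (cmod (f x) + cmod (g x))"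
          unfolding h by (intro mult_left_mono norm_triangle_ineq) auto
        thus ?thesis using B[of x] C[of x] by (simp add: distrib_left)
      qed
      thus ?thesis unfolding bounded_iff by (intro exI[of _ "B + C"]) auto
    qed
  qed (use f g in blast)
qed

lemma schwartz_cmult:
  assumes f: "schwartz f"
  shows "schwartz (\<lambda>x. c * f x)"
proof -
  let ?S = "{\<lambda>x. c * f x | f. schwartz f}"
  show ?thesis
  proof (rule schwartz_closure[of _ ?S])
    fix h assume "h \<in> ?S"
    then obtain f where h: "h = (\<lambda>x. c * f x)" "schwartz f" by blast
    note d = schwartz_differentiable_0[OF h(2)]
    show "h differentiable (at x)" for x unfolding h by (intro differentiable_mult d) auto
    have eq: "partial i h = (\<lambda>x. c * partial i f x)" for i
      unfolding h(1) by (intro ext partial_cmult[OF d])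
    show "partial i h \<in> ?S" for i
      by (intro CollectI exI[of _ "partial i f"] conjI eq schwartz_partial h)
    show "bounded (range (\<lambda>x. norm x ^ k * cmod (h x)))" for k
    proof -
      obtain B where B: "\<And>x. norm x ^ k * cmod (f x) \<le> B"
        using schwartz_bounded[OF h(2), of k] unfolding bounded_iff by auto
      have "norm x ^ k * cmod (h x) \<le> cmod c * B" for x
        using mult_left_mono[OF B[of x], of "cmod c"] by (simp add: h norm_mult mult_ac)
      thus ?thesis unfolding bounded_iff by (intro exI[of _ "cmod c * B"]) auto
    qed
  qed (use f in blast)
qed

section \<open>Characters and modulation\<close>

definition character :: "real ^ 'n \<Rightarrow> real ^ 'n \<Rightarrow> complex" where
  "character t x = exp (2 * of_real pi * \<i> * of_real (t \<bullet> x))"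

lemma character_add: "character (s + t) x = character s x * character t x"
  by (simp add: character_def inner_add_left exp_add[symmetric] algebra_simps)

lemma character_add_right: "character s (x + y) = character s x * character s y"
  by (simp add: character_def inner_add_right exp_add[symmetric] algebra_simps)

lemma norm_character [simp]: "cmod (character t x) = 1"
  by (simp add: character_def norm_exp_eq_Re)

lemma character_0 [simp]: "character 0 x = 1"
  by (simp add: character_def)

lemma character_minus_right: "character t (- x) = cnj (character t x)"
  by (simp add: character_def exp_cnj)

lemma character_has_derivative:
  "(character t has_derivative (\<lambda>h. character t x * (2 * of_real pi * \<i> * of_real (t \<bullet> h)))) (at x)"
proof -
  have "bounded_linear (\<lambda>h. 2 * of_real pi * \<i> * complex_of_real (t \<bullet> h))"
    by (intro bounded_linear_const_mult bounded_linear_compose[OF bounded_linear_of_real] bounded_linear_inner_right)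
  hence "((\<lambda>x. 2 * of_real pi * \<i> * complex_of_real (t \<bullet> x)) has_derivative (\<lambda>h. 2 * of_real pi * \<i> * of_real (t \<bullet> h))) (at x)"
    by (rule bounded_linear_imp_has_derivative)
  from has_derivative_compose[OF this DERIV_exp[unfolded has_field_derivative_def]]
  show ?thesis unfolding character_def .
qed

lemma continuous_character: "continuous_on A (character t)"
  unfolding character_def by (intro continuous_intros)

lemma character_measurable [measurable]: "character t \<in> borel_measurable borel"
  by (intro borel_measurable_continuous_onI continuous_character)

lemma integrable_character_mult:
  assumes sets: "sets M = sets borel" and f: "integrable M f"
  shows "integrable M (\<lambda>x. character t x * f x)"
proof (rule Bochner_Integration.integrable_bound[OF f])
  have [measurable]: "character t \<in> borel_measurable M"
    using character_measurable[of t] by (simp add: measurable_cong_sets[OF sets refl])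
  have [measurable]: "f \<in> borel_measurable M" using f by auto
  show "(\<lambda>x. character t x * f x) \<in> borel_measurable M" by measurable
qed (simp add: norm_mult)

lemma fourier_eq: "fourier f t = (\<integral>x. f x * character (- t) x \<partial>lborel)"
  by (simp add: fourier_def character_def)

lemma fourier_modulate: "fourier (\<lambda>x. character \<tau> x * f x) t = fourier f (t - \<tau>)"
proof -
  have "character (- (t - \<tau>)) x = character \<tau> x * character (- t) x" for x
    using character_add[of \<tau> "- t" x] by simp
  thus ?thesis unfolding fourier_eq by (simp add: mult_ac)
qed

lemma partial_character_mult:
  assumes "f differentiable (at x)"
  shows "partial i (\<lambda>x. character t x * f x) x =
    character t x * (2 * of_real pi * \<i> * of_real (t $ i) * f x + partial i f x)"
proof -
  have "partial i (character t) x = character t x * (2 * of_real pi * \<i> * of_real (t $ i))"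
    by (subst partial_eq[OF character_has_derivative]) (simp add: inner_axis)
  moreover have "character t differentiable (at x)"
    using character_has_derivative unfolding differentiable_def by blast
  ultimately show ?thesis by (subst partial_mult[OF _ assms]) (simp_all add: algebra_simps)
qed

text \<open>A partial derivative keeps the character as a factor and replaces \<open>f\<close> by
  another Schwartz function, so the products form a stable class.\<close>

lemma schwartz_modulate:
  assumes "schwartz f"
  shows "schwartz (\<lambda>x. character t x * f x)"
proof -
  let ?S = "{\<lambda>x. character t x * f x | f. schwartz f}"
  show ?thesis
  proof (rule schwartz_closure[of _ ?S])
    fix h assume "h \<in> ?S"
    then obtain f where h: "h = (\<lambda>x. character t x * f x)" "schwartz f" by blast
    note d = schwartz_differentiable_0[OF h(2)]
    have "character t differentiable (at x)" for x
      using character_has_derivative unfolding differentiable_def by blast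
    thus "h differentiable (at x)" for x unfolding h by (intro differentiable_mult d)
    have eq: "partial i h = (\<lambda>x. character t x * (2 * of_real pi * \<i> * of_real (t $ i) * f x + partial i f x))" for i
      unfolding h(1) by (intro ext partial_character_mult[OF d])
    have "schwartz (\<lambda>x. 2 * of_real pi * \<i> * of_real (t $ i) * f x + partial i f x)" for i
      by (intro schwartz_add schwartz_cmult schwartz_partial h)
    with eq show "partial i h \<in> ?S" for i
      by (intro CollectI exI[of _ "\<lambda>x. 2 * of_real pi * \<i> * of_real (t $ i) * f x + partial i f x"] conjI)
    show "bounded (range (\<lambda>x. norm x ^ k * cmod (h x)))" for k
      using schwartz_bounded[OF h(2), of k] by (simp add: h norm_mult)
  qed (use assms in blast)
qed

lemma power_Suc_norm_le: "(1 + t) ^ K \<le> 2 ^ K * (1 + t ^ K)" if "0 \<le> t" for t :: real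
proof -
  have "1 + t \<le> 2 * max 1 t" by simp
  hence "(1 + t) ^ K \<le> (2 * max 1 t) ^ K" using that by (intro power_mono) auto
  also have "\<dots> = 2 ^ K * max 1 t ^ K" by (simp add: power_mult_distrib)
  also have "max 1 t ^ K \<le> 1 + t ^ K" using that by (cases "t \<le> 1") (auto simp: max_def)
  finally show ?thesis by simp
qed

lemma schwartz_continuous: "schwartz f \<Longrightarrow> continuous_on UNIV f"
  by (intro continuous_at_imp_continuous_on ballI differentiable_imp_continuous_within schwartz_differentiable_0)

lemma rapidly_decreasingI:
  assumes fm: "f \<in> borel_measurable borel" and bd: "\<And>k. \<exists>B. \<forall>x. norm x ^ k * cmod (f x) \<le> B"
  shows "rapidly_decreasing f"
  unfolding rapidly_decreasing_def
proof (intro conjI allI)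
  fix K :: nat
  obtain B C where B: "\<And>x. norm x ^ 0 * cmod (f x) \<le> B" and C: "\<And>x. norm x ^ K * cmod (f x) \<le> C"
    using bd[of 0] bd[of K] by blast
  have "cmod (f x) \<le> 2 ^ K * (B + C) / (1 + norm x) ^ K" for x
  proof -
    have "(1 + norm x) ^ K * cmod (f x) \<le> 2 ^ K * (1 + norm x ^ K) * cmod (f x)"
      by (intro mult_right_mono power_Suc_norm_le) auto
    also have "\<dots> = 2 ^ K * (norm x ^ 0 * cmod (f x) + norm x ^ K * cmod (f x))"
      by (simp add: algebra_simps)
    also have "\<dots> \<le> 2 ^ K * (B + C)" by (intro mult_left_mono add_mono B C) auto
    finally show ?thesis by (subst pos_le_divide_eq) (auto simp: mult.commute add_pos_nonneg)
  qed
  moreover have "0 \<le> B" "0 \<le> C" using B[of 0] C[of 0] by (auto intro: order_trans[rotated])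
  ultimately show "\<exists>D\<ge>0. \<forall>x. cmod (f x) \<le> D / (1 + norm x) ^ K"
    by (intro exI[of _ "2 ^ K * (B + C)"]) auto
qed (rule fm)

lemma schwartz_rapidly_decreasing:
  assumes "schwartz f" shows "rapidly_decreasing f"
proof (rule rapidly_decreasingI)
  show "f \<in> borel_measurable borel"
    using schwartz_continuous[OF assms] by (rule borel_measurable_continuous_onI)
  show "\<exists>B. \<forall>x. norm x ^ k * cmod (f x) \<le> B" for k
    using schwartz_bounded[OF assms, of k] unfolding bounded_iff by auto
qed

lemma integrable_lborel_inverse_power_norm:
  "integrable lborel (\<lambda>x :: real ^ 'n. 1 / (1 + norm x) ^ (DIM(real ^ 'n) + 2))"
proof (rule integrable_inverse_power_norm)
  let ?n = "DIM(real ^ 'n)"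
  fix R :: real assume R: "0 \<le> R"
  have "{x :: real ^ 'n. norm x < R} = ball 0 R" by auto
  hence "emeasure lborel {x :: real ^ 'n. norm x < R} = ennreal (unit_ball_vol ?n * R ^ ?n)"
    using R by (simp add: emeasure_ball)
  also have "\<dots> \<le> ennreal (unit_ball_vol ?n * (1 + R) ^ ?n)"
    using R by (intro ennreal_leI mult_left_mono power_mono) auto
  finally show "emeasure lborel {x :: real ^ 'n. norm x < R} \<le> ennreal (unit_ball_vol ?n * (1 + R) ^ ?n)" .
qed auto

lemma integrable_lborel_rapidly_decreasing:
  fixes f :: "real ^ 'n \<Rightarrow> complex"
  assumes "rapidly_decreasing f" shows "integrable lborel f"
  by (rule integrable_rapidly_decreasing[OF _ integrable_lborel_inverse_power_norm assms]) simp

lemma rapidly_decreasing_modulate: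
  "rapidly_decreasing f \<Longrightarrow> rapidly_decreasing (\<lambda>x. character t x * f x)"
  unfolding rapidly_decreasing_def by (auto simp: norm_mult)

section \<open>Derivatives under the Fourier transform and decay of the transform\<close>

lemma difference_quotient_tendsto:
  fixes f :: "real ^ 'n \<Rightarrow> complex"
  assumes "f differentiable (at x)"
  shows "(\<lambda>m. (f (x + (1 / (real m + 1)) *\<^sub>R axis i 1) - f x) * of_real (real m + 1)) \<longlonglongrightarrow> partial i f x"
proof -
  let ?h = "\<lambda>m::nat. (1 / (real m + 1)) *\<^sub>R (axis i 1 :: real ^ 'n)"
  let ?D = "frechet_derivative f (at x)"
  have D: "(f has_derivative ?D) (at x)" using assms by (simp add: frechet_derivative_works)
  interpret D: bounded_linear ?D using D by (rule has_derivative_bounded_linear)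
  have h0: "filterlim ?h (at 0) sequentially"
  proof (rule filterlim_atI)
    have "(\<lambda>m. 1 / (real m + 1)) \<longlonglongrightarrow> 0" using LIMSEQ_inverse_real_of_nat by (simp add: inverse_eq_divide add.commute)
    hence "?h \<longlonglongrightarrow> 0 *\<^sub>R axis i 1" by (intro tendsto_intros)
    thus "?h \<longlonglongrightarrow> 0" by simp
  qed (auto simp: axis_eq_0_iff)
  have "(\<lambda>h. norm (f (x + h) - f x - ?D h) / norm h) \<midarrow>0\<rightarrow> 0"
    using D by (simp add: has_derivative_at)
  from filterlim_compose[OF this h0]
  have "(\<lambda>m. norm (f (x + ?h m) - f x - ?D (?h m)) / norm (?h m)) \<longlonglongrightarrow> 0" .
  moreover have "norm (f (x + ?h m) - f x - ?D (?h m)) / norm (?h m) =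
      norm ((f (x + ?h m) - f x) * of_real (real m + 1) - partial i f x)" for m
  proof -
    have "?D (?h m) = of_real (1 / (real m + 1)) * partial i f x"
      unfolding D.scaleR by (rule scaleR_conv_of_real)
    hence "(f (x + ?h m) - f x) * of_real (real m + 1) - partial i f x =
        (f (x + ?h m) - f x - ?D (?h m)) * of_real (real m + 1)"
      by (simp add: left_diff_distrib of_real_divide of_real_add[symmetric] del: of_real_add of_nat_add)
    moreover have "norm (?h m) = 1 / (real m + 1)" by simp
    moreover have "cmod (of_real (real m + 1)) = real m + 1" unfolding norm_of_real by simp
    ultimately show ?thesis by (simp only: norm_mult) simp
  qed
  ultimately have "(\<lambda>m. norm ((f (x + ?h m) - f x) * of_real (real m + 1) - partial i f x)) \<longlonglongrightarrow> 0" by simp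
  thus ?thesis unfolding tendsto_norm_zero_iff by (rule LIM_zero_cancel)
qed

lemma difference_le_partial_bound:
  fixes f :: "real ^ 'n \<Rightarrow> complex"
  assumes f: "\<And>x. f differentiable (at x)" and h: "0 \<le> h"
    and B: "\<And>s. 0 \<le> s \<Longrightarrow> s \<le> h \<Longrightarrow> cmod (partial i f (x + s *\<^sub>R axis i 1)) \<le> B"
  shows "cmod (f (x + h *\<^sub>R axis i 1) - f x) \<le> B * h"
proof -
  let ?e = "axis i 1 :: real ^ 'n"
  have "cmod ((\<lambda>s. f (x + s *\<^sub>R ?e)) h - (\<lambda>s. f (x + s *\<^sub>R ?e)) 0) \<le> B * norm (h - 0)"
  proof (rule differentiable_bound[where S = "{0..h}"])
    fix s :: real assume s: "s \<in> {0..h}"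
    let ?D = "frechet_derivative f (at (x + s *\<^sub>R ?e))"
    have D: "(f has_derivative ?D) (at (x + s *\<^sub>R ?e))"
      using f frechet_derivative_works by blast
    interpret D: bounded_linear ?D using D by (rule has_derivative_bounded_linear)
    have "((\<lambda>s. x + s *\<^sub>R ?e) has_derivative (\<lambda>u. u *\<^sub>R ?e)) (at s within {0..h})"
      by (auto intro!: derivative_eq_intros)
    from has_derivative_compose[OF this D]
    show "((\<lambda>s. f (x + s *\<^sub>R ?e)) has_derivative (\<lambda>u. u *\<^sub>R partial i f (x + s *\<^sub>R ?e))) (at s within {0..h})"
      by (simp add: D.scaleR)
    show "onorm (\<lambda>u. u *\<^sub>R partial i f (x + s *\<^sub>R ?e)) \<le> B"
      using B[of s] s by (intro onorm_le) (auto simp: mult.commute[of B] intro!: mult_left_mono)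
  qed (use h in auto)
  thus ?thesis using h by simp
qed

lemma integrable_translate:
  fixes f :: "real ^ 'n \<Rightarrow> complex"
  assumes f: "integrable lborel f"
  shows "integrable lborel (\<lambda>x. f (x + a))" "(\<integral>x. f (x + a) \<partial>lborel) = (\<integral>x. f x \<partial>lborel)"
proof -
  have fm [measurable]: "f \<in> borel_measurable borel" using f by auto
  have "integrable (distr lborel borel ((+) a)) f" using f by (simp add: lborel_distr_plus)
  thus "integrable lborel (\<lambda>x. f (x + a))" by (subst (asm) integrable_distr_eq) (auto simp: add.commute)
  have "(\<integral>x. f x \<partial>lborel) = (\<integral>x. f x \<partial>distr lborel borel ((+) a))" by (simp add: lborel_distr_plus)
  also have "\<dots> = (\<integral>x. f (a + x) \<partial>lborel)" by (rule integral_distr) auto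
  finally show "(\<integral>x. f (x + a) \<partial>lborel) = (\<integral>x. f x \<partial>lborel)" by (simp add: add.commute)
qed

text \<open>By translation invariance every difference quotient has integral 0; the decay of the
  derivative, uniform over shifts by at most 1, allows passage to the limit under the
  integral.\<close>

lemma integral_partial_eq_0:
  fixes f :: "real ^ 'n \<Rightarrow> complex"
  assumes f: "schwartz f"
  shows "(\<integral>x. partial i f x \<partial>lborel) = 0"
proof -
  let ?e = "axis i 1 :: real ^ 'n"
  define q where "q m x = (f (x + (1 / (real m + 1)) *\<^sub>R ?e) - f x) * of_real (real m + 1)" for m x
  note d = schwartz_differentiable_0[OF f]
  have int: "integrable lborel f"
    by (intro integrable_lborel_rapidly_decreasing schwartz_rapidly_decreasing f)
  have [measurable]: "f \<in> borel_measurable borel" using int by auto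
  let ?K = "DIM(real ^ 'n) + 2"
  obtain D where D: "0 \<le> D" "\<And>x. cmod (partial i f x) \<le> D / (1 + norm x) ^ ?K"
    using rapidly_decreasingE[OF schwartz_rapidly_decreasing[OF schwartz_partial[OF f]]] by blast
  have pm: "rapidly_decreasing (partial i f)" by (intro schwartz_rapidly_decreasing schwartz_partial f)
  have q0: "(\<integral>x. q m x \<partial>lborel) = 0" for m
  proof -
    have "(\<integral>x. (f (x + (1 / (real m + 1)) *\<^sub>R ?e) - f x) \<partial>lborel) = 0"
      by (subst Bochner_Integration.integral_diff) (simp_all add: integrable_translate[OF int] int)
    thus ?thesis unfolding q_def by (subst integral_mult_left_zero) simp
  qed
  have "(\<lambda>m. \<integral>x. q m x \<partial>lborel) \<longlonglongrightarrow> (\<integral>x. partial i f x \<partial>lborel)"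
  proof (rule integral_dominated_convergence)
    show "partial i f \<in> borel_measurable lborel" using pm by measurable
    show "q m \<in> borel_measurable lborel" for m unfolding q_def by measurable
    let ?w = "\<lambda>x :: real ^ 'n. 1 / (1 + norm x) ^ ?K"
    show "AE x in lborel. (\<lambda>m. q m x) \<longlonglongrightarrow> partial i f x"
      unfolding q_def using difference_quotient_tendsto[OF d] by (intro AE_I2)
    show "AE x in lborel. norm (q m x) \<le> 2 ^ ?K * D * ?w x" for m
    proof (rule AE_I2)
      fix x :: "real ^ 'n"
      have "cmod (f (x + (1 / (real m + 1)) *\<^sub>R ?e) - f x) \<le> (2 ^ ?K * D * ?w x) * (1 / (real m + 1))"
      proof (rule difference_le_partial_bound[OF d])
        fix s :: real assume s: "0 \<le> s" "s \<le> 1 / (real m + 1)"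
        have "1 / (real m + 1) \<le> 1" by simp
        with s have s1: "s \<le> 1" by linarith
        \<comment> \<open>A shift by at most 1 changes \<open>1 + norm x\<close> by at most the
          factor 2. This is the origin of \<open>2 ^ ?K\<close> in the dominating function.\<close>
        have "norm x \<le> norm (x + s *\<^sub>R ?e) + norm (s *\<^sub>R ?e)"
          using norm_triangle_ineq4[of "x + s *\<^sub>R ?e" "s *\<^sub>R ?e"] by simp
        also have "norm (s *\<^sub>R ?e) \<le> 1" using s s1 by simp
        also have "norm (x + s *\<^sub>R ?e) + 1 \<le> 1 + 2 * norm (x + s *\<^sub>R ?e)" by simp
        finally have "1 + norm x \<le> 2 * (1 + norm (x + s *\<^sub>R ?e))" by simp
        hence "(1 + norm x) ^ ?K \<le> (2 * (1 + norm (x + s *\<^sub>R ?e))) ^ ?K" by (intro power_mono) auto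
        hence "(1 + norm x) ^ ?K \<le> 2 ^ ?K * (1 + norm (x + s *\<^sub>R ?e)) ^ ?K" by (simp only: power_mult_distrib)
        moreover have "0 < (1 + norm x) ^ ?K" "0 < (1 + norm (x + s *\<^sub>R ?e)) ^ ?K" by (simp_all add: add_pos_nonneg)
        ultimately have "1 / (1 + norm (x + s *\<^sub>R ?e)) ^ ?K \<le> 2 ^ ?K * ?w x"
          by (simp add: divide_simps mult_ac)
        hence "D * (1 / (1 + norm (x + s *\<^sub>R ?e)) ^ ?K) \<le> D * (2 ^ ?K * ?w x)"
          using D by (intro mult_left_mono) auto
        thus "cmod (partial i f (x + s *\<^sub>R ?e)) \<le> 2 ^ ?K * D * ?w x"
          using D(2)[of "x + s *\<^sub>R ?e"] by (simp add: mult_ac)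
      qed auto
      hence "cmod (f (x + (1 / (real m + 1)) *\<^sub>R ?e) - f x) \<le> (2 ^ ?K * D * ?w x) / (real m + 1)"
        by (simp only: times_divide_eq_right mult_1_right)
      hence "cmod (f (x + (1 / (real m + 1)) *\<^sub>R ?e) - f x) * (real m + 1) \<le> 2 ^ ?K * D * ?w x"
        by (rule pos_le_divide_eq[THEN iffD1, rotated]) simp
      moreover have "cmod (of_real (real m + 1)) = real m + 1" unfolding norm_of_real by simp
      ultimately show "norm (q m x) \<le> 2 ^ ?K * D * ?w x" unfolding q_def norm_mult by simp
    qed
    show "integrable lborel (\<lambda>x. 2 ^ ?K * D * ?w x)"
      by (intro integrable_mult_right integrable_lborel_inverse_power_norm)
  qed
  thus ?thesis by (simp add: q0 LIMSEQ_const_iff)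
qed

text \<open>Integration by parts: the partial derivative of \<open>character (- t) x * f x\<close>
  has integral 0, and the product rule splits it into the two transforms.\<close>

lemma fourier_partial:
  fixes f :: "real ^ 'n \<Rightarrow> complex"
  assumes f: "schwartz f"
  shows "fourier (partial i f) t = 2 * of_real pi * \<i> * of_real (t $ i) * fourier f t"
proof -
  let ?c = "2 * of_real pi * \<i> * of_real (t $ i) :: complex"
  have int: "integrable lborel (\<lambda>x. g x * character (- t) x)" if "schwartz g" for g
    using integrable_lborel_rapidly_decreasing[OF rapidly_decreasing_modulate[OF schwartz_rapidly_decreasing[OF that]], of "- t"]
    by (simp add: mult.commute)
  have "0 = (\<integral>x. partial i (\<lambda>x. character (- t) x * f x) x \<partial>lborel)"
    by (rule integral_partial_eq_0[symmetric]) (rule schwartz_modulate[OF f])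
  also have "\<dots> = (\<integral>x. partial i f x * character (- t) x - ?c * (f x * character (- t) x) \<partial>lborel)"
    by (intro Bochner_Integration.integral_cong refl, subst partial_character_mult[OF schwartz_differentiable_0[OF f]])
       (simp add: algebra_simps)
  also have "\<dots> = fourier (partial i f) t - ?c * fourier f t"
    unfolding fourier_eq using int[OF f] int[OF schwartz_partial[OF f]] by (subst Bochner_Integration.integral_diff) auto
  finally show ?thesis by simp
qed

lemma continuous_fourier:
  fixes f :: "real ^ 'n \<Rightarrow> complex"
  assumes f: "rapidly_decreasing f"
  shows "continuous_on UNIV (fourier f)"
proof (rule continuous_on_sequentiallyI)
  fix u :: "nat \<Rightarrow> real ^ 'n" and a assume u: "u \<longlonglongrightarrow> a"
  have [measurable]: "f \<in> borel_measurable borel" using f by (rule rapidly_decreasing_measurable)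
  have "(\<lambda>n. \<integral>x. f x * character (- u n) x \<partial>lborel) \<longlonglongrightarrow> (\<integral>x. f x * character (- a) x \<partial>lborel)"
  proof (rule integral_dominated_convergence[where w = "\<lambda>x. norm (f x)"])
    show "integrable lborel (\<lambda>x. norm (f x))"
      using integrable_lborel_rapidly_decreasing[OF f] by simp
    show "AE x in lborel. (\<lambda>n. f x * character (- u n) x) \<longlonglongrightarrow> f x * character (- a) x"
      unfolding character_def by (intro AE_I2 tendsto_intros u)
  qed (auto simp: norm_mult)
  thus "(\<lambda>n. fourier f (u n)) \<longlonglongrightarrow> fourier f a" by (simp add: fourier_eq)
qed

text \<open>Each factor \<open>t $ i\<close> is traded for one more partial derivative of the
  function, whose transform is bounded by the integral of its modulus.\<close>

lemma rapidly_decreasing_fourier: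
  fixes f :: "real ^ 'n \<Rightarrow> complex"
  assumes f: "schwartz f"
  shows "rapidly_decreasing (fourier f)"
proof (rule rapidly_decreasingI)
  show "fourier f \<in> borel_measurable borel"
    by (intro borel_measurable_continuous_onI continuous_fourier schwartz_rapidly_decreasing f)
  have coord: "\<exists>D. \<forall>t. \<bar>t $ i\<bar> ^ k * cmod (fourier g t) \<le> D" if "schwartz g" for g i k
    using that
  proof (induction k arbitrary: g)
    case (0 g)
    have "cmod (fourier g t) \<le> (\<integral>x. cmod (g x) \<partial>lborel)" for t
      unfolding fourier_eq using integral_norm_bound[of lborel "\<lambda>x. g x * character (- t) x"] by (simp add: norm_mult)
    thus ?case by auto
  next
    case (Suc k g)
    obtain D where D: "\<And>t. \<bar>t $ i\<bar> ^ k * cmod (fourier (partial i g) t) \<le> D"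
      using Suc.IH[OF schwartz_partial[OF Suc.prems]] by blast
    have "\<bar>t $ i\<bar> ^ Suc k * cmod (fourier g t) \<le> D" for t
    proof -
      \<comment> \<open>The factor \<open>2 * pi\<close> that the derivative produces exceeds 1, so
        inserting it keeps the bound.\<close>
      have "\<bar>t $ i\<bar> * cmod (fourier g t) \<le> 2 * pi * (\<bar>t $ i\<bar> * cmod (fourier g t))"
        using pi_gt3 by (intro mult_right_mono[of 1 "2 * pi", simplified]) auto
      also have "\<dots> = cmod (fourier (partial i g) t)"
        by (simp add: fourier_partial[OF Suc.prems] norm_mult)
      finally have "\<bar>t $ i\<bar> ^ k * (\<bar>t $ i\<bar> * cmod (fourier g t)) \<le> \<bar>t $ i\<bar> ^ k * cmod (fourier (partial i g) t)"
        by (intro mult_left_mono) auto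
      thus ?thesis using D[of t] by (simp add: mult_ac)
    qed
    thus ?case by blast
  qed
  fix k
  have "\<forall>i. \<exists>D. \<forall>t. \<bar>t $ i\<bar> ^ k * cmod (fourier f t) \<le> D" using coord[OF f] by blast
  then obtain D where D: "\<And>i t. \<bar>t $ i\<bar> ^ k * cmod (fourier f t) \<le> D i" by metis
  have D0: "0 \<le> D i" for i using order_trans[OF _ D[of 0 i]] by simp
  let ?n = "real CARD('n)"
  have "norm t ^ k * cmod (fourier f t) \<le> ?n ^ k * (\<Sum>i\<in>UNIV. D i)" for t
  proof -
    \<comment> \<open>The norm is at most \<open>?n\<close> times the largest coordinate. As the
      index of that coordinate depends on \<open>t\<close>, the bounds \<open>D i\<close> are added
      up.\<close>
    obtain m where m: "\<And>i. \<bar>t $ i\<bar> \<le> \<bar>t $ m\<bar>"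
    proof -
      have "Max (range (\<lambda>i. \<bar>t $ i\<bar>)) \<in> range (\<lambda>i. \<bar>t $ i\<bar>)" by (rule Max_in) auto
      then obtain m where "Max (range (\<lambda>i. \<bar>t $ i\<bar>)) = \<bar>t $ m\<bar>" by (rule imageE)
      thus ?thesis using that[of m] by (metis Max_ge finite_class.finite finite_imageI rangeI)
    qed
    have "norm t \<le> (\<Sum>i\<in>UNIV. \<bar>t $ i\<bar>)" by (rule norm_le_l1_cart)
    also have "\<dots> \<le> ?n * \<bar>t $ m\<bar>" using m by (intro sum_bounded_above[where 'a=real, THEN order_trans]) auto
    finally have "norm t ^ k * cmod (fourier f t) \<le> (?n * \<bar>t $ m\<bar>) ^ k * cmod (fourier f t)"
      by (intro mult_right_mono power_mono) auto
    also have "\<dots> = ?n ^ k * (\<bar>t $ m\<bar> ^ k * cmod (fourier f t))" by (simp add: power_mult_distrib)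
    also have "\<dots> \<le> ?n ^ k * D m" by (intro mult_left_mono D) auto
    also have "\<dots> \<le> ?n ^ k * (\<Sum>i\<in>UNIV. D i)"
      using D0 by (intro mult_left_mono member_le_sum) auto
    finally show ?thesis .
  qed
  thus "\<exists>B. \<forall>t. norm t ^ k * cmod (fourier f t) \<le> B" by blast
qed

section \<open>Boundedness of the masses\<close>

definition gaussian :: "real \<Rightarrow> real ^ 'n \<Rightarrow> complex" where
  "gaussian a x = exp (of_real (- (a * (x \<bullet> x))))"

text \<open>The products of the Gaussian with polynomials, generated by rules so that stability
  under partial derivatives and decay can be proved by induction.\<close>

inductive_set gaussian_span :: "real \<Rightarrow> (real ^ 'n \<Rightarrow> complex) set" for a where
  base: "gaussian a \<in> gaussian_span a"
| coord: "g \<in> gaussian_span a \<Longrightarrow> (\<lambda>x. of_real (x $ i) * g x) \<in> gaussian_span a"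
| cmult: "g \<in> gaussian_span a \<Longrightarrow> (\<lambda>x. c * g x) \<in> gaussian_span a"
| add: "g \<in> gaussian_span a \<Longrightarrow> h \<in> gaussian_span a \<Longrightarrow> (\<lambda>x. g x + h x) \<in> gaussian_span a"

lemma gaussian_has_derivative:
  "(gaussian a has_derivative (\<lambda>h. gaussian a x * of_real (- (a * (2 * (x \<bullet> h)))))) (at x)"
proof -
  have "((\<lambda>x. - (a * (x \<bullet> x))) has_derivative (\<lambda>h. - (a * (2 * (x \<bullet> h))))) (at x)"
    by (auto intro!: derivative_eq_intros simp: inner_commute algebra_simps)
  from has_derivative_compose[OF has_derivative_of_real[OF this] DERIV_exp[unfolded has_field_derivative_def]]
  show ?thesis unfolding gaussian_def .
qed

lemma coord_has_derivative: "((\<lambda>x. complex_of_real (x $ i)) has_derivative (\<lambda>h. of_real (h $ i))) (at x)"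
  by (intro has_derivative_of_real bounded_linear_imp_has_derivative bounded_linear_vec_nth)

lemma coord_differentiable: "(\<lambda>x. complex_of_real (x $ i)) differentiable (at x)"
  using coord_has_derivative unfolding differentiable_def by blast

lemma gaussian_span_differentiable:
  assumes "g \<in> gaussian_span a" shows "g differentiable (at x)"
  using assms
proof (induction arbitrary: x rule: gaussian_span.induct)
  case base
  show ?case using gaussian_has_derivative unfolding differentiable_def by blast
next
  case (coord g i)
  show ?case by (intro differentiable_mult coord_differentiable coord.IH)
next
  case (cmult g c)
  show ?case by (intro differentiable_mult differentiable_const cmult.IH)
next
  case (add g h)
  show ?case by (intro differentiable_add add.IH)
qed

lemma gaussian_span_partial:
  assumes "g \<in> gaussian_span a" shows "partial i g \<in> gaussian_span a"
  using assms
proof (induction rule: gaussian_span.induct)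
  case base
  have "partial i (gaussian a) = (\<lambda>x. of_real (- 2 * a) * (of_real (x $ i) * gaussian a x))"
    by (intro ext, subst partial_eq[OF gaussian_has_derivative]) (simp add: inner_axis)
  moreover have "(\<lambda>x. of_real (- 2 * a) * (of_real (x $ i) * gaussian a x)) \<in> gaussian_span a"
    by (intro gaussian_span.intros)
  ultimately show ?case by simp
next
  case (coord g j)
  have "partial i (\<lambda>x. of_real (x $ j) * g x) = (\<lambda>x. of_real (x $ j) * partial i g x + of_real (axis i 1 $ j) * g x)"
    by (intro ext, subst partial_mult[OF coord_differentiable gaussian_span_differentiable[OF coord.hyps]],
        subst partial_eq[OF coord_has_derivative]) simp
  moreover have "(\<lambda>x. of_real (x $ j) * partial i g x + of_real (axis i 1 $ j) * g x) \<in> gaussian_span a"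
    by (intro gaussian_span.add gaussian_span.coord gaussian_span.cmult coord)
  ultimately show ?case by simp
next
  case (cmult g c)
  have "partial i (\<lambda>x. c * g x) = (\<lambda>x. c * partial i g x)"
    by (intro ext partial_cmult gaussian_span_differentiable[OF cmult.hyps])
  thus ?case using gaussian_span.cmult[OF cmult.IH] by simp
next
  case (add g h)
  have "partial i (\<lambda>x. g x + h x) = (\<lambda>x. partial i g x + partial i h x)"
    by (intro ext partial_add gaussian_span_differentiable[OF add.hyps(1)] gaussian_span_differentiable[OF add.hyps(2)])
  thus ?case using gaussian_span.add[OF add.IH] by simp
qed

text \<open>This is the \<open>k\<close>-th power of \<open>u / k \<le> exp (u / k)\<close>; for
  \<open>k = 0\<close> the constant is \<open>0 ^ 0 = 1\<close>.\<close>

lemma power_le_power_self_exp: "u ^ k \<le> real k ^ k * exp u" if "0 \<le> u" for u :: real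
proof (cases "k = 0")
  case False
  have "u / k \<le> exp (u / k)" using exp_ge_add_one_self[of "u / k"] by linarith
  hence "(u / k) ^ k \<le> exp (u / k) ^ k" using that by (intro power_mono) auto
  also have "\<dots> = exp u" using False by (simp add: exp_of_nat_mult[symmetric])
  finally show ?thesis using False by (simp add: power_divide field_simps)
qed (use that in simp)

lemma norm_power_gaussian_le:
  assumes a: "0 < a"
  shows "norm x ^ k * cmod (gaussian a x) \<le> 1 + real k ^ k / a ^ k"
proof -
  let ?t = "norm x" and ?u = "a * norm x ^ 2"
  have g: "cmod (gaussian a x) = exp (- ?u)" by (simp add: gaussian_def norm_exp_eq_Re power2_norm_eq_inner)
  \<comment> \<open>Doubling the exponent expresses the power through \<open>norm x ^ 2\<close>, on
    which the Gaussian depends.\<close>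
  have "?t ^ k \<le> 1 + (?t ^ 2) ^ k"
  proof (cases "?t \<le> 1")
    case True
    hence "?t ^ k \<le> 1" by (intro power_le_one) auto
    thus ?thesis by (simp add: add_increasing2)
  next
    case False
    hence "?t ^ k \<le> (?t ^ 2) ^ k" by (intro power_mono self_le_power) auto
    thus ?thesis by simp
  qed
  also have "(?t ^ 2) ^ k = ?u ^ k / a ^ k" using a by (simp add: power_mult_distrib)
  also have "\<dots> \<le> (real k ^ k * exp ?u) / a ^ k"
    using a by (intro divide_right_mono power_le_power_self_exp) auto
  finally have "?t ^ k * exp (- ?u) \<le> (1 + (real k ^ k * exp ?u) / a ^ k) * exp (- ?u)"
    by (intro mult_right_mono) auto
  also have "\<dots> = exp (- ?u) + real k ^ k / a ^ k" by (simp add: distrib_right exp_minus)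
  also have "\<dots> \<le> 1 + real k ^ k / a ^ k" using a by simp
  finally show ?thesis by (simp add: g)
qed

lemma gaussian_span_bounded:
  assumes g: "g \<in> gaussian_span a" and a: "0 < a"
  shows "\<exists>B. \<forall>x. norm x ^ k * cmod (g x) \<le> B"
  using g
proof (induction arbitrary: k rule: gaussian_span.induct)
  case base
  show ?case using norm_power_gaussian_le[OF a] by blast
next
  case (coord g i)
  obtain B where B: "\<And>x. norm x ^ Suc k * cmod (g x) \<le> B" using coord.IH by blast
  have "norm x ^ k * cmod (of_real (x $ i) * g x) \<le> B" for x
  proof -
    have "norm x ^ k * cmod (of_real (x $ i) * g x) = norm x ^ k * cmod (g x) * \<bar>x $ i\<bar>" by (simp add: norm_mult)
    also have "\<dots> \<le> norm x ^ k * cmod (g x) * norm x"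
      using component_le_norm_cart[of x i] by (intro mult_left_mono) auto
    also have "\<dots> \<le> B" using B[of x] by (simp add: mult_ac)
    finally show ?thesis .
  qed
  thus ?case by blast
next
  case (cmult g c)
  obtain B where B: "\<And>x. norm x ^ k * cmod (g x) \<le> B" using cmult.IH by blast
  have "norm x ^ k * cmod (c * g x) \<le> cmod c * B" for x
    using mult_left_mono[OF B[of x], of "cmod c"] by (simp add: norm_mult mult_ac)
  thus ?case by blast
next
  case (add g h)
  obtain B C where B: "\<And>x. norm x ^ k * cmod (g x) \<le> B" and C: "\<And>x. norm x ^ k * cmod (h x) \<le> C"
    using add.IH by meson
  have "norm x ^ k * cmod (g x + h x) \<le> B + C" for x
  proof -
    have "norm x ^ k * cmod (g x + h x) \<le> norm x ^ k * (cmod (g x) + cmod (h x))"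
      by (intro mult_left_mono norm_triangle_ineq) auto
    thus ?thesis using B[of x] C[of x] by (simp add: distrib_left)
  qed
  thus ?case by blast
qed

lemma schwartz_gaussian:
  assumes a: "0 < a" shows "schwartz (gaussian a)"
proof (rule schwartz_closure[OF gaussian_span.base])
  fix g :: "real ^ 'n \<Rightarrow> complex" and k assume g: "g \<in> gaussian_span a"
  obtain B where B: "\<And>x. norm x ^ k * cmod (g x) \<le> B" using gaussian_span_bounded[OF g a] by blast
  thus "bounded (range (\<lambda>x. norm x ^ k * cmod (g x)))" unfolding bounded_iff by (intro exI[of _ B]) auto
qed (rule gaussian_span_differentiable gaussian_span_partial; assumption)+

text \<open>For large \<open>a\<close> the Gaussian itself is wide and its transform narrow.
  Concentration is wanted on the side of \<open>\<mu>\<close>, where the transform is evaluated,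
  which explains the parameter \<open>1 / a ^ 2\<close>.\<close>

lemma fourier_gaussian_scale:
  assumes a: "0 < a"
  shows "fourier (gaussian (1 / a ^ 2)) (t :: real ^ 'n) = of_real (a ^ CARD('n)) * fourier (gaussian 1) (a *\<^sub>R t)"
proof -
  let ?n = "CARD('n)"
  have gm [measurable]: "gaussian b \<in> borel_measurable borel" for b :: real
    unfolding gaussian_def by (intro borel_measurable_continuous_onI continuous_intros)
  let ?f = "\<lambda>x :: real ^ 'n. gaussian (1 / a ^ 2) x * character (- t) x"
  have "fourier (gaussian (1 / a ^ 2)) t = (\<integral>x. ?f x \<partial>density (distr lborel borel (\<lambda>x. 0 + a *\<^sub>R x)) (\<lambda>_. ennreal (a ^ ?n)))"
    unfolding fourier_eq using lborel_affine[of a "0 :: real ^ 'n"] a by (simp add: ennreal_power)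
  also have "\<dots> = (\<integral>x. (a ^ ?n) *\<^sub>R ?f x \<partial>distr lborel borel (\<lambda>x. 0 + a *\<^sub>R x))"
    using a by (intro integral_density) auto
  also have "\<dots> = (\<integral>x. (a ^ ?n) *\<^sub>R ?f (0 + a *\<^sub>R x) \<partial>lborel)"
    by (intro integral_distr) auto
  also have "\<dots> = (\<integral>x. (a ^ ?n) *\<^sub>R (gaussian 1 x * character (- (a *\<^sub>R t)) x) \<partial>lborel)"
  proof (intro Bochner_Integration.integral_cong refl)
    fix x :: "real ^ 'n"
    have "gaussian (1 / a ^ 2) (a *\<^sub>R x) = gaussian 1 x" using a by (simp add: gaussian_def power2_eq_square)
    moreover have "character (- t) (a *\<^sub>R x) = character (- (a *\<^sub>R t)) x" by (simp add: character_def)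
    ultimately show "(a ^ ?n) *\<^sub>R ?f (0 + a *\<^sub>R x) = (a ^ ?n) *\<^sub>R (gaussian 1 x * character (- (a *\<^sub>R t)) x)" by simp
  qed
  also have "\<dots> = of_real (a ^ ?n) * fourier (gaussian 1) (a *\<^sub>R t)"
    unfolding fourier_eq by (subst integral_scaleR_right) (simp add: scaleR_conv_of_real)
  finally show ?thesis .
qed

text \<open>The value at 0 is the integral of a strictly positive function. It multiplies the mass
  to be isolated and is later divided out.\<close>

lemma fourier_gaussian_0: "fourier (gaussian 1) (0 :: real ^ 'n) \<noteq> 0"
proof
  let ?g = "\<lambda>x :: real ^ 'n. exp (- (x \<bullet> x))"
  assume 0: "fourier (gaussian 1) (0 :: real ^ 'n) = 0"
  have eq: "gaussian 1 x = complex_of_real (?g x)" for x by (simp add: gaussian_def exp_of_real[symmetric])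
  have "integrable lborel (gaussian 1 :: real ^ 'n \<Rightarrow> complex)"
    by (intro integrable_lborel_rapidly_decreasing schwartz_rapidly_decreasing schwartz_gaussian) auto
  hence int: "integrable lborel ?g" unfolding eq [abs_def] by (simp only: complex_of_real_integrable_eq)
  have "(\<integral>x. ?g x \<partial>lborel) = 0"
    using 0 by (simp add: fourier_eq eq)
  hence "AE x in lborel. ?g x = 0" using int by (subst (asm) integral_nonneg_eq_0_iff_AE) auto
  hence "AE x in (lborel :: (real ^ 'n) measure). False" by simp
  hence "emeasure (lborel :: (real ^ 'n) measure) UNIV = 0" by (simp add: AE_iff_null null_sets_def)
  thus False by simp
qed

section \<open>Uniform bound for the masses\<close>

lemma separated_translate_abs_summable:
  fixes S :: "'a::euclidean_space set"
  assumes \<delta>: "0 < \<delta>" and sep: "separated \<delta> S"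
  shows "(\<lambda>x. 1 / (1 + norm (x - c)) ^ (DIM('a) + 2)) abs_summable_on S"
    and "(\<Sum>\<^sub>ax\<in>S. 1 / (1 + norm (x - c)) ^ (DIM('a) + 2)) \<le> separation_const DIM('a) \<delta> * shell_const DIM('a)"
proof -
  let ?T = "(\<lambda>x. x - c) ` S"
  have bij: "bij_betw (\<lambda>x. x - c) S ?T" by (intro bij_betw_imageI) (auto simp: inj_on_def)
  have sepT: "separated \<delta> ?T"
    using sep by (auto simp: dist_norm)
  note * = separated_abs_summable[OF \<delta> sepT]
  show "(\<lambda>x. 1 / (1 + norm (x - c)) ^ (DIM('a) + 2)) abs_summable_on S"
    using *(1) by (subst (asm) abs_summable_on_reindex_bij_betw[OF bij, symmetric])
  show "(\<Sum>\<^sub>ax\<in>S. 1 / (1 + norm (x - c)) ^ (DIM('a) + 2)) \<le> separation_const DIM('a) \<delta> * shell_const DIM('a)"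
    using *(2) by (subst (asm) infsetsum_reindex_bij_betw[OF bij, symmetric])
qed

text \<open>A simple form of Peetre's inequality: it recentres polynomial weights from the origin to
  \<open>x\<close>.\<close>

lemma one_plus_norm_le:
  fixes x y :: "'a::real_normed_vector"
  shows "1 + norm y \<le> (1 + norm x) * (1 + norm (y - x))"
proof -
  have "0 \<le> norm x * norm (y - x)" by simp
  moreover have "(1 + norm x) * (1 + norm (y - x)) = 1 + norm x + norm (y - x) + norm x * norm (y - x)"
    by (simp add: algebra_simps)
  ultimately show ?thesis using norm_triangle_sub[of y x] by linarith
qed

lemma divide_power_le:
  fixes x y :: "'a::real_normed_vector"
  assumes "b \<le> M * (1 + norm (y - x)) ^ N"
  shows "b / (1 + norm (y - x)) ^ (N + k) \<le> M * (1 / (1 + norm (y - x)) ^ k)"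
proof -
  have pos: "0 < 1 + norm (y - x)" by (simp add: add_pos_nonneg)
  have "b / (1 + norm (y - x)) ^ (N + k) \<le> M * (1 + norm (y - x)) ^ N / (1 + norm (y - x)) ^ (N + k)"
    using assms by (intro divide_right_mono) auto
  also have "\<dots> = M * (1 / (1 + norm (y - x)) ^ k)" using pos by (simp only: power_add) (simp add: divide_simps)
  finally show ?thesis .
qed

lemma mult_power_one_plus_norm_le:
  fixes x y :: "'a::real_normed_vector"
  assumes "0 \<le> B"
  shows "B * (1 + norm y) ^ N \<le> B * (1 + norm x) ^ N * (1 + norm (y - x)) ^ N"
proof -
  have "(1 + norm y) ^ N \<le> ((1 + norm x) * (1 + norm (y - x))) ^ N" by (intro power_mono one_plus_norm_le) auto
  from mult_left_mono[OF this assms] show ?thesis by (simp only: power_mult_distrib mult.assoc)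
qed

text \<open>The polynomial bound on \<open>b\<close> is improved by a factor 2 at each application of the assumed
  self-improving inequality.\<close>

lemma self_improving_bound:
  fixes \<Lambda> :: "'a::euclidean_space set" and b :: "'a \<Rightarrow> real"
  assumes \<delta>: "0 < \<delta>" and sep: "separated \<delta> \<Lambda>"
    and b0: "\<And>x. 0 \<le> b x" and b: "\<And>x. x \<in> \<Lambda> \<Longrightarrow> b x \<le> B * (1 + norm x) ^ N" and B: "0 \<le> B"
    and C: "0 \<le> C" and \<epsilon>: "0 \<le> \<epsilon>" "\<epsilon> * (separation_const DIM('a) \<delta> * shell_const DIM('a)) \<le> 1 / 2"
    and self: "\<And>x. x \<in> \<Lambda> \<Longrightarrow> b x \<le> C + \<epsilon> * (\<Sum>\<^sub>ay\<in>\<Lambda> - {x}. b y / (1 + norm (y - x)) ^ (N + (DIM('a) + 2)))"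
    and x: "x \<in> \<Lambda>"
  shows "b x \<le> 2 * C"
proof -
  let ?n = "DIM('a)"
  let ?S = "separation_const ?n \<delta> * shell_const ?n"
  have bound: "b x \<le> 2 * C + B / 2 ^ m * (1 + norm x) ^ N" if "x \<in> \<Lambda>" for m x
    using that
  proof (induction m arbitrary: x)
    case (0 x)
    thus ?case using b[of x] C by simp
  next
    case (Suc m x)
    let ?E = "B / 2 ^ m"
    let ?M = "2 * C + ?E * (1 + norm x) ^ N"
    have M0: "0 \<le> ?M" using B C by simp
    have summand: "b y / (1 + norm (y - x)) ^ (N + (?n + 2)) \<le> ?M * (1 / (1 + norm (y - x)) ^ (?n + 2))"
      if y: "y \<in> \<Lambda> - {x}" for y
    proof -
      let ?d = "1 + norm (y - x)"
      have d: "1 \<le> ?d" by simp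
      have "?E * (1 + norm y) ^ N \<le> ?E * (1 + norm x) ^ N * ?d ^ N"
        using B by (intro mult_power_one_plus_norm_le) auto
      moreover have "2 * C \<le> 2 * C * ?d ^ N" using C d by (intro mult_le_cancel_left1[THEN iffD2] conjI impI one_le_power) auto
      moreover have "b y \<le> 2 * C + ?E * (1 + norm y) ^ N" using Suc.IH y by auto
      moreover have "?M * ?d ^ N = 2 * C * ?d ^ N + ?E * (1 + norm x) ^ N * ?d ^ N" by (rule distrib_right)
      ultimately have "b y \<le> ?M * ?d ^ N" by linarith
      thus ?thesis by (rule divide_power_le)
    qed
    have sm: "(\<lambda>y. 1 / (1 + norm (y - x)) ^ (?n + 2)) abs_summable_on \<Lambda> - {x}"
      by (rule separated_translate_abs_summable(1)[OF \<delta>]) (use sep in auto)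
    have sm': "(\<lambda>y. ?M * (1 / (1 + norm (y - x)) ^ (?n + 2))) abs_summable_on \<Lambda> - {x}"
      by (intro abs_summable_on_cmult_right sm)
    have "(\<Sum>\<^sub>ay\<in>\<Lambda> - {x}. b y / (1 + norm (y - x)) ^ (N + (?n + 2))) \<le> (\<Sum>\<^sub>ay\<in>\<Lambda> - {x}. ?M * (1 / (1 + norm (y - x)) ^ (?n + 2)))"
    proof (rule infsetsum_mono[OF _ sm' summand])
      show "(\<lambda>y. b y / (1 + norm (y - x)) ^ (N + (?n + 2))) abs_summable_on \<Lambda> - {x}"
        by (rule abs_summable_on_comparison_test'[OF sm']) (use summand b0 in \<open>simp add: abs_of_nonneg\<close>)
    qed
    also have "\<dots> = ?M * (\<Sum>\<^sub>ay\<in>\<Lambda> - {x}. 1 / (1 + norm (y - x)) ^ (?n + 2))"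
      by (intro infsetsum_cmult_right sm)
    also have "\<dots> \<le> ?M * ?S"
      using M0 by (intro mult_left_mono separated_translate_abs_summable(2)[OF \<delta>]) (use sep in auto)
    finally have "b x \<le> C + \<epsilon> * (?M * ?S)"
      using self[OF Suc.prems] \<epsilon>(1) by (meson add_left_mono mult_left_mono order_trans)
    also have "\<epsilon> * (?M * ?S) = ?M * (\<epsilon> * ?S)" by (simp add: mult_ac)
    also have "?M * (\<epsilon> * ?S) \<le> ?M * (1 / 2)" using M0 \<epsilon>(2) by (intro mult_left_mono) auto
    \<comment> \<open>\<open>C\<close> plus half of \<open>?M\<close> equals \<open>2 * C\<close>
      plus half of the growing term. So \<open>2 * C\<close> is reproduced at each pass and is what
      remains in the limit.\<close>
    finally show ?case by (simp add: field_simps)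
  qed
  have "(\<lambda>m. 2 * C + B * (1 + norm x) ^ N * (1 / 2) ^ m) \<longlonglongrightarrow> 2 * C + B * (1 + norm x) ^ N * 0"
    by (intro tendsto_intros LIMSEQ_realpow_zero) auto
  hence "(\<lambda>m. 2 * C + B / 2 ^ m * (1 + norm x) ^ N) \<longlonglongrightarrow> 2 * C"
    by (simp add: power_divide mult_ac)
  thus ?thesis using bound[OF x] by (intro LIMSEQ_le_const) auto
qed

text \<open>Characters have modulus 1, so \<open>\<tau>\<close> disappears from the bound; this
  uniformity is what bounds the masses of \<open>\<mu>\<close>.\<close>

lemma norm_pairing_modulate_le:
  fixes \<nu> :: "(real ^ 'n) set \<Rightarrow> complex"
  shows "cmod (pairing \<nu> (\<lambda>x. character \<tau> x * f x)) \<le> (\<Sum>k<4. \<integral>x. cmod (f x) \<partial>jordan_part k \<nu>)"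
proof -
  have "cmod (pairing \<nu> (\<lambda>x. character \<tau> x * f x)) \<le> (\<Sum>k<4. cmod (jordan_coeff k * (\<integral>x. character \<tau> x * f x \<partial>jordan_part k \<nu>)))"
    unfolding pairing_eq_jordan by (rule norm_sum)
  also have "\<dots> \<le> (\<Sum>k<4. \<integral>x. cmod (f x) \<partial>jordan_part k \<nu>)"
  proof (intro sum_mono)
    fix k
    show "cmod (jordan_coeff k * (\<integral>x. character \<tau> x * f x \<partial>jordan_part k \<nu>)) \<le> (\<integral>x. cmod (f x) \<partial>jordan_part k \<nu>)"
      using integral_norm_bound[of "jordan_part k \<nu>" "\<lambda>x. character \<tau> x * f x"] by (simp add: norm_mult)
  qed
  finally show ?thesis .
qed

text \<open>The bridge between the two sides: modulating the test function paired with
  \<open>\<nu>\<close> shifts its transform along \<open>\<mu>\<close>.\<close>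

lemma fourier_pairing_modulate:
  fixes \<mu> \<nu> :: "(real ^ 'n) set \<Rightarrow> complex"
  assumes ft: "has_fourier_transform \<mu> \<nu>" and sp: "sum_of_point_masses \<Lambda> \<mu>" and \<Lambda>: "countable \<Lambda>"
    and f: "schwartz f"
  shows "(\<lambda>x. \<mu> {x} * fourier f (x - \<tau>)) abs_summable_on \<Lambda>"
    and "pairing \<nu> (\<lambda>x. character \<tau> x * f x) = (\<Sum>\<^sub>ax\<in>\<Lambda>. \<mu> {x} * fourier f (x - \<tau>))"
proof -
  have si: "slowly_increasing \<mu>" using ft by (simp add: has_fourier_transform_def)
  have sc: "schwartz (\<lambda>x. character \<tau> x * f x)" by (rule schwartz_modulate[OF f])
  have int: "integrable (jordan_part k \<mu>) (fourier (\<lambda>x. character \<tau> x * f x))" for k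
    by (intro integrable_jordan_part si rapidly_decreasing_fourier sc)
  have cm: "complex_measure \<mu>" using si by (simp add: slowly_increasing_def)
  note * = pairing_point_masses[OF cm sp \<Lambda> int]
  show "(\<lambda>x. \<mu> {x} * fourier f (x - \<tau>)) abs_summable_on \<Lambda>" using *(1) by (simp only: fourier_modulate)
  have "pairing \<nu> (\<lambda>x. character \<tau> x * f x) = pairing \<mu> (fourier (\<lambda>x. character \<tau> x * f x))"
    using ft sc by (simp add: has_fourier_transform_def)
  also have "\<dots> = (\<Sum>\<^sub>ax\<in>\<Lambda>. \<mu> {x} * fourier f (x - \<tau>))" unfolding *(2) fourier_modulate ..
  finally show "pairing \<nu> (\<lambda>x. character \<tau> x * f x) = (\<Sum>\<^sub>ax\<in>\<Lambda>. \<mu> {x} * fourier f (x - \<tau>))" .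
qed

lemma separated_imp_countable:
  fixes S :: "'a::euclidean_space set"
  assumes "0 < \<delta>" and "separated \<delta> S"
  shows "countable S"
proof -
  have "countable {x \<in> S. norm x < real n}" for n
    by (intro countable_finite separated_card_le(1)[OF assms]) auto
  hence "countable (\<Union>n. {x \<in> S. norm x < real n})" by (intro countable_UN) auto
  moreover have "(\<Union>n. {x \<in> S. norm x < real n}) = S" using reals_Archimedean2 by auto
  ultimately show ?thesis by simp
qed

text \<open>The point \<open>x\<close> lies in the ball of radius \<open>norm x + 1\<close>, whose
  variation grows polynomially. This a priori bound starts the self-improvement.\<close>

lemma slowly_increasing_atoms_le:
  assumes "slowly_increasing \<mu>"
  obtains B N where "0 \<le> B" "\<And>x. cmod (\<mu> {x}) \<le> B * (1 + norm x) ^ N"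
proof -
  obtain C N where C: "0 \<le> C" and growth: "\<And>R. 0 \<le> R \<Longrightarrow> variation \<mu> {x. norm x < R} \<le> ennreal (C * (1 + R) ^ N)"
    using slowly_increasing_growth[OF assms] by blast
  interpret locally_finite_complex_measure \<mu> by standard (use assms in \<open>simp add: slowly_increasing_def\<close>)
  have "cmod (\<mu> {x}) \<le> (C * 2 ^ N) * (1 + norm x) ^ N" for x
  proof -
    have "ennreal (cmod (\<mu> {x})) \<le> variation \<mu> {y. norm y < norm x + 1}"
      by (intro norm_le_variation bounded_borelD[OF open_ball_bounded_borel]) auto
    also have "\<dots> \<le> ennreal (C * (1 + (norm x + 1)) ^ N)" by (intro growth) auto
    also have "\<dots> \<le> ennreal (C * (2 * (1 + norm x)) ^ N)"
      using C by (intro ennreal_leI mult_left_mono power_mono) auto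
    finally have "cmod (\<mu> {x}) \<le> C * (2 * (1 + norm x)) ^ N" using C by (subst (asm) ennreal_le_iff) auto
    thus ?thesis by (simp only: power_mult_distrib mult.assoc)
  qed
  thus ?thesis using C by (intro that[of "C * 2 ^ N" N]) auto
qed

text \<open>Testing with translates of a narrow Gaussian isolates one mass; the pairing with \<open>\<nu>\<close> is
  bounded uniformly in the translation because it only modulates the test function.\<close>

lemma point_masses_bounded:
  fixes \<mu> \<nu> :: "(real ^ 'n) set \<Rightarrow> complex"
  assumes ft: "has_fourier_transform \<mu> \<nu>" and sp: "sum_of_point_masses \<Lambda> \<mu>"
    and \<delta>: "0 < \<delta>" and sep: "separated \<delta> \<Lambda>"
  shows "\<exists>C. \<forall>x\<in>\<Lambda>. cmod (\<mu> {x}) \<le> C"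
proof -
  let ?n = "DIM(real ^ 'n)"
  have \<Lambda>: "countable \<Lambda>" using separated_imp_countable[OF \<delta> sep] .
  have si: "slowly_increasing \<mu>" using ft by (simp add: has_fourier_transform_def)
  obtain B N where B: "0 \<le> B" "\<And>x. cmod (\<mu> {x}) \<le> B * (1 + norm x) ^ N"
    using slowly_increasing_atoms_le[OF si] by blast
  \<comment> \<open>Of the decay order, \<open>N\<close> pays for the a priori growth of the masses
    and \<open>?n + 2\<close> for summability over a separated set.\<close>
  let ?K = "N + (?n + 2)"
  let ?F = "fourier (gaussian 1) :: real ^ 'n \<Rightarrow> complex"
  have F0: "0 < cmod (?F 0)" using fourier_gaussian_0 by auto
  obtain D where D: "0 \<le> D" "\<And>t. cmod (?F t) \<le> D / (1 + norm t) ^ ?K"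
    using rapidly_decreasingE[OF rapidly_decreasing_fourier[OF schwartz_gaussian[of 1]]] by (metis zero_less_one)
  \<comment> \<open>The quotient \<open>d / (1 + d)\<close> increases with \<open>d\<close>, so its
    value at \<open>\<delta>\<close> compares \<open>d\<close> with \<open>1 + d\<close> for all
    distances that occur between distinct points.\<close>
  define m where "m = \<delta> / (1 + \<delta>)"
  have m: "0 < m" using \<delta> by (simp add: m_def)
  have md: "m * (1 + d) \<le> d" if "\<delta> \<le> d" for d
    using \<delta> that by (simp add: m_def field_simps)
  define S where "S = separation_const ?n \<delta> * shell_const ?n"
  have S0: "0 \<le> S" unfolding S_def by (intro mult_nonneg_nonneg separation_const_nonneg shell_const_nonneg \<delta>)
  \<comment> \<open>Collects what the off-centre estimate leaves after division by the central value
    \<open>cmod (?F 0)\<close>; the power of \<open>m\<close> turns \<open>norm (y - x)\<close> into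
    \<open>1 + norm (y - x)\<close>.\<close>
  define E where "E = D / (cmod (?F 0) * m ^ ?K)"
  have E0: "0 \<le> E" using D F0 m by (simp add: E_def)
  \<comment> \<open>Large enough that \<open>\<epsilon> * S = E * S / a ^ ?K\<close> is at most 1/2;
    by \<open>a \<le> a ^ ?K\<close> it suffices that \<open>2 * E * S \<le> a\<close>.\<close>
  define a where "a = 1 + 2 * E * S"
  have a1: "1 \<le> a" using E0 S0 by (simp add: a_def)
  have aK: "a \<le> a ^ ?K" using a1 by (intro self_le_power) auto
  define \<epsilon> where "\<epsilon> = E / a ^ ?K"
  have \<epsilon>0: "0 \<le> \<epsilon>" using E0 a1 by (simp add: \<epsilon>_def)
  have \<epsilon>S: "\<epsilon> * S \<le> 1 / 2"
  proof -
    have "2 * E * S \<le> a ^ ?K" using aK by (simp add: a_def)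
    thus ?thesis using a1 by (simp add: \<epsilon>_def divide_le_eq)
  qed
  let ?\<psi> = "gaussian (1 / a ^ 2) :: real ^ 'n \<Rightarrow> complex"
  have \<psi>: "schwartz ?\<psi>" using a1 by (intro schwartz_gaussian) auto
  define A where "A = (\<Sum>k<4. \<integral>x. cmod (?\<psi> x) \<partial>jordan_part k \<nu>)"
  have A0: "0 \<le> A" unfolding A_def by (intro sum_nonneg integral_nonneg) auto
  \<comment> \<open>The bound \<open>A\<close> on all modulated pairings, divided by the value at 0
    of the transform of \<open>?\<psi>\<close>.\<close>
  define C where "C = A / (a ^ CARD('n) * cmod (?F 0))"
  have C0: "0 \<le> C" using A0 a1 by (simp add: C_def)
  have F\<psi>: "fourier ?\<psi> t = of_real (a ^ CARD('n)) * ?F (a *\<^sub>R t)" for t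
    using a1 by (intro fourier_gaussian_scale) auto
  \<comment> \<open>At the translation \<open>x\<close> the term \<open>y = x\<close> carries the
    mass in question; all other points are at distance at least \<open>\<delta>\<close>, in the tail
    of the transform.\<close>
  have self: "cmod (\<mu> {x}) \<le> C + \<epsilon> * (\<Sum>\<^sub>ay\<in>\<Lambda> - {x}. cmod (\<mu> {y}) / (1 + norm (y - x)) ^ ?K)"
    if x: "x \<in> \<Lambda>" for x
  proof -
    let ?c = "a ^ CARD('n) * cmod (?F 0)"
    let ?R = "\<lambda>y. \<mu> {y} * fourier ?\<psi> (y - x)"
    have c0: "0 < ?c" using a1 F0 by simp
    note * = fourier_pairing_modulate[OF ft sp \<Lambda> \<psi>, of x]
    have smR: "?R abs_summable_on \<Lambda> - {x}" by (rule abs_summable_on_subset[OF *(1)]) auto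
    have "pairing \<nu> (\<lambda>z. character x z * ?\<psi> z) = (\<Sum>\<^sub>ay\<in>{x} \<union> (\<Lambda> - {x}). ?R y)"
      using x unfolding *(2) by (intro arg_cong[where f="infsetsum _"]) auto
    also have "\<dots> = (\<Sum>\<^sub>ay\<in>{x}. ?R y) + (\<Sum>\<^sub>ay\<in>\<Lambda> - {x}. ?R y)"
      by (rule infsetsum_Un_disjoint[OF _ smR]) simp_all
    also have "(\<Sum>\<^sub>ay\<in>{x}. ?R y) = ?R x" by simp
    finally have split: "pairing \<nu> (\<lambda>z. character x z * ?\<psi> z) = ?R x + (\<Sum>\<^sub>ay\<in>\<Lambda> - {x}. ?R y)" .
    have "cmod (?R x) \<le> cmod (pairing \<nu> (\<lambda>z. character x z * ?\<psi> z)) + cmod (\<Sum>\<^sub>ay\<in>\<Lambda> - {x}. ?R y)"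
      unfolding split by (rule norm_diff_ineq[unfolded le_diff_eq diff_le_eq])
    also have "cmod (?R x) = ?c * cmod (\<mu> {x})" using a1 by (simp add: F\<psi> norm_mult norm_power)
    also have "cmod (pairing \<nu> (\<lambda>z. character x z * ?\<psi> z)) \<le> A"
      unfolding A_def by (rule norm_pairing_modulate_le)
    also have "cmod (\<Sum>\<^sub>ay\<in>\<Lambda> - {x}. ?R y) \<le> ?c * (\<epsilon> * (\<Sum>\<^sub>ay\<in>\<Lambda> - {x}. cmod (\<mu> {y}) / (1 + norm (y - x)) ^ ?K))"
    proof -
      let ?w = "\<lambda>y. cmod (\<mu> {y}) / (1 + norm (y - x)) ^ ?K"
      have le: "cmod (?R y) \<le> ?c * \<epsilon> * ?w y" if y: "y \<in> \<Lambda> - {x}" for y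
      proof -
        let ?d = "norm (y - x)"
        have "\<not> dist y x < \<delta>" using sep x y by blast
        hence d: "\<delta> \<le> ?d" by (simp add: dist_norm)
        have "a * (m * (1 + ?d)) \<le> a * ?d" using md[OF d] a1 by (intro mult_left_mono) auto
        also have "\<dots> \<le> 1 + norm (a *\<^sub>R (y - x))" using a1 by simp
        finally have le: "(a * (m * (1 + ?d))) ^ ?K \<le> (1 + norm (a *\<^sub>R (y - x))) ^ ?K"
          using a1 m by (intro power_mono) auto
        have pos: "0 < (a * (m * (1 + ?d))) ^ ?K"
          using a1 m by (intro zero_less_power mult_pos_pos) (auto intro: add_pos_nonneg)
        have "cmod (?F (a *\<^sub>R (y - x))) \<le> D / (1 + norm (a *\<^sub>R (y - x))) ^ ?K" by (rule D(2))
        also have "\<dots> \<le> D / (a * (m * (1 + ?d))) ^ ?K"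
          using D(1) le pos by (intro divide_left_mono mult_pos_pos) auto
        also have "\<dots> = cmod (?F 0) * \<epsilon> / (1 + ?d) ^ ?K"
        proof -
          have gen: "D / (A * (Q * U)) = F * (D / (F * Q) / A) / U" if "F \<noteq> 0" for A Q U F :: real
            using that by simp
          thus ?thesis unfolding \<epsilon>_def E_def power_mult_distrib using F0 by (intro gen) simp
        qed
        finally have "cmod (?F (a *\<^sub>R (y - x))) \<le> cmod (?F 0) * \<epsilon> / (1 + ?d) ^ ?K" .
        hence "cmod (\<mu> {y}) * a ^ CARD('n) * cmod (?F (a *\<^sub>R (y - x))) \<le> cmod (\<mu> {y}) * a ^ CARD('n) * (cmod (?F 0) * \<epsilon> / (1 + ?d) ^ ?K)"
          using a1 by (intro mult_left_mono) auto
        moreover have "cmod (?R y) = cmod (\<mu> {y}) * a ^ CARD('n) * cmod (?F (a *\<^sub>R (y - x)))"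
          using a1 by (simp add: F\<psi> norm_mult norm_power)
        ultimately show ?thesis by (simp add: mult_ac)
      qed
      \<comment> \<open>Convergence rests on the a priori growth, which \<open>?K\<close> was chosen
        to outweigh.\<close>
      have sw: "?w abs_summable_on \<Lambda> - {x}"
      proof (rule abs_summable_on_comparison_test'[OF abs_summable_on_cmult_right[OF separated_translate_abs_summable(1)[of \<delta> "\<Lambda> - {x}" x]]])
        fix y assume y: "y \<in> \<Lambda> - {x}"
        have "cmod (\<mu> {y}) \<le> B * (1 + norm x) ^ N * (1 + norm (y - x)) ^ N"
          using B(2) mult_power_one_plus_norm_le[OF B(1)] by (rule order_trans)
        from divide_power_le[OF this] have "?w y \<le> (B * (1 + norm x) ^ N) * (1 / (1 + norm (y - x)) ^ (?n + 2))" .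
        moreover have "norm (?w y) = ?w y" by simp
        ultimately show "norm (?w y) \<le> (B * (1 + norm x) ^ N) * (1 / (1 + norm (y - x)) ^ (?n + 2))" by (simp only:)
      qed (use \<delta> sep in auto)
      have "cmod (\<Sum>\<^sub>ay\<in>\<Lambda> - {x}. ?R y) \<le> (\<Sum>\<^sub>ay\<in>\<Lambda> - {x}. cmod (?R y))" by (rule norm_infsetsum_bound)
      also have "\<dots> \<le> (\<Sum>\<^sub>ay\<in>\<Lambda> - {x}. ?c * \<epsilon> * ?w y)"
        by (intro infsetsum_mono le abs_summable_on_normI smR abs_summable_on_cmult_right sw)
      also have "\<dots> = ?c * (\<epsilon> * (\<Sum>\<^sub>ay\<in>\<Lambda> - {x}. ?w y))"
        unfolding mult.assoc[symmetric] by (intro infsetsum_cmult_right sw)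
      finally show ?thesis .
    qed
    finally have "?c * cmod (\<mu> {x}) \<le> ?c * (C + \<epsilon> * (\<Sum>\<^sub>ay\<in>\<Lambda> - {x}. cmod (\<mu> {y}) / (1 + norm (y - x)) ^ ?K))"
      using c0 F0 a1 by (simp add: C_def distrib_left)
    thus ?thesis using c0 by (rule mult_left_le_imp_le)
  qed
  have "cmod (\<mu> {x}) \<le> 2 * C" if "x \<in> \<Lambda>" for x
    by (rule self_improving_bound[OF \<delta> sep _ B(2) B(1) C0 \<epsilon>0 _ self that]) (use \<epsilon>S in \<open>auto simp: S_def\<close>)
  thus ?thesis by blast
qed

section \<open>Wiener's lemma and the choice of frequencies\<close>

text \<open>Diagonal argument: from index \<open>Suc k\<close> on, the diagonal sequence is a
  subsequence of one along which the \<open>k\<close>-th coordinate converges.\<close>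

lemma common_convergent_subsequence:
  fixes X :: "nat \<Rightarrow> nat \<Rightarrow> 'a::heine_borel"
  assumes bdd: "\<And>k. bounded (range (\<lambda>j. X j k))"
  obtains r where "strict_mono r" "\<And>k. convergent (\<lambda>j. X (r j) k)"
proof -
  interpret subseqs "\<lambda>k s. convergent (\<lambda>j. X (s j) k)"
  proof
    fix k and s :: "nat \<Rightarrow> nat" assume "strict_mono s"
    have "bounded (range (\<lambda>j. X (s j) k))" by (rule bounded_subset[OF bdd[of k]]) auto
    then obtain l r where "strict_mono r" "((\<lambda>j. X (s j) k) \<circ> r) \<longlonglongrightarrow> l"
      using bounded_imp_convergent_subsequence by blast
    thus "\<exists>r. strict_mono r \<and> convergent (\<lambda>j. X ((s \<circ> r) j) k)"
      by (auto simp: convergent_def o_def)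
  qed
  have "convergent (\<lambda>j. X (diagseq j) k)" for k
  proof -
    have "convergent (\<lambda>j. X ((diagseq \<circ> ((+) (Suc k))) j) k)"
    proof (rule diagseq_holds)
      fix k and s r :: "nat \<Rightarrow> nat"
      assume r: "strict_mono r" and "convergent (\<lambda>j. X (s j) k)"
      then obtain l where "(\<lambda>j. X (s j) k) \<longlonglongrightarrow> l" by (auto simp: convergent_def)
      from LIMSEQ_subseq_LIMSEQ[OF this r] show "convergent (\<lambda>j. X ((s \<circ> r) j) k)"
        by (auto simp: convergent_def o_def)
    qed
    hence "convergent (\<lambda>j. X (diagseq (j + Suc k)) k)" by (simp add: add.commute o_def)
    thus ?thesis by (subst (asm) convergent_ignore_initial_segment)
  qed
  thus ?thesis using subseq_diagseq that by blast
qed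

text \<open>Averages over a finite box of lattice frequencies in place of a cube of real ones, so
  that frequencies are summed and never integrated. It plays the part of the kernel in Wiener's
  lemma.\<close>

definition box_character_mean :: "real \<Rightarrow> nat \<Rightarrow> real ^ 'n \<Rightarrow> complex" where
  "box_character_mean h m z =
     (\<Sum>g\<in>PiE UNIV (\<lambda>_. {..<m}). character (\<chi> i. h * real (g i)) z) / of_nat (m ^ CARD('n))"

text \<open>Characters factor over the coordinates, and a sum of products over a box is the product
  of one-dimensional sums, here means of geometric progressions.\<close>

lemma box_character_mean_prod:
  fixes z :: "real ^ 'n"
  shows "box_character_mean h m z =
    (\<Prod>i\<in>UNIV. (\<Sum>k<m. exp (2 * of_real pi * \<i> * of_real (h * z $ i)) ^ k) / of_nat m)"
proof -
  let ?w = "\<lambda>i. exp (2 * of_real pi * \<i> * complex_of_real (h * z $ i))"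
  have ch: "character (\<chi> i. h * real (g i)) z = (\<Prod>i\<in>UNIV. ?w i ^ g i)" for g :: "'n \<Rightarrow> nat"
  proof -
    have "character (\<chi> i. h * real (g i)) z = exp (\<Sum>i\<in>UNIV. of_nat (g i) * (2 * of_real pi * \<i> * complex_of_real (h * z $ i)))"
      unfolding character_def inner_vec_def of_real_sum sum_distrib_left
      by (intro arg_cong[where f = exp] sum.cong refl) (simp add: mult_ac)
    also have "\<dots> = (\<Prod>i\<in>UNIV. exp (of_nat (g i) * (2 * of_real pi * \<i> * complex_of_real (h * z $ i))))"
      by (rule exp_sum) simp
    also have "\<dots> = (\<Prod>i\<in>UNIV. ?w i ^ g i)" by (intro prod.cong refl exp_of_nat_mult)
    finally show ?thesis .
  qed
  have "(\<Prod>i\<in>UNIV. (\<Sum>k<m. ?w i ^ k) / of_nat m) = (\<Prod>i\<in>UNIV. \<Sum>k<m. ?w i ^ k) / of_nat (m ^ CARD('n))"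
    by (simp add: prod_dividef)
  also have "(\<Prod>i\<in>UNIV. \<Sum>k<m. ?w i ^ k) = (\<Sum>g\<in>PiE UNIV (\<lambda>_. {..<m}). \<Prod>i\<in>UNIV. ?w i ^ g i)"
    by (rule prod_sum_PiE) auto
  finally show ?thesis unfolding box_character_mean_def ch ..
qed

lemma norm_power_mean_le: "cmod ((\<Sum>k<m. w ^ k) / of_nat m) \<le> 1" if "cmod w = 1"
proof -
  have "cmod (\<Sum>k<m. w ^ k) \<le> (\<Sum>k<m. cmod (w ^ k))" by (rule norm_sum)
  also have "\<dots> = real m" using that by (simp add: norm_power)
  finally show ?thesis by (cases "m = 0") (auto simp: norm_divide divide_le_eq)
qed

lemma norm_power_mean_le_inverse:
  assumes w: "cmod w = 1" "w \<noteq> 1"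
  shows "cmod ((\<Sum>k<m. w ^ k) / of_nat m) \<le> (2 / cmod (w - 1)) * (1 / real m)"
proof -
  have "cmod (w ^ m - 1) \<le> cmod (w ^ m) + cmod 1" by (rule norm_triangle_ineq4)
  also have "\<dots> = 2" by (simp add: norm_power w)
  finally have "cmod (w ^ m - 1) / cmod (w - 1) / real m \<le> 2 / cmod (w - 1) / real m"
    by (intro divide_right_mono) auto
  moreover have "(\<Sum>k<m. w ^ k) = (w ^ m - 1) / (w - 1)" by (rule geometric_sum[OF w(2)])
  ultimately show ?thesis by (simp add: norm_divide norm_mult)
qed

lemma norm_box_character_mean_le: "cmod (box_character_mean h m z) \<le> 1"
  unfolding box_character_mean_prod prod_norm[symmetric]
  by (intro prod_le_1) (auto intro!: norm_power_mean_le simp: norm_exp_eq_Re)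

text \<open>One coordinate with \<open>z $ i \<noteq> 0\<close> decides. Since
  \<open>h * z $ i\<close> is nonzero and less than 1 in modulus, it is no integer, the ratio of its
  geometric progression differs from 1 and its mean decays like \<open>1 / m\<close>; the other
  factors are at most 1.\<close>

lemma box_character_mean_tendsto:
  assumes z: "z \<noteq> 0" and h: "0 < h" and small: "\<And>i. \<bar>h * z $ i\<bar> < 1"
  shows "(\<lambda>m. box_character_mean h m z) \<longlonglongrightarrow> 0"
proof -
  let ?w = "\<lambda>i. exp (2 * of_real pi * \<i> * complex_of_real (h * z $ i))"
  obtain i where i: "z $ i \<noteq> 0" using z by (auto simp: vec_eq_iff)
  have w: "?w i \<noteq> 1"
  proof
    assume "?w i = 1"
    then obtain n :: int where "2 * pi * (h * z $ i) = of_int (2 * n) * pi" unfolding exp_eq_1 by auto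
    hence n: "h * z $ i = of_int n" by simp
    hence "\<bar>real_of_int n\<bar> < 1" using small[of i] by simp
    hence "n = 0" by simp
    thus False using n i h by simp
  qed
  have nw: "cmod (?w j) = 1" for j by (simp add: norm_exp_eq_Re)
  have le: "cmod (box_character_mean h m z) \<le> (2 / cmod (?w i - 1)) * (1 / real m)" for m
  proof -
    let ?t = "\<lambda>j. cmod ((\<Sum>k<m. ?w j ^ k) / of_nat m)"
    have "cmod (box_character_mean h m z) = ?t i * (\<Prod>j\<in>UNIV - {i}. ?t j)"
      unfolding box_character_mean_prod prod_norm[symmetric] by (rule prod.remove) auto
    also have "\<dots> \<le> ?t i * 1"
      by (intro mult_left_mono prod_le_1 conjI norm_power_mean_le nw) auto
    also have "\<dots> \<le> (2 / cmod (?w i - 1)) * (1 / real m)"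
      unfolding mult_1_right by (rule norm_power_mean_le_inverse[OF nw w])
    finally show ?thesis .
  qed
  have "(\<lambda>m. (2 / cmod (?w i - 1)) * (1 / real m)) \<longlonglongrightarrow> (2 / cmod (?w i - 1)) * 0"
    by (intro tendsto_intros lim_1_over_n)
  hence "(\<lambda>m. (2 / cmod (?w i - 1)) * (1 / real m)) \<longlonglongrightarrow> 0" by simp
  thus ?thesis by (rule Lim_null_comparison[rotated]) (use le in auto)
qed

text \<open>The inverse Fourier transform of the complex measure with density \<open>f\<close> with
  respect to \<open>M\<close>.\<close>

definition frequency_integral :: "(real ^ 'n) measure \<Rightarrow> (real ^ 'n \<Rightarrow> complex) \<Rightarrow> real ^ 'n \<Rightarrow> complex" where
  "frequency_integral M f \<tau> = (\<integral>x. character \<tau> x * f x \<partial>M)"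

text \<open>Bundles the hypotheses of Wiener's lemma. The radius is part of it because it decides
  how fine the lattice of frequencies has to be.\<close>

definition locally_integrable_atomless :: "(real ^ 'n) measure \<Rightarrow> (real ^ 'n \<Rightarrow> complex) \<Rightarrow> real \<Rightarrow> bool" where
  "locally_integrable_atomless M f R \<longleftrightarrow> sets M = sets borel \<and> (\<forall>x. emeasure M {x} = 0) \<and>
     integrable M f \<and> (\<forall>x. f x \<noteq> 0 \<longrightarrow> norm x < R)"

text \<open>Wiener's lemma; the frequencies run over a lattice so fine that its characters separate the points
  of the support.\<close>

lemma wiener_mean_tendsto:
  fixes M :: "(real ^ 'n) measure" and f :: "real ^ 'n \<Rightarrow> complex"
  assumes la: "locally_integrable_atomless M f R" and h: "0 < h" "h * (2 * R) \<le> 1"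
  shows "(\<lambda>m. (\<Sum>g\<in>PiE (UNIV :: 'n set) (\<lambda>_. {..<m}). cmod (frequency_integral M f (\<chi> i. h * real (g i))) ^ 2) / real (m ^ CARD('n))) \<longlonglongrightarrow> 0"
proof -
  from la have sets: "sets M = sets borel" and at: "\<And>x. emeasure M {x} = 0"
    and f: "integrable M f" and supp: "\<And>x. f x \<noteq> 0 \<Longrightarrow> norm x < R"
    by (auto simp: locally_integrable_atomless_def)
  have fm [measurable]: "f \<in> borel_measurable M" using f by auto
  have cm [measurable]: "character t \<in> borel_measurable M" for t
    using character_measurable by (simp add: measurable_cong_sets[OF sets refl])
  have [measurable]: "(\<lambda>y. cnj (f y)) \<in> borel_measurable M"
    using fm by (intro measurable_compose[OF _ borel_measurable_continuous_onI[OF continuous_on_cnj[OF continuous_on_id]]])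
  have mean [measurable]: "(\<lambda>y. box_character_mean h m (x - y)) \<in> borel_measurable M" for m x
  proof -
    have "continuous_on UNIV (\<lambda>y. box_character_mean h m (x - y))"
      unfolding box_character_mean_def character_def divide_inverse by (intro continuous_intros)
    hence "(\<lambda>y. box_character_mean h m (x - y)) \<in> borel_measurable borel" by (rule borel_measurable_continuous_onI)
    thus ?thesis by (simp cong: measurable_cong_sets add: measurable_cong_sets[OF sets refl])
  qed
  define T where "T = frequency_integral M f"
  let ?t = "\<lambda>g :: 'n \<Rightarrow> nat. (\<chi> i. h * real (g i)) :: real ^ 'n"
  let ?G = "\<lambda>m. PiE (UNIV :: 'n set) (\<lambda>_. {..<m::nat})"
  have fin: "finite (?G m)" for m by (intro finite_PiE) auto
  note intc = integrable_character_mult[OF sets f]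
  \<comment> \<open>The mean square is a double integral of \<open>f x * cnj (f y)\<close> against
    the kernel at \<open>x - y\<close>; \<open>J\<close> is the inner integral over
    \<open>y\<close>, first written as a finite sum.\<close>
  define J where "J m x = (\<Sum>g\<in>?G m. character (?t g) x * cnj (T (?t g))) / of_nat (m ^ CARD('n))" for m x
  have mean_eq: "of_real ((\<Sum>g\<in>?G m. cmod (T (?t g)) ^ 2) / real (m ^ CARD('n))) = (\<integral>x. f x * J m x \<partial>M)" for m
  proof -
    have "(\<integral>x. f x * J m x \<partial>M) = (\<integral>x. (\<Sum>g\<in>?G m. (character (?t g) x * f x) * cnj (T (?t g))) / of_nat (m ^ CARD('n)) \<partial>M)"
      unfolding J_def by (intro Bochner_Integration.integral_cong refl) (simp add: sum_distrib_left mult_ac)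
    also have "\<dots> = (\<Sum>g\<in>?G m. T (?t g) * cnj (T (?t g))) / of_nat (m ^ CARD('n))"
      by (simp only: integral_divide_zero) 
         (subst Bochner_Integration.integral_sum, auto intro!: integrable_mult_left intc simp: T_def frequency_integral_def)
    finally show ?thesis by (simp add: complex_norm_square[symmetric])
  qed
  have J_eq: "J m x = (\<integral>y. cnj (f y) * box_character_mean h m (x - y) \<partial>M)" for m x
  proof -
    have "(\<integral>y. cnj (f y) * box_character_mean h m (x - y) \<partial>M) =
        (\<integral>y. (\<Sum>g\<in>?G m. character (?t g) x * cnj (character (?t g) y * f y)) / of_nat (m ^ CARD('n)) \<partial>M)"
      unfolding box_character_mean_def
    proof (intro Bochner_Integration.integral_cong refl)
      fix y
      have "character s (x - y) = character s x * cnj (character s y)" for s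
        using character_add_right[of s x "- y"] by (simp add: character_minus_right)
      thus "cnj (f y) * ((\<Sum>g\<in>?G m. character (?t g) (x - y)) / of_nat (m ^ CARD('n))) =
        (\<Sum>g\<in>?G m. character (?t g) x * cnj (character (?t g) y * f y)) / of_nat (m ^ CARD('n))"
        by (simp add: sum_distrib_left mult_ac)
    qed
    also have "\<dots> = (\<Sum>g\<in>?G m. character (?t g) x * cnj (T (?t g))) / of_nat (m ^ CARD('n))"
      by (simp only: integral_divide_zero)
         (subst Bochner_Integration.integral_sum, auto intro!: integrable_mult_right integrable_cnj intc
           simp: T_def frequency_integral_def simp del: complex_cnj_mult)
    finally show ?thesis by (simp add: J_def)
  qed
  have J_lim: "(\<lambda>m. J m x) \<longlonglongrightarrow> 0" if x: "norm x < R" for x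
  proof -
    have "(\<lambda>m. \<integral>y. cnj (f y) * box_character_mean h m (x - y) \<partial>M) \<longlonglongrightarrow> (\<integral>y. 0 \<partial>M)"
    proof (rule integral_dominated_convergence[where w = "\<lambda>y. cmod (f y)"])
      show "(\<lambda>y. cnj (f y) * box_character_mean h m (x - y)) \<in> borel_measurable M" for m
        by (intro borel_measurable_times mean) measurable
      \<comment> \<open>The kernel fails to tend to 0 only on the diagonal, and there the absence of
        atoms enters.\<close>
      have "AE y in M. y \<noteq> x"
        using at[of x] by (intro AE_I[of _ _ "{x}"]) (auto simp: sets)
      thus "AE y in M. (\<lambda>m. cnj (f y) * box_character_mean h m (x - y)) \<longlonglongrightarrow> 0"
      proof eventually_elim
        case (elim y)
        show ?case
        proof (cases "f y = 0")
          case False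
          hence y: "norm y < R" by (rule supp)
          \<comment> \<open>Two points of the support differ by less than \<open>2 * R\<close> in
            each coordinate, so \<open>h * (2 * R) \<le> 1\<close> keeps the scaled difference
            within the range where the kernel is known to decay.\<close>
          have "(\<lambda>m. box_character_mean h m (x - y)) \<longlonglongrightarrow> 0"
          proof (rule box_character_mean_tendsto[OF _ h(1)])
            fix i
            have "\<bar>(x - y) $ i\<bar> \<le> norm (x - y)" by (rule component_le_norm_cart)
            also have "\<dots> \<le> norm x + norm y" by (rule norm_triangle_ineq4)
            also have "\<dots> < 2 * R" using x y by simp
            finally have "h * \<bar>(x - y) $ i\<bar> < h * (2 * R)" using h(1) by (rule mult_strict_left_mono)
            hence "h * \<bar>(x - y) $ i\<bar> < 1" using h(2) by (rule order_less_le_trans)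
            thus "\<bar>h * (x - y) $ i\<bar> < 1" by (simp only: abs_mult abs_of_pos[OF h(1)])
          qed (use elim in auto)
          from tendsto_mult_left[OF this, of "cnj (f y)"] show ?thesis by simp
        qed simp
      qed
      show "AE y in M. norm (cnj (f y) * box_character_mean h m (x - y)) \<le> cmod (f y)" for m
        by (intro AE_I2) (simp add: norm_mult mult_left_le norm_box_character_mean_le)
    qed (use f in auto)
    thus ?thesis by (simp add: J_eq)
  qed
  define A where "A = (\<integral>y. cmod (f y) \<partial>M)"
  have J_bound: "cmod (J m x) \<le> A" for m x
    unfolding J_eq A_def
  proof (rule order_trans[OF integral_norm_bound])
    show "(\<integral>y. norm (cnj (f y) * box_character_mean h m (x - y)) \<partial>M) \<le> (\<integral>y. cmod (f y) \<partial>M)"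
    proof (rule integral_mono)
      have "(\<lambda>y. cnj (f y) * box_character_mean h m (x - y)) \<in> borel_measurable M"
        by (intro borel_measurable_times mean) measurable
      thus "integrable M (\<lambda>y. norm (cnj (f y) * box_character_mean h m (x - y)))"
        by (intro integrable_norm Bochner_Integration.integrable_bound[OF f])
           (auto simp: norm_mult mult_left_le norm_box_character_mean_le)
    qed (use f in \<open>auto simp: norm_mult mult_left_le norm_box_character_mean_le\<close>)
  qed
  have "(\<lambda>m. \<integral>x. f x * J m x \<partial>M) \<longlonglongrightarrow> (\<integral>x. 0 \<partial>M)"
  proof (rule integral_dominated_convergence[where w = "\<lambda>x. cmod (f x) * A"])
    show "(\<lambda>x. f x * J m x) \<in> borel_measurable M" for m unfolding J_def by measurable
    show "AE x in M. (\<lambda>m. f x * J m x) \<longlonglongrightarrow> 0"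
    proof (rule AE_I2)
      fix x show "(\<lambda>m. f x * J m x) \<longlonglongrightarrow> 0"
        using tendsto_mult_left[OF J_lim[OF supp], of x "f x"] by (cases "f x = 0") auto
    qed
    show "AE x in M. norm (f x * J m x) \<le> cmod (f x) * A" for m
      by (intro AE_I2) (simp add: norm_mult mult_left_mono J_bound)
  qed (use f in auto)
  hence "(\<lambda>m. complex_of_real ((\<Sum>g\<in>?G m. cmod (T (?t g)) ^ 2) / real (m ^ CARD('n)))) \<longlonglongrightarrow> of_real 0"
    unfolding mean_eq by simp
  thus ?thesis unfolding tendsto_of_real_iff T_def .
qed

text \<open>The sum over \<open>L\<close> of the mean squares tends to 0. If the sum of squares were
  at least \<open>\<epsilon> ^ 2\<close> at every frequency of a box, so would be its mean.\<close>

lemma exists_small_frequency_integrals: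
  fixes M :: "'l \<Rightarrow> (real ^ 'n) measure"
  assumes L: "finite L" and la: "\<And>l. l \<in> L \<Longrightarrow> locally_integrable_atomless (M l) (f l) R"
    and R: "0 < R" and \<epsilon>: "0 < \<epsilon>"
  shows "\<exists>\<tau>. \<forall>l\<in>L. cmod (frequency_integral (M l) (f l) \<tau>) < \<epsilon>"
proof -
  \<comment> \<open>The coarsest spacing that Wiener's lemma admits for supports of radius
    \<open>R\<close>.\<close>
  define h where "h = 1 / (2 * R)"
  have h: "0 < h" "h * (2 * R) \<le> 1" using R by (auto simp: h_def)
  let ?t = "\<lambda>g :: 'n \<Rightarrow> nat. (\<chi> i. h * real (g i)) :: real ^ 'n"
  let ?G = "\<lambda>m. PiE (UNIV :: 'n set) (\<lambda>_. {..<m::nat})"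
  let ?T = "\<lambda>l g. cmod (frequency_integral (M l) (f l) (?t g)) ^ 2"
  have "(\<lambda>m. \<Sum>l\<in>L. (\<Sum>g\<in>?G m. ?T l g) / real (m ^ CARD('n))) \<longlonglongrightarrow> (\<Sum>l\<in>L. 0)"
    by (intro tendsto_sum wiener_mean_tendsto[OF la h])
  hence "(\<lambda>m. \<Sum>l\<in>L. (\<Sum>g\<in>?G m. ?T l g) / real (m ^ CARD('n))) \<longlonglongrightarrow> 0" by simp
  hence "\<forall>\<^sub>F m in sequentially. (\<Sum>l\<in>L. (\<Sum>g\<in>?G m. ?T l g) / real (m ^ CARD('n))) < \<epsilon> ^ 2"
    using \<epsilon> by (intro order_tendstoD(2)) auto
  with eventually_gt_at_top[of 0] have "\<forall>\<^sub>F m in sequentially. 0 < m \<and> (\<Sum>l\<in>L. (\<Sum>g\<in>?G m. ?T l g) / real (m ^ CARD('n))) < \<epsilon> ^ 2"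
    by eventually_elim auto
  then obtain m where m: "0 < m" "(\<Sum>l\<in>L. (\<Sum>g\<in>?G m. ?T l g) / real (m ^ CARD('n))) < \<epsilon> ^ 2"
    using eventually_happens'[OF sequentially_bot] by blast
  have card: "card (?G m) = m ^ CARD('n)" by (simp add: card_PiE)
  have "\<exists>g\<in>?G m. (\<Sum>l\<in>L. ?T l g) < \<epsilon> ^ 2"
  proof (rule ccontr)
    assume "\<not> ?thesis"
    hence "(\<Sum>g\<in>?G m. \<epsilon> ^ 2) \<le> (\<Sum>g\<in>?G m. \<Sum>l\<in>L. ?T l g)" by (intro sum_mono) (auto simp: not_less)
    also have "\<dots> = (\<Sum>l\<in>L. \<Sum>g\<in>?G m. ?T l g)" by (rule sum.swap)
    finally have "real (m ^ CARD('n)) * \<epsilon> ^ 2 \<le> (\<Sum>l\<in>L. \<Sum>g\<in>?G m. ?T l g)" by (simp add: card)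
    moreover have "(\<Sum>l\<in>L. \<Sum>g\<in>?G m. ?T l g) < \<epsilon> ^ 2 * real (m ^ CARD('n))"
      using m by (simp only: sum_divide_distrib[symmetric]) (simp add: pos_divide_less_eq)
    ultimately show False by (simp add: mult.commute)
  qed
  then obtain g where g: "(\<Sum>l\<in>L. ?T l g) < \<epsilon> ^ 2" by blast
  have "cmod (frequency_integral (M l) (f l) (?t g)) < \<epsilon>" if l: "l \<in> L" for l
  proof -
    have "?T l g \<le> (\<Sum>l\<in>L. ?T l g)" using L l by (intro member_le_sum) auto
    with g have "?T l g < \<epsilon> ^ 2" by linarith
    thus ?thesis by (rule power_less_imp_less_base) (use \<epsilon> in simp)
  qed
  thus ?thesis by blast
qed

text \<open>A sequence with good differences is built greedily, and the differences of a subsequence on which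
  the finitely many characters converge are almost periods.\<close>

lemma exists_almost_period_small_frequency_integrals:
  fixes M :: "'l \<Rightarrow> (real ^ 'n) measure" and F :: "(real ^ 'n) set"
  assumes F: "finite F" and L: "finite L" and la: "\<And>l. l \<in> L \<Longrightarrow> locally_integrable_atomless (M l) (f l) R"
    and R: "0 < R" and \<epsilon>: "0 < \<epsilon>"
  shows "\<exists>\<tau>. (\<forall>s\<in>F. cmod (character \<tau> s - 1) < \<epsilon>) \<and> (\<forall>l\<in>L. cmod (frequency_integral (M l) (f l) \<tau>) < \<epsilon>)"
proof -
  define good where "good \<tau> \<longleftrightarrow> (\<forall>l\<in>L. cmod (frequency_integral (M l) (f l) \<tau>) < \<epsilon>)" for \<tau>
  \<comment> \<open>Smallness at \<open>\<tau> - p\<close> is smallness at \<open>\<tau>\<close> for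
    the function modulated by \<open>- p\<close>. Finitely many \<open>p\<close> thus merely enlarge
    the finite family, with the same supports.\<close>
  have ex: "\<exists>\<tau>. \<forall>p\<in>P. good (\<tau> - p)" if P: "finite P" for P
  proof -
    let ?f = "\<lambda>(l, p) x. character (- p) x * f l x"
    have "\<exists>\<tau>. \<forall>lp\<in>L \<times> P. cmod (frequency_integral (M (fst lp)) (?f lp) \<tau>) < \<epsilon>"
    proof (rule exists_small_frequency_integrals[OF _ _ R \<epsilon>])
      fix lp assume "lp \<in> L \<times> P"
      then obtain l p where lp: "lp = (l, p)" "l \<in> L" by auto
      have sets: "sets (M l) = sets borel" and f: "integrable (M l) (f l)"
        using la[OF lp(2)] by (auto simp: locally_integrable_atomless_def)
      from integrable_character_mult[OF this] show "locally_integrable_atomless (M (fst lp)) (?f lp) R"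
        using la[OF lp(2)] by (simp add: lp locally_integrable_atomless_def)
    qed (use L P in auto)
    then obtain \<tau> where \<tau>: "\<forall>lp\<in>L \<times> P. cmod (frequency_integral (M (fst lp)) (?f lp) \<tau>) < \<epsilon>" by blast
    have ch: "character \<tau> x * (character (- p) x * z) = character (\<tau> - p) x * z" for p x z
      using character_add[of \<tau> "- p" x] by simp
    hence fe: "frequency_integral (M l) (?f (l, p)) \<tau> = frequency_integral (M l) (f l) (\<tau> - p)" for l p
      unfolding frequency_integral_def by (simp only: prod.case ch)
    show ?thesis unfolding good_def
    proof (intro exI ballI)
      fix p l assume "p \<in> P" "l \<in> L"
      hence "(l, p) \<in> L \<times> P" by simp
      with \<tau> have "cmod (frequency_integral (M (fst (l, p))) (?f (l, p)) \<tau>) < \<epsilon>" by (rule bspec)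
      thus "cmod (frequency_integral (M l) (f l) (\<tau> - p)) < \<epsilon>" by (simp only: fe fst_conv)
    qed
  qed
  define pick where "pick P = (SOME \<tau>. \<forall>p\<in>P. good (\<tau> - p))" for P
  \<comment> \<open>\<open>S n\<close> lists the terms before position \<open>n\<close>: every
    choice has to respect all earlier ones.\<close>
  define S where "S = rec_nat [] (\<lambda>_ ts. pick (set ts) # ts)"
  define t where "t n = pick (set (S n))" for n
  have S: "S 0 = []" "S (Suc n) = t n # S n" for n by (simp_all add: S_def t_def)
  have mem: "t a \<in> set (S b)" if "a < b" for a b
    using that by (induction b) (auto simp: S less_Suc_eq)
  have good: "good (t b - t a)" if "a < b" for a b
    using someI_ex[OF ex[of "set (S b)"]] mem[OF that] unfolding t_def pick_def by blast
  \<comment> \<open>Character values lie on the unit circle. The enumeration of a finite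
    \<open>F\<close> repeats, and for empty \<open>F\<close> its values are arbitrary; both are
    harmless.\<close>
  have "bounded (range (\<lambda>j. character (t j) (from_nat_into F k)))" for k
    unfolding bounded_iff by (intro exI[of _ 1]) auto
  then obtain r where r: "strict_mono r" "\<And>k. convergent (\<lambda>j. character (t (r j)) (from_nat_into F k))"
    using common_convergent_subsequence[of "\<lambda>j k. character (t j) (from_nat_into F k)"] by blast
  have "\<exists>N. \<forall>a\<ge>N. \<forall>b\<ge>N. cmod (character (t (r a)) s - character (t (r b)) s) < \<epsilon>" if s: "s \<in> F" for s
  proof -
    obtain k where "from_nat_into F k = s"
      using from_nat_into_surj[OF countable_finite[OF F] s] by blast
    hence "Cauchy (\<lambda>j. character (t (r j)) s)" using r(2)[of k] convergent_Cauchy by auto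
    thus ?thesis using \<epsilon> unfolding Cauchy_def dist_norm by blast
  qed
  then obtain N where N: "\<And>s a b. s \<in> F \<Longrightarrow> a \<ge> N s \<Longrightarrow> b \<ge> N s \<Longrightarrow> cmod (character (t (r a)) s - character (t (r b)) s) < \<epsilon>"
    by metis
  \<comment> \<open>The sum is a common upper bound of the finitely many thresholds, also for empty
    \<open>F\<close>.\<close>
  define n where "n = (\<Sum>s\<in>F. N s)"
  have n: "N s \<le> n" if "s \<in> F" for s unfolding n_def using F that by (intro member_le_sum) auto
  define \<tau> where "\<tau> = t (r (Suc n)) - t (r n)"
  have "good \<tau>" unfolding \<tau>_def using r(1) by (intro good) (auto simp: strict_mono_def)
  moreover have "cmod (character \<tau> s - 1) < \<epsilon>" if s: "s \<in> F" for s
  proof -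
    have eq: "character (t (r (Suc n))) s = character \<tau> s * character (t (r n)) s"
      using character_add[of \<tau> "t (r n)" s] by (simp add: \<tau>_def)
    have "cmod (character (t (r (Suc n))) s - character (t (r n)) s) < \<epsilon>"
      using n[OF s] by (intro N s) auto
    also have "character (t (r (Suc n))) s - character (t (r n)) s = (character \<tau> s - 1) * character (t (r n)) s"
      by (simp add: eq algebra_simps)
    finally show ?thesis by (simp add: norm_mult)
  qed
  ultimately show ?thesis unfolding good_def by blast
qed

text \<open>At stage \<open>j\<close> the first \<open>j + 1\<close> points and integrals are
  handled with tolerance \<open>1 / (j + 1)\<close>, so each of the countably many demands is met
  from some stage on.\<close>

lemma exists_selecting_frequencies:
  fixes M :: "nat \<Rightarrow> (real ^ 'n) measure" and s :: "nat \<Rightarrow> real ^ 'n"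
  assumes la: "\<And>q. \<exists>R. locally_integrable_atomless (M q) (f q) R"
  shows "\<exists>\<tau>. (\<forall>i. (\<lambda>j. character (\<tau> j) (s i)) \<longlonglongrightarrow> 1) \<and>
    (\<forall>q. (\<lambda>j. frequency_integral (M q) (f q) (\<tau> j)) \<longlonglongrightarrow> 0)"
proof -
  obtain R where R: "\<And>q. locally_integrable_atomless (M q) (f q) (R q)" using la by metis
  have "\<exists>\<tau>. (\<forall>x\<in>s ` {..j}. cmod (character \<tau> x - 1) < 1 / real (Suc j)) \<and>
      (\<forall>q\<in>{..j}. cmod (frequency_integral (M q) (f q) \<tau>) < 1 / real (Suc j))" for j
  proof (rule exists_almost_period_small_frequency_integrals)
    \<comment> \<open>A common radius for the supports treated at stage \<open>j\<close>; the
      summand 1 makes it positive.\<close>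
    let ?R = "1 + (\<Sum>q\<le>j. \<bar>R q\<bar>)"
    show "0 < ?R" by (intro add_pos_nonneg sum_nonneg) auto
    fix q assume q: "q \<in> {..j}"
    have "\<bar>R q\<bar> \<le> (\<Sum>q\<le>j. \<bar>R q\<bar>)" using q by (intro member_le_sum) auto
    hence "R q \<le> ?R" by simp
    thus "locally_integrable_atomless (M q) (f q) ?R"
      using R[of q] unfolding locally_integrable_atomless_def by force
  qed auto
  hence "\<exists>\<tau>. \<forall>j. (\<forall>x\<in>s ` {..j}. cmod (character (\<tau> j) x - 1) < 1 / real (Suc j)) \<and>
      (\<forall>q\<in>{..j}. cmod (frequency_integral (M q) (f q) (\<tau> j)) < 1 / real (Suc j))"
    by (intro choice allI)
  then obtain \<tau> where \<tau>: "\<And>j. \<forall>x\<in>s ` {..j}. cmod (character (\<tau> j) x - 1) < 1 / real (Suc j)"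
      "\<And>j. \<forall>q\<in>{..j}. cmod (frequency_integral (M q) (f q) (\<tau> j)) < 1 / real (Suc j)"
    by blast
  have lim: "(\<lambda>j. 1 / real (Suc j)) \<longlonglongrightarrow> 0" using LIMSEQ_inverse_real_of_nat by (simp add: inverse_eq_divide)
  show ?thesis
  proof (intro exI[of _ \<tau>] conjI allI)
    fix i
    have "\<forall>\<^sub>F j in sequentially. norm (character (\<tau> j) (s i) - 1) \<le> 1 / real (Suc j)"
      using eventually_ge_at_top[of i] by eventually_elim (use \<tau>(1) in \<open>auto intro!: less_imp_le\<close>)
    from Lim_null_comparison[OF this lim] show "(\<lambda>j. character (\<tau> j) (s i)) \<longlonglongrightarrow> 1"
      by (rule LIM_zero_cancel)
  next
    fix q
    have "\<forall>\<^sub>F j in sequentially. norm (frequency_integral (M q) (f q) (\<tau> j)) \<le> 1 / real (Suc j)"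
      using eventually_ge_at_top[of q] by eventually_elim (use \<tau>(2) in \<open>auto intro!: less_imp_le\<close>)
    thus "(\<lambda>j. frequency_integral (M q) (f q) (\<tau> j)) \<longlonglongrightarrow> 0"
      by (rule Lim_null_comparison[OF _ lim])
  qed
qed

section \<open>Cells\<close>

text \<open>The floor makes the cubes half-open, so that they partition the space. They serve dyadic
  approximation with \<open>h = 1 / 2 ^ p\<close>, and the bookkeeping of moving points with
  \<open>h\<close> a fixed fraction of the separation.\<close>

definition cell_index :: "real \<Rightarrow> real ^ 'n \<Rightarrow> int ^ 'n" where
  "cell_index h x = (\<chi> i. \<lfloor>x $ i / h\<rfloor>)"

definition cell :: "real \<Rightarrow> int ^ 'n \<Rightarrow> (real ^ 'n) set" where
  "cell h k = {x. cell_index h x = k}"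

definition corner :: "real \<Rightarrow> int ^ 'n \<Rightarrow> real ^ 'n" where
  "corner h k = (\<chi> i. h * of_int (k $ i))"

lemma mem_cell_iff:
  assumes h: "0 < h"
  shows "x \<in> cell h k \<longleftrightarrow> (\<forall>i. h * of_int (k $ i) \<le> x $ i \<and> x $ i < h * of_int (k $ i) + h)"
proof -
  have "\<lfloor>x $ i / h\<rfloor> = k $ i \<longleftrightarrow> h * of_int (k $ i) \<le> x $ i \<and> x $ i < h * of_int (k $ i) + h" for i
    using h by (simp add: floor_eq_iff pos_le_divide_eq pos_divide_less_eq algebra_simps)
  thus ?thesis by (simp add: cell_def cell_index_def vec_eq_iff)
qed

lemma corner_mem_cell: "0 < h \<Longrightarrow> corner h k \<in> cell h k"
  by (simp add: mem_cell_iff corner_def)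

text \<open>Strictness comes from the half-open cubes, and it matters when
  \<open>real CARD('n) * h\<close> equals the separation of a point set.\<close>

lemma dist_cell_less:
  fixes x y :: "real ^ 'n"
  assumes h: "0 < h" and x: "x \<in> cell h k" and y: "y \<in> cell h k"
  shows "dist x y < real CARD('n) * h"
proof -
  have "dist x y \<le> (\<Sum>i\<in>UNIV. \<bar>(x - y) $ i\<bar>)" unfolding dist_norm by (rule norm_le_l1_cart)
  also have "\<dots> < (\<Sum>i\<in>(UNIV :: 'n set). h)"
  proof (rule sum_strict_mono)
    fix i :: 'n
    show "\<bar>(x - y) $ i\<bar> < h"
      using x[unfolded mem_cell_iff[OF h], rule_format, of i] y[unfolded mem_cell_iff[OF h], rule_format, of i] by (auto simp: abs_less_iff)
  qed auto
  finally show ?thesis by simp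
qed

lemma cell_bounded_borel:
  assumes h: "0 < h"
  shows "cell h k \<in> bounded_borel"
proof -
  have "cell h k = (\<Inter>i. {x. h * of_int (k $ i) \<le> x $ i \<and> x $ i < h * of_int (k $ i) + h})"
    using mem_cell_iff[OF h, of _ k] by auto
  moreover have "(\<Inter>i. {x :: real ^ 'a. h * of_int (k $ i) \<le> x $ i \<and> x $ i < h * of_int (k $ i) + h}) \<in> sets borel"
    by measurable
  ultimately have "cell h k \<in> sets borel" by simp
  moreover have "bounded (cell h k)"
    unfolding bounded_any_center[of "cell h k" "corner h k"]
    using dist_cell_less[OF h corner_mem_cell[OF h]] less_imp_le by blast
  ultimately show ?thesis by (simp add: bounded_borel_def)
qed

lemma one_plus_norm_cell_le:
  fixes x y :: "real ^ 'n"
  assumes h: "0 < h" and x: "x \<in> cell h k" and y: "y \<in> cell h k"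
  shows "1 + norm x \<le> (1 + real CARD('n) * h) * (1 + norm y)"
proof -
  have "norm (x - y) \<le> real CARD('n) * h" using dist_cell_less[OF h x y] by (simp add: dist_norm)
  hence "(1 + norm y) * (1 + norm (x - y)) \<le> (1 + norm y) * (1 + real CARD('n) * h)" by (intro mult_left_mono) auto
  thus ?thesis using one_plus_norm_le[of x y] by (simp add: mult.commute)
qed

text \<open>Carries decay from one point of a cell to another, which yields dominating functions
  that depend on the cell alone.\<close>

lemma inverse_power_norm_cell_le:
  fixes x y :: "real ^ 'n"
  assumes h: "0 < h" and x: "x \<in> cell h k" and y: "y \<in> cell h k" and D: "0 \<le> D"
  shows "D / (1 + norm y) ^ K \<le> D * (1 + real CARD('n) * h) ^ K * (1 / (1 + norm x) ^ K)"
proof -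
  have "(1 + norm x) ^ K \<le> ((1 + real CARD('n) * h) * (1 + norm y)) ^ K"
    by (intro power_mono one_plus_norm_cell_le[OF h x y]) auto
  hence "(1 + norm x) ^ K \<le> (1 + real CARD('n) * h) ^ K * (1 + norm y) ^ K" by (simp only: power_mult_distrib)
  moreover have "0 < (1 + norm x) ^ K" "0 < (1 + norm y) ^ K" by (simp_all add: add_pos_nonneg)
  ultimately have "1 / (1 + norm y) ^ K \<le> (1 + real CARD('n) * h) ^ K * (1 / (1 + norm x) ^ K)"
    by (simp add: divide_simps mult_ac)
  from mult_left_mono[OF this D] show ?thesis by (simp add: mult_ac)
qed

lemma corner_separated:
  fixes k l :: "int ^ 'n"
  assumes h: "0 < h" and "dist (corner h k) (corner h l) < h"
  shows "k = l"
proof (rule ccontr)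
  assume "k \<noteq> l"
  then obtain i where "k $ i \<noteq> l $ i" by (auto simp: vec_eq_iff)
  hence "1 \<le> \<bar>real_of_int (k $ i) - of_int (l $ i)\<bar>" by linarith
  hence "h * 1 \<le> h * \<bar>real_of_int (k $ i) - of_int (l $ i)\<bar>" using h by (intro mult_left_mono) auto
  also have "\<dots> = \<bar>(corner h k - corner h l) $ i\<bar>" using h by (simp add: corner_def abs_mult flip: right_diff_distrib)
  also have "\<dots> \<le> norm (corner h k - corner h l)" by (rule component_le_norm_cart)
  finally show False using assms(2) by (simp add: dist_norm)
qed

text \<open>The corners are distinct and \<open>h\<close>-separated, so the sum over cells is a sum
  over a separated set.\<close>

lemma corner_abs_summable:
  assumes h: "0 < h"
  shows "(\<lambda>k :: int ^ 'n. 1 / (1 + norm (corner h k)) ^ (DIM(real ^ 'n) + 2)) abs_summable_on UNIV"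
proof -
  have "inj (corner h :: int ^ 'n \<Rightarrow> _)"
    by (intro injI corner_separated[OF h]) (use h in simp)
  hence bij: "bij_betw (corner h :: int ^ 'n \<Rightarrow> _) UNIV (range (corner h))" by (rule inj_on_imp_bij_betw)
  have "\<forall>x\<in>range (corner h :: int ^ 'n \<Rightarrow> _). \<forall>y\<in>range (corner h). dist x y < h \<longrightarrow> x = y"
    using corner_separated[OF h] by blast
  from separated_abs_summable(1)[OF h this] show ?thesis
    by (subst (asm) abs_summable_on_reindex_bij_betw[OF bij, symmetric])
qed

lemma finite_vec_box: "finite {k :: 'a ^ 'n. \<forall>i. k $ i \<in> A}" if "finite A"
proof -
  have "{k :: 'a ^ 'n. \<forall>i. k $ i \<in> A} \<subseteq> vec_lambda ` PiE UNIV (\<lambda>_. A)"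
  proof
    fix k :: "'a ^ 'n" assume "k \<in> {k. \<forall>i. k $ i \<in> A}"
    hence "vec_nth k \<in> PiE UNIV (\<lambda>_. A)" by auto
    thus "k \<in> vec_lambda ` PiE UNIV (\<lambda>_. A)" by (intro image_eqI[of _ _ "vec_nth k"]) auto
  qed
  thus ?thesis by (rule finite_subset) (intro finite_imageI finite_PiE, use that in auto)
qed

text \<open>The function \<open>f\<close> is approximated in \<open>L\<^sup>1(M)\<close> by finite combinations of indicators of dyadic cells.\<close>

lemma frequency_integral_tendsto_0:
  fixes M :: "(real ^ 'n) measure"
  assumes sets: "sets M = sets borel" and fin: "\<And>A. A \<in> bounded_borel \<Longrightarrow> emeasure M A < \<infinity>"
    and K: "integrable M (\<lambda>x. 1 / (1 + norm x) ^ K)"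
    and cells: "\<And>p k. (\<lambda>j. frequency_integral M (indicator (cell (1 / 2 ^ p) k)) (\<tau> j)) \<longlonglongrightarrow> 0"
    and f: "rapidly_decreasing f" and cont: "continuous_on UNIV f"
  shows "(\<lambda>j. frequency_integral M f (\<tau> j)) \<longlonglongrightarrow> 0"
proof -
  let ?h = "\<lambda>p::nat. 1 / 2 ^ p :: real"
  let ?n = "real CARD('n)"
  have h: "0 < ?h p" for p by simp
  \<comment> \<open>The cells with corners in the cube of half-side \<open>p\<close>: finitely many
    for each \<open>p\<close>, yet exhausting the space as \<open>p\<close> grows.\<close>
  define box where "box p = {k :: int ^ 'n. \<forall>i. k $ i \<in> {- int (p * 2 ^ p)..int (p * 2 ^ p)}}" for p
  have finbox: "finite (box p)" for p unfolding box_def by (rule finite_vec_box) auto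
  define s where "s p x = (\<Sum>k\<in>box p. f (corner (?h p) k) * indicator (cell (?h p) k) x)" for p x
  have s_eq: "s p x = (if cell_index (?h p) x \<in> box p then f (corner (?h p) (cell_index (?h p) x)) else 0)" for p x
  proof -
    have "s p x = (\<Sum>k\<in>box p. if k = cell_index (?h p) x then f (corner (?h p) (cell_index (?h p) x)) else 0)"
      unfolding s_def by (intro sum.cong refl) (auto simp: cell_def indicator_def)
    thus ?thesis by (simp add: sum.delta[OF finbox])
  qed
  note [measurable_cong] = sets
  have [measurable]: "cell (?h p) k \<in> sets borel" for p and k :: "int ^ 'n"
    by (rule bounded_borelD[OF cell_bounded_borel[OF h]])
  have [measurable]: "f \<in> borel_measurable borel" using f by (rule rapidly_decreasing_measurable)
  have sm [measurable]: "s p \<in> borel_measurable borel" for p unfolding s_def by measurable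
  have own: "x \<in> cell (?h p) (cell_index (?h p) x)" for p and x :: "real ^ 'n" by (simp add: cell_def)
  have corner_lim: "(\<lambda>p. corner (?h p) (cell_index (?h p) x)) \<longlonglongrightarrow> x" for x :: "real ^ 'n"
  proof -
    have "(\<lambda>p. ?n * (1 / 2) ^ p) \<longlonglongrightarrow> ?n * 0" by (intro tendsto_intros LIMSEQ_realpow_zero) auto
    hence lim: "(\<lambda>p. ?n * ?h p) \<longlonglongrightarrow> 0" by (simp add: power_divide)
    have "dist (corner (?h p) (cell_index (?h p) x)) x \<le> ?n * ?h p" for p
      using dist_cell_less[OF h corner_mem_cell[OF h] own] by (rule less_imp_le)
    thus ?thesis by (intro metric_tendsto_imp_tendsto[OF lim]) (auto simp: dist_real_def intro!: always_eventually)
  qed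
  have s_lim: "(\<lambda>p. s p x) \<longlonglongrightarrow> f x" for x
  proof -
    have "(\<lambda>p. f (corner (?h p) (cell_index (?h p) x))) \<longlonglongrightarrow> f x"
      using cont corner_lim by (rule continuous_on_tendsto_compose) auto
    moreover have "\<forall>\<^sub>F p in sequentially. f (corner (?h p) (cell_index (?h p) x)) = s p x"
    proof -
      \<comment> \<open>The margin 1 absorbs the rounding by the floor.\<close>
      obtain N where N: "norm x + 1 \<le> real N" using real_arch_simple by blast
      show ?thesis using eventually_ge_at_top[of N]
      proof eventually_elim
        case (elim p)
        have "cell_index (?h p) x \<in> box p"
          unfolding box_def
        proof (intro CollectI allI)
          fix i
          have "\<bar>x $ i\<bar> + 1 \<le> real p" using component_le_norm_cart[of x i] N elim by linarith
          hence "(\<bar>x $ i\<bar> + 1) * 2 ^ p \<le> real p * 2 ^ p" by (intro mult_right_mono) auto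
          hence "\<bar>x $ i\<bar> * 2 ^ p + 2 ^ p \<le> real p * 2 ^ p" by (simp add: distrib_right)
          moreover have "(1::real) \<le> 2 ^ p" by simp
          moreover have "\<bar>x $ i * 2 ^ p\<bar> = \<bar>x $ i\<bar> * 2 ^ p" "real (p * 2 ^ p) = real p * 2 ^ p"
            by (simp_all add: abs_mult)
          ultimately have "\<bar>x $ i * 2 ^ p\<bar> + 1 \<le> real (p * 2 ^ p)" by linarith
          hence "\<lfloor>x $ i * 2 ^ p\<rfloor> \<in> {- int (p * 2 ^ p)..int (p * 2 ^ p)}"
            by (simp only: atLeastAtMost_iff) linarith
          thus "cell_index (?h p) x $ i \<in> {- int (p * 2 ^ p)..int (p * 2 ^ p)}"
            by (simp add: cell_index_def)
        qed
        thus ?case by (simp add: s_eq)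
      qed
    qed
    ultimately show ?thesis by (rule Lim_transform_eventually)
  qed
  obtain D where D: "0 \<le> D" "\<And>x. cmod (f x) \<le> D / (1 + norm x) ^ K"
    using rapidly_decreasingE[OF f] by blast
  \<comment> \<open>One integrable bound for \<open>f\<close> and all its approximations: the sides
    of the cells are at most 1, so moving to the corner costs at most
    \<open>(1 + ?n) ^ K\<close>.\<close>
  let ?w = "\<lambda>x. D * (1 + ?n) ^ K * (1 / (1 + norm x) ^ K)"
  have w: "integrable M ?w" using K by (rule integrable_mult_right)
  have fw: "cmod (f (corner (?h p) (cell_index (?h p) x))) \<le> ?w x" for p x
  proof -
    let ?y = "corner (?h p) (cell_index (?h p) x)"
    have "cmod (f ?y) \<le> D / (1 + norm ?y) ^ K" by (rule D)
    also have "\<dots> \<le> D * (1 + ?n * ?h p) ^ K * (1 / (1 + norm x) ^ K)"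
      by (rule inverse_power_norm_cell_le[OF h own corner_mem_cell[OF h] D(1)])
    also have "\<dots> \<le> ?w x"
    proof (intro mult_right_mono mult_left_mono power_mono)
      have "?h p \<le> 1" by simp
      hence "?n * ?h p \<le> ?n * 1" by (intro mult_left_mono) auto
      thus "1 + ?n * ?h p \<le> 1 + ?n" by simp
    qed (use D in auto)
    finally show ?thesis .
  qed
  have w0: "0 \<le> ?w x" for x :: "real ^ 'n" using D by simp
  have sw: "cmod (s p x) \<le> ?w x" for p x unfolding s_eq using fw w0 by simp
  have fw': "cmod (f x) \<le> ?w x" for x
  proof -
    have "(1 + norm x) ^ K > 0" by (simp add: add_pos_nonneg)
    moreover have "D * 1 \<le> D * (1 + ?n) ^ K" using D(1) by (intro mult_left_mono one_le_power) auto
    ultimately have "D / (1 + norm x) ^ K \<le> D * (1 + ?n) ^ K / (1 + norm x) ^ K" by (intro divide_right_mono) auto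
    thus ?thesis using D(2)[of x] by simp
  qed
  have int_f: "integrable M f" by (rule Bochner_Integration.integrable_bound[OF w]) (use fw' w0 in \<open>auto simp del: times_divide_eq_right\<close>)
  have int_s: "integrable M (s p)" for p
    by (rule Bochner_Integration.integrable_bound[OF w]) (use sw w0 in \<open>auto simp del: times_divide_eq_right\<close>)
  have L1: "(\<lambda>p. \<integral>x. cmod (f x - s p x) \<partial>M) \<longlonglongrightarrow> (\<integral>x. 0 \<partial>M)"
  proof (rule integral_dominated_convergence[where w = "\<lambda>x. ?w x + ?w x"])
    show "integrable M (\<lambda>x. ?w x + ?w x)" by (intro Bochner_Integration.integrable_add w)
    show "AE x in M. (\<lambda>p. cmod (f x - s p x)) \<longlonglongrightarrow> 0"
    proof (rule AE_I2)
      fix x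
      have "(\<lambda>p. cmod (f x - s p x)) \<longlonglongrightarrow> cmod (f x - f x)" by (intro tendsto_intros s_lim)
      thus "(\<lambda>p. cmod (f x - s p x)) \<longlonglongrightarrow> 0" by simp
    qed
    show "AE x in M. norm (cmod (f x - s p x)) \<le> ?w x + ?w x" for p
      by (intro AE_I2) (simp only: real_norm_def abs_norm_cancel order_trans[OF norm_triangle_ineq4 add_mono[OF fw' sw]])
  qed measurable
  have s_FI: "(\<lambda>j. frequency_integral M (s p) (\<tau> j)) \<longlonglongrightarrow> 0" for p
  proof -
    have ind: "integrable M (\<lambda>x. character t x * indicator (cell (?h p) k) x)" for t and k :: "int ^ 'n"
    proof (rule Bochner_Integration.integrable_bound)
      show "integrable M (indicator (cell (?h p) k) :: _ \<Rightarrow> real)"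
        using fin[OF cell_bounded_borel[OF h, of p k]] by (intro integrable_real_indicator) auto
    qed (auto simp: norm_mult indicator_def)
    have "frequency_integral M (s p) t = (\<Sum>k\<in>box p. f (corner (?h p) k) * frequency_integral M (indicator (cell (?h p) k)) t)" for t
    proof -
      have "frequency_integral M (s p) t = (\<integral>x. (\<Sum>k\<in>box p. f (corner (?h p) k) * (character t x * indicator (cell (?h p) k) x)) \<partial>M)"
        unfolding frequency_integral_def s_def
        by (intro Bochner_Integration.integral_cong refl) (simp add: sum_distrib_left mult_ac)
      also have "\<dots> = (\<Sum>k\<in>box p. \<integral>x. f (corner (?h p) k) * (character t x * indicator (cell (?h p) k) x) \<partial>M)"
        by (intro Bochner_Integration.integral_sum integrable_mult_right ind)
      also have "\<dots> = (\<Sum>k\<in>box p. f (corner (?h p) k) * frequency_integral M (indicator (cell (?h p) k)) t)"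
        unfolding frequency_integral_def by simp
      finally show ?thesis .
    qed
    moreover have "(\<lambda>j. \<Sum>k\<in>box p. f (corner (?h p) k) * frequency_integral M (indicator (cell (?h p) k)) (\<tau> j)) \<longlonglongrightarrow>
        (\<Sum>k\<in>box p. f (corner (?h p) k) * 0)"
      by (intro tendsto_intros cells)
    ultimately show ?thesis by simp
  qed
  show ?thesis
  proof (rule LIMSEQ_I)
    fix e :: real assume e: "0 < e"
    have "\<forall>\<^sub>F p in sequentially. (\<integral>x. cmod (f x - s p x) \<partial>M) < e / 2"
      using L1 e by (intro order_tendstoD(2)) auto
    then obtain p where p: "(\<integral>x. cmod (f x - s p x) \<partial>M) < e / 2"
      using eventually_happens'[OF sequentially_bot] by blast
    obtain J where J: "\<And>j. j \<ge> J \<Longrightarrow> norm (frequency_integral M (s p) (\<tau> j) - 0) < e / 2"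
      using LIMSEQ_D[OF s_FI[of p], of "e / 2"] e by auto
    have "norm (frequency_integral M f (\<tau> j) - 0) < e" if j: "j \<ge> J" for j
    proof -
      \<comment> \<open>The error is bounded by the distance in the mean, uniformly in
        \<open>j\<close>, because characters have modulus 1. Hence \<open>p\<close> can be fixed
        before \<open>j\<close> grows.\<close>
      have "frequency_integral M f (\<tau> j) - frequency_integral M (s p) (\<tau> j) = (\<integral>x. character (\<tau> j) x * (f x - s p x) \<partial>M)"
        unfolding frequency_integral_def right_diff_distrib
        by (rule Bochner_Integration.integral_diff[symmetric]) (intro integrable_character_mult sets int_f int_s)+
      also have "cmod \<dots> \<le> (\<integral>x. cmod (f x - s p x) \<partial>M)"
        using integral_norm_bound[of M "\<lambda>x. character (\<tau> j) x * (f x - s p x)"] by (simp add: norm_mult)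
      finally have "cmod (frequency_integral M f (\<tau> j) - frequency_integral M (s p) (\<tau> j)) < e / 2" using p by simp
      moreover have "cmod (frequency_integral M f (\<tau> j)) \<le>
          cmod (frequency_integral M f (\<tau> j) - frequency_integral M (s p) (\<tau> j)) + cmod (frequency_integral M (s p) (\<tau> j))"
        using norm_triangle_ineq[of "frequency_integral M f (\<tau> j) - frequency_integral M (s p) (\<tau> j)" "frequency_integral M (s p) (\<tau> j)"] by simp
      ultimately show ?thesis using J[OF j] by simp
    qed
    thus "\<exists>J. \<forall>j\<ge>J. norm (frequency_integral M f (\<tau> j) - 0) < e" by blast
  qed
qed

section \<open>Limits of translates\<close>

lemma pairing_modulate_tendsto_discrete_part:
  fixes \<nu> :: "(real ^ 'n) set \<Rightarrow> complex"
  assumes si: "slowly_increasing \<nu>"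
  shows "\<exists>\<tau>. \<forall>f. rapidly_decreasing f \<longrightarrow> continuous_on UNIV f \<longrightarrow>
    (\<lambda>j. pairing \<nu> (\<lambda>x. character (\<tau> j) x * f x)) \<longlonglongrightarrow> pairing (discrete_part \<nu>) f"
proof -
  interpret locally_finite_complex_measure \<nu> by standard (use si in \<open>simp add: slowly_increasing_def\<close>)
  interpret C: locally_finite_complex_measure continuous_part by standard (rule complex_measure_continuous_part)
  note si' = slowly_increasing_parts[OF si]
  have cm': "complex_measure atomic_part" by (rule atoms.complex_measure_point_mass_measure)
  define S where "S = {x. \<nu> {x} \<noteq> 0}"
  have S: "countable S" unfolding S_def by (rule atoms.countable_support)
  \<comment> \<open>A natural number codes a dyadic level, a cell and a Jordan part, so that one
    choice of frequencies covers all of them. Indices beyond 3 merely repeat the last part.\<close>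
  define M where "M q = (case from_nat q :: nat \<times> (int ^ 'n) \<times> nat of (p, k, l) \<Rightarrow> jordan_part l continuous_part)" for q
  define g where "g q = (case from_nat q :: nat \<times> (int ^ 'n) \<times> nat of (p, k, l) \<Rightarrow> (indicator (cell (1 / 2 ^ p) k) :: real ^ 'n \<Rightarrow> complex))" for q
  have la: "\<exists>R. locally_integrable_atomless (M q) (g q) R" for q
  proof -
    obtain p k l where q: "(from_nat q :: nat \<times> (int ^ 'n) \<times> nat) = (p, k, l)" by (metis prod_cases3)
    have b: "cell (1 / 2 ^ p) k \<in> bounded_borel" by (rule cell_bounded_borel) simp
    then obtain R where R: "\<And>x. x \<in> cell (1 / 2 ^ p) k \<Longrightarrow> norm x \<le> R"
      unfolding bounded_borel_def bounded_iff by blast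
    have "emeasure (jordan_part l continuous_part) {x} = 0" for x
      by (simp add: C.jordan_part_singleton signed_part_def continuous_part_def)
    moreover have "integrable (jordan_part l continuous_part) (indicator (cell (1 / 2 ^ p) k) :: _ \<Rightarrow> real)"
      using C.jordan_part_finite[OF b] b by (intro integrable_real_indicator) (auto simp: bounded_borel_def)
    hence "integrable (jordan_part l continuous_part) (\<lambda>x. complex_of_real (indicator (cell (1 / 2 ^ p) k) x))"
      by (rule integrable_of_real)
    hence "integrable (jordan_part l continuous_part) (indicator (cell (1 / 2 ^ p) k) :: _ \<Rightarrow> complex)"
      by (simp only: of_real_indicator)
    moreover have "norm x < R + 1" if "(indicator (cell (1 / 2 ^ p) k) x :: complex) \<noteq> 0" for x
      using that R[of x] by (auto simp: indicator_def split: if_splits)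
    ultimately have "locally_integrable_atomless (M q) (g q) (R + 1)"
      by (simp add: locally_integrable_atomless_def M_def g_def q)
    thus ?thesis ..
  qed
  obtain \<tau> where atoms_lim: "\<forall>i. (\<lambda>j. character (\<tau> j) (from_nat_into S i)) \<longlonglongrightarrow> 1"
      and cells_lim: "\<forall>q. (\<lambda>j. frequency_integral (M q) (g q) (\<tau> j)) \<longlonglongrightarrow> 0"
    using exists_selecting_frequencies[where M = M and f = g and s = "from_nat_into S", OF la] by blast
  obtain K where K: "\<And>k. integrable (jordan_part k continuous_part) (\<lambda>x. 1 / (1 + norm x) ^ K)"
    using jordan_part_integrable_inverse_power_norm[OF si'(2)] by blast
  show ?thesis
  proof (intro exI[of _ \<tau>] allI impI)
    fix f :: "real ^ 'n \<Rightarrow> complex" assume "rapidly_decreasing f" "continuous_on UNIV f"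
    note f = this
    have FI: "(\<lambda>j. frequency_integral (jordan_part l continuous_part) f (\<tau> j)) \<longlonglongrightarrow> 0" for l
    proof (rule frequency_integral_tendsto_0[OF C.sets_jordan_part C.jordan_part_finite K _ f])
      fix p and k :: "int ^ 'n"
      have "(from_nat (to_nat (p, k, l)) :: nat \<times> (int ^ 'n) \<times> nat) = (p, k, l)" by simp
      thus "(\<lambda>j. frequency_integral (jordan_part l continuous_part) (indicator (cell (1 / 2 ^ p) k)) (\<tau> j)) \<longlonglongrightarrow> 0"
        using spec[OF cells_lim, of "to_nat (p, k, l)"] by (simp add: M_def g_def)
    qed
    let ?e = "\<lambda>j x. character (\<tau> j) x * f x"
    have r: "rapidly_decreasing (?e j)" for j by (rule rapidly_decreasing_modulate[OF f(1)])
    have "(\<lambda>j. \<Sum>k<4. jordan_coeff k * frequency_integral (jordan_part k continuous_part) f (\<tau> j)) \<longlonglongrightarrow> (\<Sum>k<4. jordan_coeff k * 0)"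
      by (intro tendsto_intros FI)
    hence c_lim: "(\<lambda>j. pairing continuous_part (?e j)) \<longlonglongrightarrow> 0"
      by (simp add: pairing_eq_jordan frequency_integral_def)
    have sp: "sum_of_point_masses S atomic_part"
      unfolding S_def by (rule atoms.sum_of_point_masses_point_mass_measure)
    have d: "(\<lambda>x. \<nu> {x} * u x) abs_summable_on S" "pairing atomic_part u = (\<Sum>\<^sub>ax\<in>S. \<nu> {x} * u x)"
      if "rapidly_decreasing u" for u
      using pairing_point_masses[OF cm' sp S integrable_jordan_part[OF si'(1) that]] by simp_all
    have "(\<lambda>j. \<Sum>\<^sub>ax\<in>S. \<nu> {x} * ?e j x) \<longlonglongrightarrow> (\<Sum>\<^sub>ax\<in>S. \<nu> {x} * f x)"
      unfolding infsetsum_def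
    proof (rule integral_dominated_convergence[where w = "\<lambda>x. cmod (\<nu> {x} * f x)"])
      show "integrable (count_space S) (\<lambda>x. cmod (\<nu> {x} * f x))"
        using abs_summable_on_normI[OF d(1)[OF f(1)]] by (simp add: abs_summable_on_def)
      show "AE x in count_space S. (\<lambda>j. \<nu> {x} * ?e j x) \<longlonglongrightarrow> \<nu> {x} * f x"
      proof (rule AE_I2)
        fix x assume "x \<in> space (count_space S)"
        then obtain i where "from_nat_into S i = x" using from_nat_into_surj[OF S] by auto
        hence "(\<lambda>j. character (\<tau> j) x) \<longlonglongrightarrow> 1" using spec[OF atoms_lim, of i] by simp
        hence "(\<lambda>j. \<nu> {x} * ?e j x) \<longlonglongrightarrow> \<nu> {x} * (1 * f x)" by (intro tendsto_intros)
        thus "(\<lambda>j. \<nu> {x} * ?e j x) \<longlonglongrightarrow> \<nu> {x} * f x" by simp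
      qed
    qed (auto simp: norm_mult)
    hence d_lim: "(\<lambda>j. pairing atomic_part (?e j)) \<longlonglongrightarrow> pairing atomic_part f"
      by (simp only: d(2)[OF r] d(2)[OF f(1)])
    have "pairing \<nu> (?e j) = pairing atomic_part (?e j) + pairing continuous_part (?e j)" for j
      by (rule pairing_add[OF cm cm' complex_measure_continuous_part])
         (auto simp: continuous_part_def[abs_def] intro!: integrable_jordan_part si si'[unfolded continuous_part_def[abs_def]] r rapidly_decreasing_measurable[OF r])
    thus "(\<lambda>j. pairing \<nu> (?e j)) \<longlonglongrightarrow> pairing (discrete_part \<nu>) f"
      unfolding discrete_part_eq using tendsto_add[OF d_lim c_lim] by simp
  qed
qed

text \<open>Each cell has diameter less than \<open>\<delta>\<close>, so it contains at most one point of each translate of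
  \<open>\<Lambda>\<close>; a cell without a point is represented by its corner with mass 0.\<close>

lemma translates_of_point_masses_subconverge:
  fixes \<Lambda> :: "(real ^ 'n) set" and c :: "real ^ 'n \<Rightarrow> complex" and \<tau> :: "nat \<Rightarrow> real ^ 'n"
  assumes \<delta>: "0 < \<delta>" and sep: "separated \<delta> \<Lambda>"
    and c: "\<And>x. x \<in> \<Lambda> \<Longrightarrow> cmod (c x) \<le> B"
  shows "\<exists>r c'. strict_mono r \<and> (\<forall>x. cmod (c' x) \<le> max B 0) \<and>
    (separated \<delta> {x. c' x \<noteq> 0}) \<and>
    (\<forall>g. rapidly_decreasing g \<longrightarrow> continuous_on UNIV g \<longrightarrow>
      (\<lambda>j. \<Sum>\<^sub>ax\<in>\<Lambda>. c x * g (x - \<tau> (r j))) \<longlonglongrightarrow> (\<Sum>\<^sub>ax\<in>{x. c' x \<noteq> 0}. c' x * g x))"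
proof -
  let ?n = "real CARD('n)"
  \<comment> \<open>For empty \<open>\<Lambda>\<close> the bound \<open>B\<close> is unconstrained
    and may be negative.\<close>
  define B' where "B' = max B 0"
  have B': "0 \<le> B'" "\<And>x. x \<in> \<Lambda> \<Longrightarrow> cmod (c x) \<le> B'" using c unfolding B'_def by (auto intro: max.coboundedI1)
  \<comment> \<open>Chosen so that the bound \<open>?n * h\<close> on the diameter of a cell is
    exactly \<open>\<delta>\<close>.\<close>
  define h where "h = \<delta> / ?n"
  have h: "0 < h" using \<delta> by (simp add: h_def)
  have nh: "?n * h = \<delta>" by (simp add: h_def)
  define occ where "occ j k \<longleftrightarrow> (\<exists>x\<in>\<Lambda>. x - \<tau> j \<in> cell h k)" for j k
  define pt where "pt j k = (SOME x. x \<in> \<Lambda> \<and> x - \<tau> j \<in> cell h k)" for j k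
  define m where "m j k = (if occ j k then c (pt j k) else 0)" for j k
  define p where "p j k = (if occ j k then pt j k - \<tau> j else corner h k)" for j k
  have pt: "pt j k \<in> \<Lambda>" "pt j k - \<tau> j \<in> cell h k" if "occ j k" for j k
    using that unfolding occ_def pt_def by (metis (mono_tags, lifting) someI_ex)+
  have pt_eq: "pt j k = x" if "x \<in> \<Lambda>" "x - \<tau> j \<in> cell h k" for j k x
  proof -
    have o: "occ j k" using that by (auto simp: occ_def)
    have "dist (pt j k - \<tau> j) (x - \<tau> j) < \<delta>" using dist_cell_less[OF h pt(2)[OF o] that(2)] nh by simp
    hence "dist (pt j k) x < \<delta>" by (simp add: dist_norm)
    thus ?thesis using sep pt(1)[OF o] that(1) by blast
  qed
  have p_cell: "p j k \<in> cell h k" for j k by (simp add: p_def pt corner_mem_cell[OF h])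
  have m_le: "cmod (m j k) \<le> B'" for j k by (simp add: m_def B' pt)
  \<comment> \<open>For each cell the masses are bounded and the positions stay in the cell; as the
    cells are countable, one subsequence makes all pairs converge.\<close>
  define X where "X j q = (m j (from_nat q), p j (from_nat q))" for j q
  have "bounded (range (\<lambda>j. X j q))" for q
  proof -
    have "range (\<lambda>j. X j q) \<subseteq> cball 0 B' \<times> cell h (from_nat q)"
      using m_le p_cell by (auto simp: X_def)
    moreover have "bounded (cball (0::complex) B' \<times> cell h (from_nat q))"
      using cell_bounded_borel[OF h] by (intro bounded_Times) (auto simp: bounded_borel_def)
    ultimately show ?thesis by (rule bounded_subset[rotated])
  qed
  then obtain r where r: "strict_mono r" "\<And>q. convergent (\<lambda>j. X (r j) q)"
    using common_convergent_subsequence by blast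
  define m' where "m' k = lim (\<lambda>j. m (r j) k)" for k
  define p' where "p' k = lim (\<lambda>j. p (r j) k)" for k
  have lims: "(\<lambda>j. m (r j) k) \<longlonglongrightarrow> m' k" "(\<lambda>j. p (r j) k) \<longlonglongrightarrow> p' k" for k
  proof -
    obtain L where L: "(\<lambda>j. X (r j) (to_nat k)) \<longlonglongrightarrow> L" using r(2)[of "to_nat k"] by (auto simp: convergent_def)
    have "(\<lambda>j. m (r j) k) \<longlonglongrightarrow> fst L" "(\<lambda>j. p (r j) k) \<longlonglongrightarrow> snd L"
      using tendsto_fst[OF L] tendsto_snd[OF L] by (simp_all add: X_def)
    thus "(\<lambda>j. m (r j) k) \<longlonglongrightarrow> m' k" "(\<lambda>j. p (r j) k) \<longlonglongrightarrow> p' k"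
      unfolding m'_def p'_def by (simp_all add: limI)
  qed
  define I where "I = {k. m' k \<noteq> 0}"
  \<comment> \<open>A limit position may leave its half-open cell, so two cells could share one. A
    nonzero limit mass forces the cell to be occupied eventually, and then the separation of
    \<open>\<Lambda>\<close> persists in the limit.\<close>
  have p'_sep: "\<delta> \<le> dist (p' k) (p' l)" if "k \<in> I" "l \<in> I" "k \<noteq> l" for k l
  proof -
    have ev: "\<forall>\<^sub>F j in sequentially. m (r j) k \<noteq> 0" if "k \<in> I" for k
      using tendsto_imp_eventually_ne[OF lims(1)[of k], of 0] that by (simp add: I_def)
    have "\<forall>\<^sub>F j in sequentially. \<delta> \<le> dist (p (r j) k) (p (r j) l)"
      using ev[OF that(1)] ev[OF that(2)]
    proof eventually_elim
      case (elim j)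
      have o: "occ (r j) k" "occ (r j) l" using elim by (auto simp: m_def split: if_splits)
      have ne: "pt (r j) k \<noteq> pt (r j) l"
        using pt(2)[OF o(1)] pt(2)[OF o(2)] that(3) by (auto simp: cell_def)
      have "\<not> dist (pt (r j) k) (pt (r j) l) < \<delta>" using sep pt(1)[OF o(1)] pt(1)[OF o(2)] ne by blast
      thus ?case using o by (simp add: p_def dist_norm)
    qed
    moreover have "(\<lambda>j. dist (p (r j) k) (p (r j) l)) \<longlonglongrightarrow> dist (p' k) (p' l)" by (intro tendsto_intros lims)
    ultimately show ?thesis by (intro tendsto_lowerbound) auto
  qed
  have inj: "inj_on p' I"
  proof (rule inj_onI, rule ccontr)
    fix k l assume "k \<in> I" "l \<in> I" "p' k = p' l" "k \<noteq> l"
    thus False using p'_sep[of k l] \<delta> by simp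
  qed
  define c' where "c' x = (if x \<in> p' ` I then m' (the_inv_into I p' x) else 0)" for x
  have c'_p': "c' (p' k) = m' k" if "k \<in> I" for k using that inj by (simp add: c'_def the_inv_into_f_f)
  have supp: "{x. c' x \<noteq> 0} = p' ` I"
  proof (intro equalityI subsetI)
    show "x \<in> p' ` I" if "x \<in> {x. c' x \<noteq> 0}" for x using that by (simp add: c'_def split: if_splits)
    show "x \<in> {x. c' x \<noteq> 0}" if "x \<in> p' ` I" for x
      using that
    proof
      fix k assume "x = p' k" "k \<in> I"
      thus ?thesis using c'_p'[of k] by (simp add: I_def)
    qed
  qed
  show ?thesis
  proof (intro exI[of _ r] exI[of _ c'] conjI)
    have "cmod (m' k) \<le> B'" for k
      by (rule tendsto_upperbound[OF tendsto_norm[OF lims(1)]]) (use m_le in auto)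
    thus "\<forall>x. cmod (c' x) \<le> max B 0" using B'(1) by (simp add: c'_def B'_def[symmetric])
    have "p' k = p' l" if "k \<in> I" "l \<in> I" "dist (p' k) (p' l) < \<delta>" for k l
      using p'_sep[OF that(1,2)] that(3) by (cases "k = l") auto
    thus "separated \<delta> {x. c' x \<noteq> 0}"
      unfolding supp by blast
    have "(\<lambda>j. \<Sum>\<^sub>ax\<in>\<Lambda>. c x * g (x - \<tau> (r j))) \<longlonglongrightarrow> (\<Sum>\<^sub>ax\<in>{x. c' x \<noteq> 0}. c' x * g x)"
      if g: "rapidly_decreasing g" "continuous_on UNIV g" for g :: "real ^ 'n \<Rightarrow> complex"
    proof -
    let ?K = "DIM(real ^ 'n) + 2"
    obtain D where D: "0 \<le> D" "\<And>x. cmod (g x) \<le> D / (1 + norm x) ^ ?K"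
      using rapidly_decreasingE[OF g(1)] by blast
    have reindex: "(\<Sum>\<^sub>ax\<in>\<Lambda>. c x * g (x - \<tau> j)) = (\<Sum>\<^sub>ak\<in>UNIV. m j k * g (p j k))" for j
    proof -
      let ?i = "\<lambda>x. cell_index h (x - \<tau> j)"
      have own: "x - \<tau> j \<in> cell h (?i x)" for x by (simp add: cell_def)
      have "inj_on ?i \<Lambda>"
      proof (rule inj_onI)
        fix x y assume xy: "x \<in> \<Lambda>" "y \<in> \<Lambda>" "?i x = ?i y"
        have "pt j (?i x) = x" by (rule pt_eq[OF xy(1) own])
        moreover have "pt j (?i x) = y" unfolding xy(3) by (rule pt_eq[OF xy(2) own])
        ultimately show "x = y" by simp
      qed
      moreover have "?i ` \<Lambda> = {k. occ j k}" by (auto simp: occ_def cell_def)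
      ultimately have bij: "bij_betw ?i \<Lambda> {k. occ j k}" by (rule bij_betw_imageI)
      have eq: "m j (?i x) * g (p j (?i x)) = c x * g (x - \<tau> j)" if x: "x \<in> \<Lambda>" for x
      proof -
        have "occ j (?i x)" using x own by (auto simp: occ_def)
        thus ?thesis by (simp add: m_def p_def pt_eq[OF x own])
      qed
      have "(\<Sum>\<^sub>ax\<in>\<Lambda>. c x * g (x - \<tau> j)) = (\<Sum>\<^sub>ax\<in>\<Lambda>. m j (?i x) * g (p j (?i x)))"
        by (rule infsetsum_cong[OF eq[symmetric] refl])
      also have "\<dots> = (\<Sum>\<^sub>ak\<in>{k. occ j k}. m j k * g (p j k))"
        by (rule infsetsum_reindex_bij_betw[OF bij])
      also have "\<dots> = (\<Sum>\<^sub>ak\<in>UNIV. m j k * g (p j k))"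
        by (rule infsetsum_cong_neutral) (auto simp: m_def)
      finally show ?thesis .
    qed
    \<comment> \<open>The bound refers to the corner instead of the moving point, hence dominates
      uniformly in \<open>j\<close>.\<close>
    let ?w = "\<lambda>k :: int ^ 'n. B' * (D * (1 + ?n * h) ^ ?K) * (1 / (1 + norm (corner h k)) ^ ?K)"
    have "(\<lambda>j. \<Sum>\<^sub>ak\<in>UNIV. m (r j) k * g (p (r j) k)) \<longlonglongrightarrow> (\<Sum>\<^sub>ak\<in>UNIV. m' k * g (p' k))"
      unfolding infsetsum_def
    proof (rule integral_dominated_convergence[where w = ?w])
      have "?w abs_summable_on UNIV" by (rule abs_summable_on_cmult_right[OF corner_abs_summable[OF h]])
      thus "integrable (count_space UNIV) ?w" by (simp only: abs_summable_on_def)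
      show "AE k in count_space UNIV. (\<lambda>j. m (r j) k * g (p (r j) k)) \<longlonglongrightarrow> m' k * g (p' k)"
        by (intro AE_I2 tendsto_mult lims continuous_on_tendsto_compose[OF g(2) lims(2)]) auto
      show "AE k in count_space UNIV. norm (m (r j) k * g (p (r j) k)) \<le> ?w k" for j
      proof (rule AE_I2)
        fix k
        have "cmod (g (p (r j) k)) \<le> D * (1 + ?n * h) ^ ?K * (1 / (1 + norm (corner h k)) ^ ?K)"
          by (rule order_trans[OF D(2) inverse_power_norm_cell_le[OF h corner_mem_cell[OF h] p_cell D(1)]])
        hence "cmod (m (r j) k) * cmod (g (p (r j) k)) \<le> B' * (D * (1 + ?n * h) ^ ?K * (1 / (1 + norm (corner h k)) ^ ?K))"
          using m_le B'(1) by (intro mult_mono) auto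
        thus "norm (m (r j) k * g (p (r j) k)) \<le> ?w k" by (simp only: norm_mult mult.assoc)
      qed
    qed auto
    also have "(\<Sum>\<^sub>ak\<in>UNIV. m' k * g (p' k)) = (\<Sum>\<^sub>ak\<in>I. c' (p' k) * g (p' k))"
      by (rule infsetsum_cong_neutral) (auto simp: I_def c'_p'[unfolded I_def])
    also have "\<dots> = (\<Sum>\<^sub>ax\<in>{x. c' x \<noteq> 0}. c' x * g x)"
      unfolding supp by (rule infsetsum_reindex_bij_betw[OF inj_on_imp_bij_betw[OF inj]])
    finally show ?thesis unfolding reindex .
    qed
    thus "\<forall>g. rapidly_decreasing g \<longrightarrow> continuous_on UNIV g \<longrightarrow>
        (\<lambda>j. \<Sum>\<^sub>ax\<in>\<Lambda>. c x * g (x - \<tau> (r j))) \<longlonglongrightarrow> (\<Sum>\<^sub>ax\<in>{x. c' x \<noteq> 0}. c' x * g x)"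
      by blast
  qed (rule r(1))
qed

text \<open>A ball of radius \<open>R\<close> contains polynomially many support points, each of
  mass at most \<open>B\<close>.\<close>

lemma separated_point_masses:
  fixes c :: "real ^ 'n \<Rightarrow> complex"
  assumes \<delta>: "0 < \<delta>" and sep: "separated \<delta> {x. c x \<noteq> 0}"
    and c: "\<And>x. cmod (c x) \<le> B"
  shows "point_masses c" and "slowly_increasing (point_mass_measure c)"
proof -
  let ?n = "DIM(real ^ 'n)"
  have B: "0 \<le> B" using order_trans[OF norm_ge_zero c] .
  let ?F = "\<lambda>R. {x \<in> {x. c x \<noteq> 0}. norm x < R}"
  have finF: "finite (?F R)" for R
  proof (cases "0 \<le> R")
    case True thus ?thesis by (rule separated_card_le(1)[OF \<delta> sep])
  next
    case False
    have "\<not> norm x < R" for x :: "real ^ 'n" using False norm_ge_zero[of x] by linarith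
    hence empty: "?F R = {}" by blast
    show ?thesis unfolding empty by (rule finite.emptyI)
  qed
  show pm: "point_masses c"
  proof
    fix R
    have "c abs_summable_on ?F R" by (rule abs_summable_on_finite[OF finF])
    moreover have "c abs_summable_on ?F R \<longleftrightarrow> c abs_summable_on {x. norm x < R}"
      by (rule abs_summable_on_cong_neutral) auto
    ultimately show "c abs_summable_on {x. norm x < R}" by blast
  qed
  interpret point_masses c by (rule pm)
  show "slowly_increasing (point_mass_measure c)"
  proof (rule slowly_increasingI[OF complex_measure_point_mass_measure])
    show "0 \<le> B * separation_const ?n \<delta>" using B separation_const_nonneg[OF \<delta>] by simp
    fix R :: real assume R: "0 \<le> R"
    have "(\<Sum>\<^sub>ax\<in>{x. norm x < R}. cmod (c x)) = (\<Sum>\<^sub>ax\<in>?F R. cmod (c x))"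
      by (rule infsetsum_cong_neutral) auto
    also have "\<dots> = (\<Sum>x\<in>?F R. cmod (c x))" using finF by (rule infsetsum_finite)
    also have "\<dots> \<le> real (card (?F R)) * B" by (rule sum_bounded_above) (rule c)
    also have "\<dots> \<le> (separation_const ?n \<delta> * (1 + R) ^ ?n) * B"
      by (intro mult_right_mono separated_card_le(2)[OF \<delta> sep R] B)
    finally have "ennreal (\<Sum>\<^sub>ax\<in>{x. norm x < R}. cmod (c x)) \<le> ennreal (B * separation_const ?n \<delta> * (1 + R) ^ ?n)"
      by (intro ennreal_leI) (simp only: mult_ac)
    with variation_point_mass_measure_le[OF open_ball_bounded_borel]
    show "variation (point_mass_measure c) {x. norm x < R} \<le> ennreal (B * separation_const ?n \<delta> * (1 + R) ^ ?n)"
      by (rule order_trans)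
  qed
qed

theorem theorem2p6:
  fixes \<mu> \<nu> :: "(real ^ 'n) set \<Rightarrow> complex" and \<Lambda> :: "(real ^ 'n) set"
  assumes "slowly_increasing \<mu>"
    and "sum_of_point_masses \<Lambda> \<mu>"
    and "\<forall>x \<in> \<Lambda>. \<mu> {x} \<noteq> 0"
    and "uniform_discrete \<Lambda>"
    and "slowly_increasing \<nu>"
    and "has_fourier_transform \<mu> \<nu>"
  shows "\<exists>\<mu>' \<Lambda>'.
           slowly_increasing \<mu>' \<and>
           sum_of_point_masses \<Lambda>' \<mu>' \<and>
           (\<forall>x \<in> \<Lambda>'. \<mu>' {x} \<noteq> 0) \<and>
           uniform_discrete \<Lambda>' \<and>
           has_fourier_transform \<mu>' (discrete_part \<nu>)"
proof -
  obtain \<delta> where \<delta>: "0 < \<delta>" and sep: "separated \<delta> \<Lambda>"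
    using assms(4) unfolding uniform_discrete_def by blast
  have \<Lambda>: "countable \<Lambda>" by (rule separated_imp_countable[OF \<delta> sep])
  obtain B where B: "\<And>x. x \<in> \<Lambda> \<Longrightarrow> cmod (\<mu> {x}) \<le> B"
    using point_masses_bounded[OF assms(6,2) \<delta> sep] by blast
  obtain \<tau> where \<tau>: "\<forall>f. rapidly_decreasing f \<longrightarrow> continuous_on UNIV f \<longrightarrow>
      (\<lambda>j. pairing \<nu> (\<lambda>x. character (\<tau> j) x * f x)) \<longlonglongrightarrow> pairing (discrete_part \<nu>) f"
    using pairing_modulate_tendsto_discrete_part[OF assms(5)] by blast
  obtain r c' where r: "strict_mono r" and c': "\<forall>x. cmod (c' x) \<le> max B 0"
      and sep': "separated \<delta> {x. c' x \<noteq> 0}"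
      and lim: "\<forall>g. rapidly_decreasing g \<longrightarrow> continuous_on UNIV g \<longrightarrow>
        (\<lambda>j. \<Sum>\<^sub>ax\<in>\<Lambda>. \<mu> {x} * g (x - \<tau> (r j))) \<longlonglongrightarrow> (\<Sum>\<^sub>ax\<in>{x. c' x \<noteq> 0}. c' x * g x)"
    using translates_of_point_masses_subconverge[where c = "\<lambda>x. \<mu> {x}" and \<tau> = \<tau>, OF \<delta> sep B] by blast
  note c' = spec[OF c']
  interpret point_masses c' by (rule separated_point_masses(1)[OF \<delta> sep' c'])
  \<comment> \<open>Restriction to nonzero masses yields the required nonvanishing; positions whose
    masses tend to 0 disappear from the support.\<close>
  let ?\<mu>' = "point_mass_measure c'" and ?\<Lambda>' = "{x. c' x \<noteq> 0}"
  have si: "slowly_increasing ?\<mu>'" by (rule separated_point_masses(2)[OF \<delta> sep' c'])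
  have sp: "sum_of_point_masses ?\<Lambda>' ?\<mu>'" by (rule sum_of_point_masses_point_mass_measure)
  have ud: "uniform_discrete ?\<Lambda>'" unfolding uniform_discrete_def using \<delta> sep' by blast
  interpret N: locally_finite_complex_measure \<nu> by standard (use assms(5) in \<open>simp add: slowly_increasing_def\<close>)
  \<comment> \<open>One sequence, the pairings of \<open>\<nu>\<close> with the modulated
    \<open>f\<close> along \<open>r\<close>, has two limits: the discrete part by the choice of
    \<open>\<tau>\<close>, and the limit measure by the convergence of the translates.\<close>
  have "pairing (discrete_part \<nu>) f = pairing ?\<mu>' (fourier f)" if f: "schwartz f" for f
  proof (rule LIMSEQ_unique)
    have "(\<lambda>j. pairing \<nu> (\<lambda>x. character (\<tau> j) x * f x)) \<longlonglongrightarrow> pairing (discrete_part \<nu>) f"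
      by (intro \<tau>[rule_format] schwartz_rapidly_decreasing schwartz_continuous f)
    from LIMSEQ_subseq_LIMSEQ[OF this r]
    show "(\<lambda>j. \<Sum>\<^sub>ax\<in>\<Lambda>. \<mu> {x} * fourier f (x - \<tau> (r j))) \<longlonglongrightarrow> pairing (discrete_part \<nu>) f"
      by (simp only: o_def fourier_pairing_modulate(2)[OF assms(6,2) \<Lambda> f])
    have rd: "rapidly_decreasing (fourier f)" by (rule rapidly_decreasing_fourier[OF f])
    have "pairing ?\<mu>' (fourier f) = (\<Sum>\<^sub>ax\<in>?\<Lambda>'. ?\<mu>' {x} * fourier f x)"
      by (intro pairing_point_masses(2) complex_measure_point_mass_measure sp countable_support
          integrable_jordan_part[OF si rd])
    thus "(\<lambda>j. \<Sum>\<^sub>ax\<in>\<Lambda>. \<mu> {x} * fourier f (x - \<tau> (r j))) \<longlonglongrightarrow> pairing ?\<mu>' (fourier f)"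
      using lim[rule_format, OF rd continuous_fourier[OF schwartz_rapidly_decreasing[OF f]]] by simp
  qed
  hence "has_fourier_transform ?\<mu>' (discrete_part \<nu>)"
    using si N.slowly_increasing_parts(1)[OF assms(5)] by (simp add: has_fourier_transform_def N.discrete_part_eq)
  moreover have "\<forall>x\<in>?\<Lambda>'. ?\<mu>' {x} \<noteq> 0" by simp
  ultimately show ?thesis using si sp ud by blast
qed

end
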